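(* For $n\geq 3$, let $r=r(n)\geq 3$ be an integer and let $\boldsymbol{k}=\boldsymbol{k}(n)=(k_1,\ldots,k_n)$ be a vector of nonnegative integers, where each $k_j=k_j(n)$ may depend on $n$. Let $k_{\max}=k_{\max}(n)=\max_{j=1}^n k_j$, $M=M(n)=\sum_{j=1}^n k_j$ and $M_2=M_2(n)=\sum_{j=1}^n k_j(k_j-1)$ for all $n\geq 3$. Suppose that the set \[ \mathcal{I}=\{n\geq 3 \mid r(n)\text{ divides } M(n)\}\] is infinite, and that $M\to\infty$ and $r^4k_{\max}^4(k_{\max}+r)=o(M)$ as $n$ tends to infinity along elements of $\mathcal{I}$. Let $\mathcal{L}_r(\boldsymbol{k})$ be the set of all linear $r$-uniform hypergraphs on the vertex set $[n]=\{1,\ldots,n\}$ with degree sequence $\boldsymbol{k}$. Then, as $n\to\infty$ along $\mathcal{I}$, \[ |\mathcal{L}_r(\boldsymbol{k})| = \frac{M!}{(M/r)!\,(r!)^{M/r}\,\prod_{i=1}^n k_i!}\,\exp\left(-\frac{(r-1)M_2}{2M}-\frac{(r-1)^2M_2^2}{4M^2}+O\left(\frac{r^4k_{\max}^4(k_{\max}+r)}{M}\right)\right).\]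
   Context: A hypergraph is a pair $(V,E)$ where $V$ is a finite set and $E$ is a multiset of multisubsets of $V$ (the edges). A vertex with multiplicity at least 2 in an edge is a loop in that edge. A hypergraph is simple if it has no loops and no repeated edges (so $E$ is a set of subsets of $V$). A hypergraph is linear if it has no loops and each pair of distinct edges intersects in at most one vertex; linear hypergraphs are simple, i.e. they also have no repeated edges. A hypergraph is $r$-uniform if every edge contains exactly $r$ vertices (counting multiplicities). Degree sequence $\boldsymbol{k}$ means that vertex $j$ has degree $k_j$ (the number of edges containing $j$, for a simple hypergraph) for $j=1,\ldots,n$. *)

theory Defs
  imports Complex_Main "HOL-Library.Multiset" "HOL-Library.Landau_Symbols"
begin

type_synonym 'a hypergraph = "'a set \<times> 'a multiset multiset"

definition hypergraph :: "'a hypergraph \<Rightarrow> bool" where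
  "hypergraph H \<longleftrightarrow> finite (fst H) \<and> (\<forall>e \<in># snd H. set_mset e \<subseteq> fst H)"

definition loop_in :: "'a \<Rightarrow> 'a multiset \<Rightarrow> bool" where
  "loop_in v e \<longleftrightarrow> count e v \<ge> 2"

definition simple_hypergraph :: "'a hypergraph \<Rightarrow> bool" where
  "simple_hypergraph H \<longleftrightarrow> (\<forall>e \<in># snd H. \<not> (\<exists>v. loop_in v e)) \<and> (\<forall>e \<in># snd H. count (snd H) e = 1)"

text \<open>Quantifying over elements of the edge multiset does not see two copies of the same edge;
  these are excluded by \<open>simple_hypergraph\<close>.\<close>

definition linear_hypergraph :: "'a hypergraph \<Rightarrow> bool" where
  "linear_hypergraph H \<longleftrightarrow> simple_hypergraph H \<and>
     (\<forall>e \<in># snd H. \<forall>f \<in># snd H. e \<noteq> f \<longrightarrow> card (set_mset e \<inter> set_mset f) \<le> 1)"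

definition uniform_hypergraph :: "nat \<Rightarrow> 'a hypergraph \<Rightarrow> bool" where
  "uniform_hypergraph r H \<longleftrightarrow> (\<forall>e \<in># snd H. size e = r)"

text \<open>The number of edges containing \<open>v\<close>. This is the degree only in the absence of loops, which is
  the only case in which it is used below.\<close>

definition hypergraph_degree :: "'a hypergraph \<Rightarrow> 'a \<Rightarrow> nat" where
  "hypergraph_degree H v = size (filter_mset (\<lambda>e. v \<in># e) (snd H))"

text \<open>A vector of length \<open>n\<close> is a function of which only the values on \<open>{1..n}\<close> are used.\<close>

definition linear_hypergraphs :: "nat \<Rightarrow> nat \<Rightarrow> (nat \<Rightarrow> nat) \<Rightarrow> nat hypergraph set" where
  "linear_hypergraphs n r k =
     {H. hypergraph H \<and> fst H = {1..n} \<and> linear_hypergraph H \<and> uniform_hypergraph r H \<and> (\<forall>j \<in> {1..n}. hypergraph_degree H j = k j)}"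

definition deg_max :: "nat \<Rightarrow> (nat \<Rightarrow> nat) \<Rightarrow> nat" where
  "deg_max n k = Max (k ` {1..n})"

definition deg_sum :: "nat \<Rightarrow> (nat \<Rightarrow> nat) \<Rightarrow> nat" where
  "deg_sum n k = (\<Sum>j = 1..n. k j)"

text \<open>Truncated subtraction is harmless here, as the summand vanishes for \<open>k j = 0\<close>.\<close>

definition deg_sum2 :: "nat \<Rightarrow> (nat \<Rightarrow> nat) \<Rightarrow> nat" where
  "deg_sum2 n k = (\<Sum>j = 1..n. k j * (k j - 1))"

text \<open>The filter for \<open>n \<rightarrow> \<infinity>\<close> along the elements of \<open>I\<close>.\<close>

definition along :: "nat set \<Rightarrow> nat filter" where
  "along I = inf sequentially (principal I)"

text \<open>Finiteness ensures that \<open>card\<close> has its intended meaning on \<open>linear_hypergraphs\<close>.\<close>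

lemma finite_linear_hypergraphs: "finite (linear_hypergraphs n r k)"
proof -
  let ?A = "{e :: nat multiset. set_mset e \<subseteq> {1..n} \<and> size e = r}"
  have "?A \<subseteq> mset ` {xs. set xs \<subseteq> {1..n} \<and> length xs = r}"
  proof
    fix e assume "e \<in> ?A"
    moreover obtain xs where "e = mset xs" by (metis ex_mset)
    ultimately show "e \<in> mset ` {xs. set xs \<subseteq> {1..n} \<and> length xs = r}" by auto
  qed
  then have A: "finite ?A"
    by (rule finite_subset) (simp add: finite_lists_length_eq)
  have "linear_hypergraphs n r k \<subseteq> (\<lambda>S. ({1..n}, mset_set S)) ` Pow ?A"
  proof
    fix H assume H: "H \<in> linear_hypergraphs n r k"
    have "snd H = mset_set (set_mset (snd H))"
    proof (rule multiset_eqI)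
      fix e show "count (snd H) e = count (mset_set (set_mset (snd H))) e"
        using H by (cases "e \<in># snd H")
          (auto simp: linear_hypergraphs_def linear_hypergraph_def simple_hypergraph_def not_in_iff)
    qed
    moreover have "set_mset (snd H) \<in> Pow ?A"
      using H by (auto simp: linear_hypergraphs_def hypergraph_def uniform_hypergraph_def)
    moreover have "fst H = {1..n}"
      using H by (simp add: linear_hypergraphs_def)
    ultimately show "H \<in> (\<lambda>S. ({1..n}, mset_set S)) ` Pow ?A"
      by (metis (no_types, lifting) image_eqI prod.collapse)
  qed
  then show ?thesis
    by (rule finite_subset) (use A in simp)
qed

end

theory Submission
  imports Defs "HOL-Library.FuncSet" "HOL-Combinatorics.Permutations"
begin

text \<open>In the configuration model, vertex \<open>i\<close> has \<open>k i\<close> points, each of the \<open>M / r\<close> edges has \<open>r\<close> slots, and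
  each linear hypergraph arises from \<open>(M / r)! (r!) ^ (M / r) (\<Prod>i. k i!)\<close> bijections from points to slots.
  These are the bijections that avoid a family of small partial matchings, the loops and the 4-cycles.

  Order this family. The probability of avoiding all of it is the product of the factors \<open>1 - p\<close>, where
  \<open>p\<close> is the probability of containing a pattern given that the earlier ones are avoided. Exchanging two
  slots of a bijection shows that \<open>p\<close> differs from the unconditional probability only by a factor
  \<open>1 + O(k\<^sub>m\<^sub>a\<^sub>x\<^sup>2 r\<^sup>2 / M)\<close>: from above as in the lopsided Local Lemma, and from below since few patterns
  overlap. The unconditional probabilities sum to \<open>\<Lambda> = O(k\<^sub>m\<^sub>a\<^sub>x\<^sup>2 r\<^sup>2)\<close>, so the probability is
  \<open>exp (- \<Lambda> + O(k\<^sub>m\<^sub>a\<^sub>x\<^sup>4 r\<^sup>4 / M))\<close>.\<close>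

section \<open>Bijections avoiding partial matchings\<close>

text \<open>The obstacle is that \<open>\<Lambda>\<close> need not be bounded: it may grow like
  k_max^2 r^2, so a fixed number of terms of inclusion-exclusion, or an additive error in each
  factor, is not accurate enough. Taking logarithms turns a relative error in p into an error
  proportional to p, and these errors sum to \<open>\<Lambda>\<close> times the relative error. The
  quadratic term of log (1 - p) is of the same kind, because p itself is small. The two exchanges
  are not symmetric. Moving a prescribed incidence away cannot create a pattern that does not touch
  it. Creating the incidence may complete a pattern, but then the original bijection satisfies one
  prescription more than the two matchings have together. The additional factor 1 / M, summed over
  all patterns, costs only \<open>\<Lambda> / M\<close>, which is again of the order of the
  admissible relative error. Repeated edges need no patterns of their own: two equal edges with at
  least two vertices already form a 4-cycle.\<close>

definition bijections :: "'a set \<Rightarrow> 'b set \<Rightarrow> ('a \<Rightarrow> 'b) set" where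
  "bijections A B = {f \<in> extensional A. bij_betw f A B}"

lemma finite_bijections:
  assumes "finite A" "finite B"
  shows "finite (bijections A B)"
proof (rule finite_subset)
  show "bijections A B \<subseteq> PiE A (\<lambda>_. B)"
    by (auto simp: bijections_def PiE_def bij_betw_def)
  show "finite (PiE A (\<lambda>_. B))"
    using assms by (simp add: finite_PiE)
qed

lemma card_bijections:
  assumes "finite A" "finite B" "card A = card B"
  shows "card (bijections A B) = fact (card A)"
proof -
  obtain g where g: "bij_betw g A B"
    using assms finite_same_card_bij by blast
  have "bij_betw (\<lambda>p. restrict (g \<circ> p) A) {p. p permutes A} (bijections A B)"
  proof (rule bij_betwI')
    fix p q assume p: "p \<in> {p. p permutes A}" and q: "q \<in> {p. p permutes A}"
    show "(restrict (g \<circ> p) A = restrict (g \<circ> q) A) = (p = q)"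
    proof
      assume eq: "restrict (g \<circ> p) A = restrict (g \<circ> q) A"
      show "p = q"
      proof
        fix x show "p x = q x"
        proof (cases "x \<in> A")
          case True
          then have "g (p x) = g (q x)" using fun_cong[OF eq, of x] by simp
          moreover have "p x \<in> A" "q x \<in> A" using p q True by (auto simp: permutes_in_image)
          ultimately show ?thesis using g by (auto simp: bij_betw_def inj_on_def)
        next
          case False
          then show ?thesis using p q by (auto simp: permutes_not_in)
        qed
      qed
    qed simp
  next
    fix p assume "p \<in> {p. p permutes A}"
    then have "bij_betw (g \<circ> p) A B"
      using g bij_betw_trans permutes_imp_bij by blast
    then show "restrict (g \<circ> p) A \<in> bijections A B"
      by (auto simp: bijections_def cong: bij_betw_cong)
  next
    fix f assume f: "f \<in> bijections A B"
    let ?h = "inv_into A g"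
    let ?p = "\<lambda>x. if x \<in> A then ?h (f x) else x"
    have "bij_betw (?h \<circ> f) A A"
      using f g bij_betw_inv_into bij_betw_trans unfolding bijections_def by blast
    then have "bij_betw ?p A A" by (rule bij_betw_cong[THEN iffD1, rotated]) auto
    then have "?p permutes A" by (rule bij_imp_permutes) auto
    moreover have "f = restrict (g \<circ> ?p) A"
    proof
      fix x show "f x = restrict (g \<circ> ?p) A x"
      proof (cases "x \<in> A")
        case True
        then have "f x \<in> B" using f by (auto simp: bijections_def bij_betw_def)
        then show ?thesis using True g by (simp add: bij_betw_def f_inv_into_f)
      next
        case False
        then show ?thesis using f by (auto simp: bijections_def extensional_def)
      qed
    qed
    ultimately show "\<exists>p\<in>{p. p permutes A}. f = restrict (g \<circ> p) A" by blast
  qed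
  then show ?thesis
    using assms card_permutations[of A "card A"] by (simp add: bij_betw_same_card[symmetric])
qed

definition agrees :: "('a \<Rightarrow> 'b) \<Rightarrow> ('a \<times> 'b) set \<Rightarrow> bool" where
  "agrees f \<phi> \<longleftrightarrow> (\<forall>(a, b)\<in>\<phi>. f a = b)"

lemma agrees_empty [simp]: "agrees f {}"
  and agrees_insert [simp]: "agrees f (insert (a, b) \<phi>) \<longleftrightarrow> f a = b \<and> agrees f \<phi>"
  and agrees_Un [simp]: "agrees f (\<phi> \<union> \<psi>) \<longleftrightarrow> agrees f \<phi> \<and> agrees f \<psi>"
  by (simp_all add: agrees_def ball_Un)

lemma agreesI: "(\<And>a b. (a, b) \<in> \<phi> \<Longrightarrow> f a = b) \<Longrightarrow> agrees f \<phi>"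
  by (auto simp: agrees_def)

lemma agreesD: "agrees f \<phi> \<Longrightarrow> (a, b) \<in> \<phi> \<Longrightarrow> f a = b"
  by (auto simp: agrees_def)

lemma not_in_fst_image: "x \<notin> fst ` \<phi> \<Longrightarrow> (a, b) \<in> \<phi> \<Longrightarrow> a \<noteq> x"
  and not_in_snd_image: "y \<notin> snd ` \<phi> \<Longrightarrow> (a, b) \<in> \<phi> \<Longrightarrow> b \<noteq> y"
  by force+

text \<open>Matchings that touch without a common incidence contradict each other
  (\<open>N_conflict\<close>), so that among touching patterns only those with a common incidence
  cause real losses.\<close>

definition touches :: "('a \<times> 'b) set \<Rightarrow> ('a \<times> 'b) set \<Rightarrow> bool" where
  "touches \<phi> \<chi> \<longleftrightarrow> fst ` \<phi> \<inter> fst ` \<chi> \<noteq> {} \<or> snd ` \<phi> \<inter> snd ` \<chi> \<noteq> {}"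

definition falling :: "nat \<Rightarrow> nat \<Rightarrow> real" where
  "falling M d = (\<Prod>i<d. real M - real i)"

lemma falling_0 [simp]: "falling M 0 = 1"
  and falling_Suc: "falling M (Suc d) = falling M d * (real M - real d)"
  by (simp_all add: falling_def)

lemma falling_pos: "d \<le> M \<Longrightarrow> falling M d > 0"
  by (auto simp: falling_def intro!: prod_pos)

locale matching_space =
  fixes A :: "'a set" and B :: "'b set" and M :: nat
  assumes finite_A: "finite A" and finite_B: "finite B"
    and card_A: "card A = M" and card_B: "card B = M"
begin

definition avoiding :: "('a \<times> 'b) set set \<Rightarrow> ('a \<times> 'b) set \<Rightarrow> ('a \<Rightarrow> 'b) set" where
  "avoiding S \<phi> = {f \<in> bijections A B. agrees f \<phi> \<and> (\<forall>\<chi>\<in>S. \<not> agrees f \<chi>)}"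

text \<open>The quotient \<open>N S \<phi> / N S {}\<close> is the conditional probability of
  containing \<open>\<phi>\<close> given that \<open>S\<close> is avoided.\<close>

abbreviation N :: "('a \<times> 'b) set set \<Rightarrow> ('a \<times> 'b) set \<Rightarrow> real" where
  "N S \<phi> \<equiv> real (card (avoiding S \<phi>))"

definition swap_slots :: "'b \<Rightarrow> 'b \<Rightarrow> ('a \<Rightarrow> 'b) \<Rightarrow> 'a \<Rightarrow> 'b" where
  "swap_slots s t f = restrict (\<lambda>a. transpose s t (f a)) A"

lemma finite_avoiding [simp]: "finite (avoiding S \<phi>)"
  by (rule finite_subset[OF _ finite_bijections[OF finite_A finite_B]]) (auto simp: avoiding_def)

lemma N_mono: "S' \<subseteq> S \<Longrightarrow> N S \<phi> \<le> N S' \<phi>"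
  unfolding of_nat_le_iff by (rule card_mono[OF finite_avoiding]) (auto simp: avoiding_def)

lemma N_empty: "N {} {} = fact M"
  using card_bijections[OF finite_A finite_B] by (simp add: avoiding_def card_A card_B)

lemma N_insert: "N (insert \<chi> S) {} = N S {} - N S \<chi>"
proof -
  have "avoiding S {} = avoiding (insert \<chi> S) {} \<union> avoiding S \<chi>"
    by (auto simp: avoiding_def)
  moreover have "avoiding (insert \<chi> S) {} \<inter> avoiding S \<chi> = {}"
    by (auto simp: avoiding_def)
  ultimately have "card (avoiding S {}) = card (avoiding (insert \<chi> S) {}) + card (avoiding S \<chi>)"
    by (simp add: card_Un_disjoint)
  then show ?thesis by simp
qed

text \<open>A bijection that avoids \<open>S'\<close> but not \<open>S\<close> contains some pattern
  of \<open>S - S'\<close>. This is the price of putting discarded patterns back.\<close>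

lemma N_le_Un:
  assumes "finite S"
  shows "N S' \<phi> \<le> N S \<phi> + (\<Sum>\<chi>\<in>S - S'. N S' (\<phi> \<union> \<chi>))"
proof -
  have "avoiding S' \<phi> \<subseteq> avoiding S \<phi> \<union> (\<Union>\<chi>\<in>S - S'. avoiding S' (\<phi> \<union> \<chi>))"
    by (auto simp: avoiding_def)
  then have "card (avoiding S' \<phi>) \<le> card (avoiding S \<phi> \<union> (\<Union>\<chi>\<in>S - S'. avoiding S' (\<phi> \<union> \<chi>)))"
    using assms by (intro card_mono) auto
  also have "\<dots> \<le> card (avoiding S \<phi>) + card (\<Union>\<chi>\<in>S - S'. avoiding S' (\<phi> \<union> \<chi>))"
    by (rule card_Un_le)
  also have "\<dots> \<le> card (avoiding S \<phi>) + (\<Sum>\<chi>\<in>S - S'. card (avoiding S' (\<phi> \<union> \<chi>)))"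
    using assms by (intro add_left_mono card_UN_le) auto
  finally have "real (card (avoiding S' \<phi>)) \<le> real (card (avoiding S \<phi>) + (\<Sum>\<chi>\<in>S - S'. card (avoiding S' (\<phi> \<union> \<chi>))))"
    by (simp only: of_nat_le_iff)
  then show ?thesis by simp
qed

section \<open>Exchanging two slots of a bijection\<close>

lemma avoiding_inj:
  assumes "f \<in> avoiding S \<phi>" "a \<in> A" "a' \<in> A" "f a = f a'"
  shows "a = a'"
  using assms by (auto simp: avoiding_def bijections_def bij_betw_def inj_on_def)

lemma avoiding_in: "f \<in> avoiding S \<phi> \<Longrightarrow> a \<in> A \<Longrightarrow> f a \<in> B"
  by (auto simp: avoiding_def bijections_def bij_betw_def)

lemma swap_slots_bijections:
  assumes "f \<in> bijections A B" "s \<in> B" "t \<in> B"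
  shows "swap_slots s t f \<in> bijections A B"
proof -
  have "bij_betw (transpose s t) B B"
    using assms permutes_imp_bij permutes_swap_id by metis
  then have "bij_betw (transpose s t \<circ> f) A B"
    using assms bij_betw_trans unfolding bijections_def by blast
  then have "bij_betw (swap_slots s t f) A B"
    by (rule bij_betw_cong[THEN iffD1, rotated]) (auto simp: swap_slots_def)
  then show ?thesis by (auto simp: bijections_def swap_slots_def)
qed

lemma swap_slots_inject:
  assumes "f \<in> bijections A B" "g \<in> bijections A B" "swap_slots s t f = swap_slots s t g"
  shows "f = g"
proof
  fix a show "f a = g a"
  proof (cases "a \<in> A")
    case True
    then have "transpose s t (f a) = transpose s t (g a)"
      using fun_cong[OF assms(3), of a] by (simp add: swap_slots_def)
    then show ?thesis by (metis transpose_involutory)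
  qed (use assms in \<open>auto simp: bijections_def extensional_def\<close>)
qed

lemma N_conflict:
  assumes "\<phi> \<subseteq> A \<times> B" "(a, b) \<in> \<phi>" "(a', b') \<in> \<phi>" "(a = a') \<noteq> (b = b')"
  shows "N S \<phi> = 0"
proof -
  have "avoiding S \<phi> = {}"
  proof (rule ccontr)
    assume "avoiding S \<phi> \<noteq> {}"
    then obtain f where f: "f \<in> avoiding S \<phi>" by blast
    then have "f a = b" "f a' = b'" using assms by (auto simp: avoiding_def agrees_def)
    then show False using assms avoiding_inj[OF f, of a a'] by auto
  qed
  then show ?thesis by simp
qed

text \<open>Exchanging the slots \<open>s\<close> and \<open>t\<close> moves \<open>x\<close> from \<open>s\<close> to an arbitrary free slot \<open>t\<close>. Every new
  incidence involves \<open>x\<close> or \<open>s\<close>, so no pattern of \<open>S\<close> is created.\<close>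

lemma N_step_upper:
  assumes \<phi>: "\<phi> \<subseteq> A \<times> B" and x: "x \<in> A" "x \<notin> fst ` \<phi>" and s: "s \<in> B" "s \<notin> snd ` \<phi>"
    and S: "\<And>\<chi>. \<chi> \<in> S \<Longrightarrow> \<chi> \<subseteq> A \<times> B \<and> x \<notin> fst ` \<chi> \<and> s \<notin> snd ` \<chi>"
  shows "(real M - real (card \<phi>)) * N S (insert (x, s) \<phi>) \<le> N S \<phi>"
proof -
  have fin: "finite \<phi>" using \<phi> finite_A finite_B finite_subset by blast
  let ?T = "B - snd ` \<phi>" and ?X = "avoiding S (insert (x, s) \<phi>)"
  have "inj_on (\<lambda>(f, t). swap_slots s t f) (?X \<times> ?T)"
  proof (rule inj_onI, clarify)
    fix f t g u assume f: "f \<in> ?X" and g: "g \<in> ?X" and eq: "swap_slots s t f = swap_slots s u g"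
    \<comment> \<open>The exchanged bijection sends \<open>x\<close> to \<open>t\<close>, so its
      value at \<open>x\<close> recovers \<open>t\<close>, and undoing the exchange recovers
      \<open>f\<close>.\<close>
    have "t = u" using fun_cong[OF eq, of x] f g x by (auto simp: swap_slots_def avoiding_def)
    moreover from this have "f = g" using eq f g swap_slots_inject by (auto simp: avoiding_def)
    ultimately show "f = g \<and> t = u" by simp
  qed
  moreover have "(\<lambda>(f, t). swap_slots s t f) ` (?X \<times> ?T) \<subseteq> avoiding S \<phi>"
  proof clarify
    fix f t assume f: "f \<in> ?X" and t: "t \<in> B" "t \<notin> snd ` \<phi>"
    let ?f = "swap_slots s t f"
    have fx: "f x = s" using f by (auto simp: avoiding_def)
    have "agrees ?f \<phi>" unfolding agrees_def
    proof clarify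
      fix a b assume ab: "(a, b) \<in> \<phi>"
      have "f a = b" using f ab by (auto simp: avoiding_def agrees_def)
      moreover have "a \<in> A" using ab \<phi> by auto
      moreover have "b \<noteq> s" "b \<noteq> t" using ab s t not_in_snd_image by metis+
      ultimately show "?f a = b" by (simp add: swap_slots_def)
    qed
    moreover have "\<not> agrees ?f \<chi>" if \<chi>: "\<chi> \<in> S" for \<chi>
    proof
      assume ag: "agrees ?f \<chi>"
      \<comment> \<open>Besides \<open>x\<close>, the exchange affects only the occupant of
        \<open>t\<close>, which moves into \<open>s\<close>. As \<open>\<chi>\<close> uses neither
        \<open>x\<close> nor \<open>s\<close>, all its incidences were present before.\<close>
      have "agrees f \<chi>" unfolding agrees_def
      proof clarify
        fix a b assume ab: "(a, b) \<in> \<chi>"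
        have 1: "?f a = b" using ag ab by (rule agreesD)
        have 2: "a \<in> A" using ab S[OF \<chi>] by auto
        have 3: "a \<noteq> x" "b \<noteq> s" using ab S[OF \<chi>] not_in_fst_image not_in_snd_image by metis+
        have "f a \<noteq> s" using avoiding_inj[OF f _ x(1), of a] fx 2 3 by auto
        then show "f a = b" using 1 2 3 by (auto simp: swap_slots_def transpose_def split: if_splits)
      qed
      then show False using f \<chi> by (auto simp: avoiding_def)
    qed
    moreover have "?f \<in> bijections A B" using f t s by (intro swap_slots_bijections) (auto simp: avoiding_def)
    ultimately show "?f \<in> avoiding S \<phi>" by (auto simp: avoiding_def)
  qed
  ultimately have "card (?X \<times> ?T) \<le> card (avoiding S \<phi>)"
    by (rule card_inj_on_le) simp
  then have 1: "real (card ?X) * real (card ?T) \<le> N S \<phi>"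
    by (metis card_cartesian_product of_nat_le_iff of_nat_mult)
  have "M - card \<phi> \<le> card ?T"
    using diff_card_le_card_Diff[of "snd ` \<phi>" B] card_image_le[OF fin, of snd] fin card_B by simp
  then have "real M - real (card \<phi>) \<le> real (card ?T)" by linarith
  then have "(real M - real (card \<phi>)) * real (card ?X) \<le> real (card ?T) * real (card ?X)"
    by (intro mult_right_mono) auto
  with 1 show ?thesis by (simp add: mult.commute)
qed

text \<open>Growing \<open>\<phi>\<close> by one incidence at a time, \<open>N_step_upper\<close>
  supplies the factors M, M - 1, and so on. If a new incidence contradicts an earlier one, the count
  is 0. This case does occur: the matchings that describe failed exchanges may be
  contradictory.\<close>

lemma N_upper_untouched:
  assumes \<phi>: "\<phi> \<subseteq> A \<times> B" "card \<phi> \<le> M"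
    and S: "\<And>\<chi>. \<chi> \<in> S \<Longrightarrow> \<chi> \<subseteq> A \<times> B \<and> \<not> touches \<phi> \<chi>"
  shows "falling M (card \<phi>) * N S \<phi> \<le> N S {}"
proof -
  have fin: "finite \<phi>" using \<phi> finite_A finite_B finite_subset by blast
  from fin \<phi> S show ?thesis
  proof (induction \<phi> rule: finite_induct)
    case (insert p \<phi>)
    obtain x s where p: "p = (x, s)" by (cases p)
    have cd: "card (insert p \<phi>) = Suc (card \<phi>)" using insert by simp
    have IH: "falling M (card \<phi>) * N S \<phi> \<le> N S {}"
      using insert.prems insert.hyps by (intro insert.IH) (auto simp: touches_def)
    show ?case
    proof (cases "x \<in> fst ` \<phi> \<or> s \<in> snd ` \<phi>")
      case True
      then obtain a b where ab: "(a, b) \<in> \<phi>" "a = x \<or> b = s" by force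
      then have "(a = x) \<noteq> (b = s)" using insert.hyps p by auto
      then have "N S (insert p \<phi>) = 0"
        using ab p insert.prems by (intro N_conflict[of _ a b x s]) auto
      then show ?thesis by simp
    next
      case False
      then have "(real M - real (card \<phi>)) * N S (insert (x, s) \<phi>) \<le> N S \<phi>"
        using insert.prems p by (intro N_step_upper) (auto simp: touches_def)
      then have "falling M (card \<phi>) * ((real M - real (card \<phi>)) * N S (insert p \<phi>)) \<le> falling M (card \<phi>) * N S \<phi>"
        unfolding p using falling_pos[of "card \<phi>" M] insert.prems cd by (intro mult_left_mono) auto
      also note IH
      finally show ?thesis by (simp only: cd falling_Suc mult.assoc)
    qed
  qed simp
qed

text \<open>The opposite exchange puts \<open>x\<close> into \<open>s\<close> and the previous occupant \<open>y\<close> of \<open>s\<close> into the old slot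
  \<open>u\<close> of \<open>x\<close>. It fails only if \<open>(y, u)\<close> completes a pattern; the double sum counts these failures.\<close>

lemma N_step_lower:
  assumes \<phi>: "\<phi> \<subseteq> A \<times> B" "inj_on snd \<phi>" and x: "x \<in> A" "x \<notin> fst ` \<phi>" and s: "s \<in> B" "s \<notin> snd ` \<phi>"
    and S: "finite S" "\<And>\<chi>. \<chi> \<in> S \<Longrightarrow> \<chi> \<subseteq> A \<times> B \<and> x \<notin> fst ` \<chi> \<and> s \<notin> snd ` \<chi>"
  shows "N S \<phi> \<le> (real M - real (card \<phi>)) * N S (insert (x, s) \<phi>)
    + (\<Sum>\<chi>\<in>S. \<Sum>(y, u)\<in>\<chi>. N S (\<phi> \<union> {(x, u), (y, s)} \<union> (\<chi> - {(y, u)})))"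
proof -
  have finS: "finite \<chi>" if "\<chi> \<in> S" for \<chi>
    using S(2)[OF that] finite_A finite_B finite_subset by blast
  have fin: "finite \<phi>" using \<phi> finite_A finite_B finite_subset by blast
  let ?T = "B - snd ` \<phi>" and ?X = "avoiding S (insert (x, s) \<phi>)" and ?G = "avoiding S \<phi>"
  let ?E = "\<lambda>\<chi> (y, u). avoiding S (\<phi> \<union> {(x, u), (y, s)} \<union> (\<chi> - {(y, u)}))"
  define g where "g f = swap_slots s (f x) f" for f
  define Z where "Z = {f \<in> ?G. \<exists>\<chi>\<in>S. agrees (g f) \<chi>}"
  have gx: "g f x = s" if "f \<in> ?G" for f
    using x by (simp add: g_def swap_slots_def)
  have gb: "g f \<in> bijections A B" if "f \<in> ?G" for f
    unfolding g_def using that s avoiding_in[OF that x(1)]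
    by (intro swap_slots_bijections) (auto simp: avoiding_def)
  have "inj_on (\<lambda>f. (g f, f x)) (?G - Z)"
  proof (rule inj_onI)
    fix f h assume f: "f \<in> ?G - Z" and h: "h \<in> ?G - Z" and eq: "(g f, f x) = (g h, h x)"
    then have "swap_slots s (f x) f = swap_slots s (f x) h" unfolding g_def prod.inject by metis
    then show "f = h" using f h swap_slots_inject by (auto simp: avoiding_def)
  qed
  moreover have "(\<lambda>f. (g f, f x)) ` (?G - Z) \<subseteq> ?X \<times> ?T"
  proof clarify
    fix f assume f: "f \<in> ?G" "f \<notin> Z"
    have fx: "f x \<in> B" "f x \<notin> snd ` \<phi>"
    proof -
      show "f x \<in> B" using avoiding_in f x by blast
      show "f x \<notin> snd ` \<phi>"
      proof
        assume "f x \<in> snd ` \<phi>"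
        then obtain a where a: "(a, f x) \<in> \<phi>" by force
        then have "f a = f x" using f by (auto simp: avoiding_def agrees_def)
        moreover have "a \<in> A" using a \<phi> by auto
        ultimately have "a = x" using avoiding_inj f x by metis
        then show False using a x by force
      qed
    qed
    have "agrees (g f) \<phi>" unfolding agrees_def
    proof clarify
      fix a b assume ab: "(a, b) \<in> \<phi>"
      have "f a = b" using f ab by (auto simp: avoiding_def agrees_def)
      moreover have "a \<in> A" using ab \<phi> by auto
      moreover have "b \<noteq> s" "b \<noteq> f x" using ab s fx not_in_snd_image by metis+
      ultimately show "g f a = b" by (simp add: g_def swap_slots_def)
    qed
    then have "g f \<in> ?X" using f gx[OF f(1)] gb[OF f(1)] by (auto simp: avoiding_def Z_def)
    then show "g f \<in> ?X \<and> f x \<in> ?T" using fx by simp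
  qed
  ultimately have "card (?G - Z) \<le> card (?X \<times> ?T)"
    by (rule card_inj_on_le) (use finite_B in simp)
  \<comment> \<open>In this direction the number of free slots is needed from above, which is where
    \<open>inj_on snd \<phi>\<close> enters.\<close>
  moreover have "real (card ?T) = real M - real (card \<phi>)"
  proof -
    have sub: "snd ` \<phi> \<subseteq> B" using \<phi> by auto
    then have "card ?T = card B - card (snd ` \<phi>)"
      using finite_B by (intro card_Diff_subset) (auto intro: finite_subset)
    moreover have "card (snd ` \<phi>) = card \<phi>" using \<phi> by (simp add: card_image)
    moreover have "card (snd ` \<phi>) \<le> card B" using sub finite_B by (rule card_mono[rotated])
    ultimately show ?thesis using card_B by simp
  qed
  ultimately have 1: "real (card (?G - Z)) \<le> (real M - real (card \<phi>)) * real (card ?X)"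
    by (metis card_cartesian_product of_nat_le_iff of_nat_mult mult.commute)
  have "Z \<subseteq> (\<Union>\<chi>\<in>S. \<Union>p\<in>\<chi>. ?E \<chi> p)"
  proof
    fix f assume "f \<in> Z"
    then obtain \<chi> where f: "f \<in> ?G" and \<chi>: "\<chi> \<in> S" "agrees (g f) \<chi>" by (auto simp: Z_def)
    have inj: "a = a'" if "f a = f a'" "a \<in> A" "a' \<in> A" for a a'
      using avoiding_inj[OF f] that by blast
    have "\<not> agrees f \<chi>" using f \<chi> by (auto simp: avoiding_def)
    then obtain y u where yu: "(y, u) \<in> \<chi>" "f y \<noteq> u" by (auto simp: agrees_def)
    have b: "a \<in> A" "a \<noteq> x" "b \<noteq> s" "g f a = b" if "(a, b) \<in> \<chi>" for a b
    proof -
      show "a \<in> A" using that S(2)[OF \<chi>(1)] by auto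
      show "a \<noteq> x" "b \<noteq> s" using that S(2)[OF \<chi>(1)] not_in_fst_image not_in_snd_image by metis+
      show "g f a = b" using \<chi>(2) that by (rule agreesD)
    qed
    \<comment> \<open>The exchange changes \<open>f\<close> only at \<open>x\<close> and at the
      occupant of \<open>s\<close>. Since \<open>\<chi>\<close> does not use \<open>x\<close>, an
      incidence of \<open>\<chi>\<close> that is missing in \<open>f\<close> belongs to that
      occupant, and its slot \<open>u\<close> is the one that \<open>x\<close> has given up.\<close>
    have fy: "f y = s" "f x = u"
      using b[OF yu(1)] yu(2) by (auto simp: g_def swap_slots_def transpose_def split: if_splits)
    have "agrees f (\<chi> - {(y, u)})"
    proof (rule agreesI)
      fix a b' assume "(a, b') \<in> \<chi> - {(y, u)}"
      then have ab: "(a, b') \<in> \<chi>" "\<not> (a = y \<and> b' = u)" by auto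
      then have "a \<noteq> y" using b(4)[OF ab(1)] b(4)[OF yu(1)] by auto
      then have "f a \<noteq> s" using inj[of a y] fy b(1)[OF ab(1)] b(1)[OF yu(1)] by auto
      then show "f a = b'" using b[OF ab(1)] by (auto simp: g_def swap_slots_def transpose_def split: if_splits)
    qed
    then have "f \<in> ?E \<chi> (y, u)" using f fy by (auto simp: avoiding_def)
    then show "f \<in> (\<Union>\<chi>\<in>S. \<Union>p\<in>\<chi>. ?E \<chi> p)" using \<chi>(1) yu(1) by blast
  qed
  then have "card Z \<le> card (\<Union>\<chi>\<in>S. \<Union>p\<in>\<chi>. ?E \<chi> p)"
    using S(1) finS by (intro card_mono) auto
  also have "\<dots> \<le> (\<Sum>\<chi>\<in>S. card (\<Union>p\<in>\<chi>. ?E \<chi> p))"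
    using S(1) by (rule card_UN_le)
  also have "\<dots> \<le> (\<Sum>\<chi>\<in>S. \<Sum>p\<in>\<chi>. card (?E \<chi> p))"
    using finS by (intro sum_mono card_UN_le)
  finally have "real (card Z) \<le> real (\<Sum>\<chi>\<in>S. \<Sum>p\<in>\<chi>. card (?E \<chi> p))"
    by (simp only: of_nat_le_iff)
  also have "\<dots> = (\<Sum>\<chi>\<in>S. \<Sum>(y, u)\<in>\<chi>. N S (\<phi> \<union> {(x, u), (y, s)} \<union> (\<chi> - {(y, u)})))"
    by (simp add: case_prod_unfold)
  finally have 2: "real (card Z) \<le> \<dots>" .
  have "card ?G = card (?G - Z) + card Z"
    using card_Diff_subset[of Z ?G] card_mono[of ?G Z] finite_subset[of Z ?G] by (auto simp: Z_def)
  then show ?thesis using 1 2 by simp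
qed

end

section \<open>Local estimates for families of patterns\<close>

lemma falling_add: "falling M (a + b) = falling M a * (\<Prod>j<b. real M - real a - real j)"
  by (induction b) (simp_all add: falling_Suc algebra_simps)

lemma falling_le_power: "d \<le> M \<Longrightarrow> falling M d \<le> real M ^ d"
  unfolding falling_def by (rule order_trans[OF prod_mono[where g = "\<lambda>_. real M"]]) auto

text \<open>Each factor is at least M - 8, because a + j < 8, and Bernoulli's inequality bounds (1 -
  8 / M)^b from below by 1 - 64 / 128. Hence the bound 128 on M.\<close>

lemma falling_shift_lower:
  assumes "a + b \<le> 8" "M \<ge> 128"
  shows "(\<Prod>j<b. real M - real a - real j) \<ge> real M ^ b / 2"
proof -
  have "(1/2 :: real) \<le> 1 + real b * (- 8 / real M)"
  proof -
    have "real b * (8 / real M) \<le> 8 * (8 / 128)"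
      using assms by (intro mult_mono divide_left_mono) auto
    then show ?thesis by simp
  qed
  also have "\<dots> \<le> (1 + (- 8 / real M)) ^ b"
    using assms by (intro Bernoulli_inequality) (auto simp: field_simps)
  finally have 1: "(1/2 :: real) \<le> (1 + (- 8 / real M)) ^ b" .
  have "real M ^ b / 2 \<le> real M ^ b * (1 + (- 8 / real M)) ^ b"
    using mult_left_mono[OF 1, of "real M ^ b"] by simp
  also have "\<dots> = (real M - 8) ^ b"
    using assms by (simp add: power_mult_distrib[symmetric] algebra_simps)
  also have "\<dots> = (\<Prod>j<b. real M - 8)" by simp
  also have "\<dots> \<le> (\<Prod>j<b. real M - real a - real j)"
    using assms by (intro prod_mono) auto
  finally show ?thesis .
qed

lemma falling_lower: "d \<le> 8 \<Longrightarrow> M \<ge> 128 \<Longrightarrow> falling M d \<ge> real M ^ d / 2"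
  using falling_shift_lower[of 0 d M] by (simp add: falling_def)

text \<open>\<open>1 / falling M d\<close> is the probability that a uniform bijection contains a given partial matching
  of size \<open>d\<close>. As \<open>\<zeta>\<close> will be small, \<open>overlap\<close> also prevents a pattern from containing another one.
  The bound \<open>4\<close> on the size of patterns keeps all partial matchings below within size \<open>8\<close>.\<close>

locale pattern_family = matching_space A B M
  for A :: "'a set" and B :: "'b set" and M :: nat +
  fixes F :: "('a \<times> 'b) set set" and \<kappa> \<zeta> :: real
  assumes finite_F: "finite F"
    and pattern: "\<chi> \<in> F \<Longrightarrow> \<chi> \<subseteq> A \<times> B \<and> \<chi> \<noteq> {} \<and> card \<chi> \<le> 4 \<and> inj_on fst \<chi> \<and> inj_on snd \<chi>"
    and touch_fst: "x \<in> A \<Longrightarrow> (\<Sum>\<chi> | \<chi> \<in> F \<and> x \<in> fst ` \<chi>. 1 / falling M (card \<chi>)) \<le> \<kappa>"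
    and touch_snd: "s \<in> B \<Longrightarrow> (\<Sum>\<chi> | \<chi> \<in> F \<and> s \<in> snd ` \<chi>. 1 / falling M (card \<chi>)) \<le> \<kappa>"
    and overlap: "\<phi> \<in> F \<Longrightarrow> (\<Sum>\<chi> | \<chi> \<in> F \<and> \<chi> \<noteq> \<phi> \<and> \<chi> \<inter> \<phi> \<noteq> {}. 1 / falling M (card (\<phi> \<union> \<chi>)))
        \<le> \<zeta> / falling M (card \<phi>)"
    and M_ge: "M \<ge> 128" and \<kappa>_nonneg: "\<kappa> \<ge> 0" and \<kappa>_le: "\<kappa> \<le> 1 / 128"
begin

section \<open>Sums of pattern weights\<close>

definition \<Lambda> :: real where "\<Lambda> = (\<Sum>\<chi>\<in>F. 1 / falling M (card \<chi>))"

lemma finite_pattern: "\<chi> \<subseteq> A \<times> B \<Longrightarrow> finite \<chi>"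
  using finite_A finite_B finite_subset by blast

lemma falling_pos8: "d \<le> 8 \<Longrightarrow> falling M d > 0"
  using M_ge by (intro falling_pos) simp

lemma weight_nonneg: "\<chi> \<in> F \<Longrightarrow> 1 / falling M (card \<chi>) \<ge> 0"
  using pattern[of \<chi>] falling_pos8[of "card \<chi>"] by (simp add: less_imp_le)

text \<open>A pattern that touches \<open>\<phi>\<close> uses one of its points or slots. There are
  at most \<open>2 * card \<phi>\<close> of these, and each accounts for at most
  \<open>\<kappa>\<close>.\<close>

lemma touch_sum:
  assumes \<phi>: "\<phi> \<subseteq> A \<times> B"
  shows "(\<Sum>\<chi> | \<chi> \<in> F \<and> touches \<phi> \<chi>. 1 / falling M (card \<chi>)) \<le> 2 * real (card \<phi>) * \<kappa>"
proof -
  let ?w = "\<lambda>\<chi>. 1 / falling M (card (\<chi> :: ('a \<times> 'b) set))"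
  let ?t = "\<lambda>p \<chi>. (if fst p \<in> fst ` \<chi> then ?w \<chi> else 0) + (if snd p \<in> snd ` \<chi> then ?w \<chi> else 0)"
  have fin: "finite \<phi>" using \<phi> by (rule finite_pattern)
  have t0: "0 \<le> ?t p \<chi>" if "\<chi> \<in> F" for p \<chi>
    using weight_nonneg[OF that] by auto
  have "(\<Sum>\<chi> | \<chi> \<in> F \<and> touches \<phi> \<chi>. ?w \<chi>) \<le> (\<Sum>\<chi> | \<chi> \<in> F \<and> touches \<phi> \<chi>. \<Sum>p\<in>\<phi>. ?t p \<chi>)"
  proof (rule sum_mono)
    fix \<chi> assume "\<chi> \<in> {\<chi> \<in> F. touches \<phi> \<chi>}"
    then have \<chi>: "\<chi> \<in> F" "touches \<phi> \<chi>" by auto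
    then obtain p where p: "p \<in> \<phi>" "fst p \<in> fst ` \<chi> \<or> snd p \<in> snd ` \<chi>"
      by (auto simp: touches_def)
    have "?w \<chi> \<le> ?t p \<chi>" using p weight_nonneg[OF \<chi>(1)] by auto
    also have "\<dots> \<le> (\<Sum>p\<in>\<phi>. ?t p \<chi>)"
      using fin p t0[OF \<chi>(1)] by (intro member_le_sum) auto
    finally show "?w \<chi> \<le> (\<Sum>p\<in>\<phi>. ?t p \<chi>)" .
  qed
  also have "\<dots> \<le> (\<Sum>\<chi>\<in>F. \<Sum>p\<in>\<phi>. ?t p \<chi>)"
    using finite_F t0 by (intro sum_mono2 sum_nonneg) auto
  also have "\<dots> = (\<Sum>p\<in>\<phi>. \<Sum>\<chi>\<in>F. ?t p \<chi>)" by (rule sum.swap)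
  also have "\<dots> \<le> (\<Sum>p\<in>\<phi>. \<kappa> + \<kappa>)"
  proof (rule sum_mono)
    fix p assume "p \<in> \<phi>"
    then have "fst p \<in> A" "snd p \<in> B" using \<phi> by auto
    then show "(\<Sum>\<chi>\<in>F. ?t p \<chi>) \<le> \<kappa> + \<kappa>"
      unfolding sum.distrib sum.inter_filter[OF finite_F, symmetric]
      by (intro add_mono touch_fst touch_snd)
  qed
  finally show ?thesis by (simp add: algebra_simps)
qed

text \<open>Every pattern is nonempty and is therefore counted at one of the M points at least. In
  \<open>N_lower_untouched\<close> this turns a sum over all patterns, divided by M, into
  \<open>\<kappa>\<close>.\<close>

lemma \<Lambda>_le: "\<Lambda> \<le> real M * \<kappa>"
proof -
  let ?w = "\<lambda>\<chi>. 1 / falling M (card (\<chi> :: ('a \<times> 'b) set))"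
  have "\<Lambda> \<le> (\<Sum>\<chi>\<in>F. \<Sum>x\<in>A. if x \<in> fst ` \<chi> then ?w \<chi> else 0)"
    unfolding \<Lambda>_def
  proof (rule sum_mono)
    fix \<chi> assume \<chi>: "\<chi> \<in> F"
    then obtain x where x: "x \<in> fst ` \<chi>" "x \<in> A" using pattern[OF \<chi>] by fastforce
    then have "?w \<chi> = (if x \<in> fst ` \<chi> then ?w \<chi> else 0)" by simp
    also have "\<dots> \<le> (\<Sum>x\<in>A. if x \<in> fst ` \<chi> then ?w \<chi> else 0)"
      using finite_A x weight_nonneg[OF \<chi>] by (intro member_le_sum) auto
    finally show "?w \<chi> \<le> (\<Sum>x\<in>A. if x \<in> fst ` \<chi> then ?w \<chi> else 0)" .
  qed
  also have "\<dots> = (\<Sum>x\<in>A. \<Sum>\<chi>\<in>F. if x \<in> fst ` \<chi> then ?w \<chi> else 0)" by (rule sum.swap)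
  also have "\<dots> \<le> (\<Sum>x\<in>A. \<kappa>)"
    unfolding sum.inter_filter[OF finite_F, symmetric] by (intro sum_mono touch_fst)
  finally show ?thesis by (simp add: card_A)
qed

lemma weight_le_\<kappa>:
  assumes \<chi>: "\<chi> \<in> F"
  shows "1 / falling M (card \<chi>) \<le> \<kappa>"
proof -
  obtain x where x: "x \<in> fst ` \<chi>" "x \<in> A" using pattern[OF \<chi>] by fastforce
  have "1 / falling M (card \<chi>) \<le> (\<Sum>\<chi> | \<chi> \<in> F \<and> x \<in> fst ` \<chi>. 1 / falling M (card \<chi>))"
    using x \<chi> finite_F weight_nonneg by (intro member_le_sum) auto
  also have "\<dots> \<le> \<kappa>" using x by (intro touch_fst)
  finally show ?thesis .
qed

text \<open>The bound 1 / 128 on \<open>\<kappa>\<close> is chosen so that the factor in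
  \<open>N_upper\<close> is at least 3 / 4 for all matchings of size at most 8.\<close>

lemma four_d_\<kappa>: "d \<le> 8 \<Longrightarrow> 4 * real d * \<kappa> \<le> 1 / 4"
  using mult_mono[of "4 * real d" 32 \<kappa> "1/128"] \<kappa>_le \<kappa>_nonneg by simp

text \<open>The induction of the Lovasz Local Lemma: discarding the patterns that touch \<open>\<phi>\<close> makes
  \<open>N_upper_untouched\<close> applicable, and by the induction hypothesis costs little.\<close>

lemma N_upper:
  assumes "S \<subseteq> F" "\<phi> \<subseteq> A \<times> B" "card \<phi> \<le> 8"
  shows "(1 - 4 * real (card \<phi>) * \<kappa>) * (falling M (card \<phi>) * N S \<phi>) \<le> N S {}"
  using assms
proof (induction "card S" arbitrary: S \<phi> rule: less_induct)
  case less
  have finS: "finite S" using less.prems finite_F finite_subset by blast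
  let ?w = "\<lambda>\<chi>. 1 / falling M (card (\<chi> :: ('a \<times> 'b) set))"
  define S' where "S' = {\<chi> \<in> S. \<not> touches \<phi> \<chi>}"
  have S': "S' \<subseteq> S" by (auto simp: S'_def)
  have c: "4 * real (card \<phi>) * \<kappa> \<le> 1 / 4" using four_d_\<kappa> less.prems by blast
  have fpos: "falling M (card \<phi>) > 0" using falling_pos8 less.prems by blast
  have "falling M (card \<phi>) * N S \<phi> \<le> falling M (card \<phi>) * N S' \<phi>"
    using N_mono[OF S'] fpos by (intro mult_left_mono) auto
  also have "\<dots> \<le> N S' {}"
    using less.prems M_ge pattern by (intro N_upper_untouched) (auto simp: S'_def)
  finally have 1: "falling M (card \<phi>) * N S \<phi> \<le> N S' {}" .
  have "N S' {} \<le> N S {} + (\<Sum>\<chi>\<in>S - S'. N S' ({} \<union> \<chi>))" by (rule N_le_Un[OF finS])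
  also have "(\<Sum>\<chi>\<in>S - S'. N S' ({} \<union> \<chi>)) \<le> (\<Sum>\<chi>\<in>S - S'. 2 * N S' {} * ?w \<chi>)"
  proof (rule sum_mono)
    fix \<chi> assume \<chi>: "\<chi> \<in> S - S'"
    then have F: "\<chi> \<in> F" using less.prems by auto
    have "card S' < card S" using \<chi> S' finS by (intro psubset_card_mono) auto
    then have "(1 - 4 * real (card \<chi>) * \<kappa>) * (falling M (card \<chi>) * N S' \<chi>) \<le> N S' {}"
      using pattern[OF F] S' less.prems by (intro less.hyps) auto
    moreover have "(1/2) * (falling M (card \<chi>) * N S' \<chi>) \<le> (1 - 4 * real (card \<chi>) * \<kappa>) * (falling M (card \<chi>) * N S' \<chi>)"
      using four_d_\<kappa>[of "card \<chi>"] pattern[OF F] falling_pos8[of "card \<chi>"] by (intro mult_right_mono mult_nonneg_nonneg) auto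
    ultimately have "falling M (card \<chi>) * N S' \<chi> \<le> 2 * N S' {}" by linarith
    then show "N S' ({} \<union> \<chi>) \<le> 2 * N S' {} * ?w \<chi>"
      using falling_pos8[of "card \<chi>"] pattern[OF F] by (simp add: field_simps)
  qed
  also have "\<dots> = 2 * N S' {} * (\<Sum>\<chi>\<in>S - S'. ?w \<chi>)" by (simp add: sum_distrib_left)
  \<comment> \<open>The 4 of the statement is 2 * 2: one 2 from dividing by the factor of the
    induction hypothesis, which is at least 1 / 2, and one from \<open>touch_sum\<close>.\<close>
  also have "\<dots> \<le> 2 * N S' {} * (2 * real (card \<phi>) * \<kappa>)"
  proof (rule mult_left_mono)
    have "(\<Sum>\<chi>\<in>S - S'. ?w \<chi>) \<le> (\<Sum>\<chi> | \<chi> \<in> F \<and> touches \<phi> \<chi>. ?w \<chi>)"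
      using less.prems finite_F weight_nonneg by (intro sum_mono2) (auto simp: S'_def)
    also have "\<dots> \<le> 2 * real (card \<phi>) * \<kappa>" using less.prems by (intro touch_sum) auto
    finally show "(\<Sum>\<chi>\<in>S - S'. ?w \<chi>) \<le> 2 * real (card \<phi>) * \<kappa>" .
  qed simp
  finally have 2: "(1 - 4 * real (card \<phi>) * \<kappa>) * N S' {} \<le> N S {}" by (simp add: algebra_simps)
  have "(1 - 4 * real (card \<phi>) * \<kappa>) * (falling M (card \<phi>) * N S \<phi>) \<le> (1 - 4 * real (card \<phi>) * \<kappa>) * N S' {}"
    using 1 c by (intro mult_left_mono) auto
  with 2 show ?case by linarith
qed

text \<open>The crude form for terms that are already small, where a constant factor does not
  matter.\<close>

lemma N_upper2:
  assumes "S \<subseteq> F" "\<phi> \<subseteq> A \<times> B" "card \<phi> \<le> 8"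
  shows "N S \<phi> \<le> 2 * N S {} * (1 / falling M (card \<phi>))"
proof -
  have "(1/2) * (falling M (card \<phi>) * N S \<phi>) \<le> (1 - 4 * real (card \<phi>) * \<kappa>) * (falling M (card \<phi>) * N S \<phi>)"
    using four_d_\<kappa>[of "card \<phi>"] assms falling_pos8[of "card \<phi>"] by (intro mult_right_mono mult_nonneg_nonneg) auto
  with N_upper[OF assms] have "falling M (card \<phi>) * N S \<phi> \<le> 2 * N S {}" by linarith
  then show ?thesis
    using falling_pos8[of "card \<phi>"] assms by (simp add: field_simps)
qed

lemma \<Lambda>_nonneg: "\<Lambda> \<ge> 0"
  unfolding \<Lambda>_def by (intro sum_nonneg weight_nonneg)

text \<open>Here \<open>\<rho>\<close> grows to \<open>\<phi>\<close> by steps of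
  \<open>N_step_lower\<close>. A failure caused by \<open>\<chi>\<close> prescribes one incidence
  more than \<open>\<rho>\<close> and \<open>\<chi>\<close> have together, so its probability is
  about 1 / M times the product of their weights. Summed over \<open>S\<close> this gives the weight
  of \<open>\<rho>\<close> times \<open>\<Lambda> / M\<close>, and
  \<open>\<Lambda> / M \<le> \<kappa>\<close>.\<close>

lemma N_lower_untouched:
  assumes S: "S \<subseteq> F" and \<phi>: "\<phi> \<in> F" and untouched: "\<And>\<chi>. \<chi> \<in> S \<Longrightarrow> \<not> touches \<phi> \<chi>"
    and \<rho>: "\<rho> \<subseteq> \<phi>"
  shows "N S {} * (1 - 16 * real (card \<rho>) * \<kappa>) \<le> falling M (card \<rho>) * N S \<rho>"
proof -
  have \<phi>': "\<phi> \<subseteq> A \<times> B" "card \<phi> \<le> 4" "inj_on fst \<phi>" "inj_on snd \<phi>" using pattern[OF \<phi>] by auto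
  have fin\<phi>: "finite \<phi>" using \<phi>' by (intro finite_pattern) auto
  have finS: "finite S" using S finite_F finite_subset by blast
  have "finite \<rho>" using \<rho> fin\<phi> finite_subset by blast
  then show ?thesis using \<rho>
  proof (induction \<rho> rule: finite_induct)
    case (insert p \<rho>)
    obtain x s where p: "p = (x, s)" by (cases p)
    let ?i = "card \<rho>"
    have cd: "card (insert p \<rho>) = Suc ?i" using insert by simp
    then have i: "?i \<le> 3" using card_mono[OF fin\<phi> insert.prems] \<phi>' by simp
    have fi: "falling M ?i > 0" using i by (intro falling_pos8) simp
    have xs: "x \<in> A" "s \<in> B" "(x, s) \<in> \<phi>" using insert.prems \<phi>' p by auto
    have x: "x \<notin> fst ` \<rho>"
      using insert.hyps insert.prems \<phi>'(3) p by (force simp: inj_on_def)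
    have s: "s \<notin> snd ` \<rho>"
      using insert.hyps insert.prems \<phi>'(4) p by (force simp: inj_on_def)
    have S1: "\<chi> \<subseteq> A \<times> B" "x \<notin> fst ` \<chi>" "s \<notin> snd ` \<chi>" "\<chi> \<inter> \<phi> = {}" "card \<chi> \<le> 4" "finite \<chi>" "\<chi> \<in> F" if "\<chi> \<in> S" for \<chi>
    proof -
      show F: "\<chi> \<in> F" using that S by auto
      then show \<chi>: "\<chi> \<subseteq> A \<times> B" "card \<chi> \<le> 4" using pattern by auto
      then show "finite \<chi>" by (intro finite_pattern)
      show "x \<notin> fst ` \<chi>" "s \<notin> snd ` \<chi>" "\<chi> \<inter> \<phi> = {}"
        using untouched[OF that] xs by (force simp: touches_def)+
    qed
    have \<rho>: "\<rho> \<subseteq> A \<times> B" "inj_on snd \<rho>" using insert.prems \<phi>' by (auto intro: inj_on_subset)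
    have "N S \<rho> \<le> (real M - real ?i) * N S (insert (x, s) \<rho>)
      + (\<Sum>\<chi>\<in>S. \<Sum>(y, u)\<in>\<chi>. N S (\<rho> \<union> {(x, u), (y, s)} \<union> (\<chi> - {(y, u)})))"
      using S1 \<rho> xs x s finS by (intro N_step_lower) auto
    also have "(\<Sum>\<chi>\<in>S. \<Sum>(y, u)\<in>\<chi>. N S (\<rho> \<union> {(x, u), (y, s)} \<union> (\<chi> - {(y, u)})))
      \<le> (\<Sum>\<chi>\<in>S. \<Sum>(y, u)\<in>\<chi>. 4 * N S {} / (falling M ?i * real M) * (1 / falling M (card \<chi>)))"
    proof (intro sum_mono, clarify)
      fix \<chi> y u assume \<chi>: "\<chi> \<in> S" and yu: "(y, u) \<in> \<chi>"
      let ?\<psi> = "\<rho> \<union> {(x, u), (y, s)} \<union> (\<chi> - {(y, u)})"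
      have yx: "y \<noteq> x" "u \<noteq> s" using S1[OF \<chi>] yu not_in_fst_image not_in_snd_image by metis+
      have yu': "y \<in> A" "u \<in> B" using S1(1)[OF \<chi>] yu by auto
      let ?R = "\<rho> \<union> (\<chi> - {(y, u)})"
      have finR: "finite ?R" using S1(6)[OF \<chi>] insert.hyps by simp
      \<comment> \<open>No incidences may coincide here: if \<open>?\<psi>\<close> were any smaller
        than \<open>?i + card \<chi> + 1\<close>, the saving of 1 / M would be lost.\<close>
      have n1: "(x, u) \<notin> insert (y, s) ?R" using yx x S1(2)[OF \<chi>] by force
      have n2: "(y, s) \<notin> ?R" using s S1(3)[OF \<chi>] by force
      have cR: "card ?R = ?i + card (\<chi> - {(y, u)})"
      proof (rule card_Un_disjoint)
        show "\<rho> \<inter> (\<chi> - {(y, u)}) = {}" using S1(4)[OF \<chi>] insert.prems by blast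
      qed (use S1(6)[OF \<chi>] insert.hyps in simp_all)
      have "?\<psi> = insert (x, u) (insert (y, s) ?R)" by blast
      then have "card ?\<psi> = card (insert (x, u) (insert (y, s) ?R))" by (rule arg_cong)
      also have "\<dots> = Suc (Suc (card ?R))"
        using finR n1 n2 by (simp only: card_insert_disjoint finite_insert not_False_eq_True)
      also have "\<dots> = ?i + Suc (Suc (card (\<chi> - {(y, u)})))" unfolding cR by simp
      also have "\<dots> = ?i + (card \<chi> + 1)"
        using card.remove[OF S1(6)[OF \<chi>] yu] by simp
      finally have c\<psi>: "card ?\<psi> = ?i + (card \<chi> + 1)" .
      have c8: "?i + (card \<chi> + 1) \<le> 8" using i S1(5)[OF \<chi>] by simp
      have f: "falling M ?i * (falling M (card \<chi>) * real M / 2) \<le> falling M (card ?\<psi>)"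
        unfolding c\<psi> falling_add[of M ?i]
      proof (rule mult_left_mono)
        have "falling M (card \<chi>) * real M / 2 \<le> real M ^ card \<chi> * real M / 2"
          using falling_le_power[of "card \<chi>" M] S1(5)[OF \<chi>] M_ge by (intro divide_right_mono mult_right_mono) auto
        also have "\<dots> = real M ^ (card \<chi> + 1) / 2" by simp
        also have "\<dots> \<le> (\<Prod>j<card \<chi> + 1. real M - real ?i - real j)"
          by (rule falling_shift_lower[OF c8 M_ge])
        finally show "falling M (card \<chi>) * real M / 2 \<le> (\<Prod>j<card \<chi> + 1. real M - real ?i - real j)" .
      qed (use fi in simp)
      have fc: "falling M (card \<chi>) > 0" using S1(5)[OF \<chi>] by (intro falling_pos8) simp
      have "N S ?\<psi> \<le> 2 * N S {} * (1 / falling M (card ?\<psi>))"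
      proof (rule N_upper2[OF S])
        show "?\<psi> \<subseteq> A \<times> B" using \<rho>(1) S1(1)[OF \<chi>] xs yu' by blast
        show "card ?\<psi> \<le> 8" unfolding c\<psi> by (rule c8)
      qed
      also have "\<dots> \<le> 2 * N S {} * (1 / (falling M ?i * (falling M (card \<chi>) * real M / 2)))"
      proof (intro mult_left_mono divide_left_mono f mult_pos_pos)
        show "0 < falling M (card ?\<psi>)" unfolding c\<psi> by (rule falling_pos8[OF c8])
      qed (use fi fc M_ge in auto)
      also have "\<dots> = 4 * N S {} / (falling M ?i * real M) * (1 / falling M (card \<chi>))"
        by simp
      finally show "N S ?\<psi> \<le> \<dots>" .
    qed
    also have "\<dots> = (\<Sum>\<chi>\<in>S. real (card \<chi>) * (4 * N S {} / (falling M ?i * real M) * (1 / falling M (card \<chi>))))"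
      by (simp add: case_prod_unfold)
    also have "\<dots> \<le> (\<Sum>\<chi>\<in>S. 4 * (4 * N S {} / (falling M ?i * real M) * (1 / falling M (card \<chi>))))"
      using S1 fi weight_nonneg by (intro sum_mono mult_right_mono mult_nonneg_nonneg) auto
    \<comment> \<open>The 16 is a product of 4 choices of the completing incidence in
      \<open>\<chi>\<close>, the 2 of \<open>N_upper2\<close> and the 2 lost in comparing falling
      factorials with powers.\<close>
    also have "\<dots> = 16 * N S {} / (falling M ?i * real M) * (\<Sum>\<chi>\<in>S. 1 / falling M (card \<chi>))"
      by (simp add: sum_distrib_left)
    also have "\<dots> \<le> 16 * N S {} / (falling M ?i * real M) * (real M * \<kappa>)"
    proof (rule mult_left_mono)
      have "(\<Sum>\<chi>\<in>S. 1 / falling M (card \<chi>)) \<le> \<Lambda>"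
        unfolding \<Lambda>_def using S finite_F weight_nonneg by (intro sum_mono2) auto
      then show "(\<Sum>\<chi>\<in>S. 1 / falling M (card \<chi>)) \<le> real M * \<kappa>" using \<Lambda>_le by linarith
    qed (use fi in simp)
    also have "\<dots> = 16 * N S {} * \<kappa> / falling M ?i" using M_ge by simp
    finally have "N S \<rho> \<le> (real M - real ?i) * N S (insert (x, s) \<rho>) + 16 * N S {} * \<kappa> / falling M ?i" by simp
    then have "falling M ?i * N S \<rho> \<le> falling M ?i * ((real M - real ?i) * N S (insert (x, s) \<rho>)) + 16 * N S {} * \<kappa>"
      using fi by (simp add: field_simps)
    moreover have "N S {} * (1 - 16 * real ?i * \<kappa>) \<le> falling M ?i * N S \<rho>"
      using insert.prems by (intro insert.IH) auto
    ultimately have "N S {} * (1 - 16 * real ?i * \<kappa>) - 16 * N S {} * \<kappa> \<le> falling M ?i * ((real M - real ?i) * N S (insert p \<rho>))"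
      unfolding p by linarith
    then show ?case unfolding cd falling_Suc by (simp add: algebra_simps)
  qed simp
qed

text \<open>Without the patterns that touch \<open>\<phi>\<close>, \<open>N_lower_untouched\<close>
  applies and loses 16 per incidence, hence 64. Putting a touching pattern \<open>\<chi>\<close>
  back loses only bijections that contain both \<open>\<phi>\<close> and \<open>\<chi>\<close>.
  There are none unless the two share an incidence, and then \<open>overlap\<close> bounds the loss,
  with the 2 of \<open>N_upper2\<close>. If \<open>\<phi>\<close> were in \<open>S\<close>, the
  right-hand side would vanish.\<close>

lemma N_lower:
  assumes S: "S \<subseteq> F" and \<phi>: "\<phi> \<in> F" "\<phi> \<notin> S" and nonneg: "64 * \<kappa> + 2 * \<zeta> \<le> 1"
  shows "N S {} * (1 - 64 * \<kappa> - 2 * \<zeta>) \<le> falling M (card \<phi>) * N S \<phi>"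
proof -
  have finS: "finite S" using S finite_F finite_subset by blast
  have \<phi>': "\<phi> \<subseteq> A \<times> B" "card \<phi> \<le> 4" using pattern[OF \<phi>(1)] by auto
  have fpos: "falling M (card \<phi>) > 0" using falling_pos8 \<phi>' by simp
  define S' where "S' = {\<chi> \<in> S. \<not> touches \<phi> \<chi>}"
  have S': "S' \<subseteq> S" "S' \<subseteq> F" using S by (auto simp: S'_def)
  have "N S' {} * (1 - 64 * \<kappa>) \<le> N S' {} * (1 - 16 * real (card \<phi>) * \<kappa>)"
    using \<phi>' mult_right_mono[of "16 * real (card \<phi>)" 64 \<kappa>] \<kappa>_nonneg by (intro mult_left_mono) auto
  also have "\<dots> \<le> falling M (card \<phi>) * N S' \<phi>"
    using S' \<phi> by (intro N_lower_untouched) (auto simp: S'_def)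
  also have "N S' \<phi> \<le> N S \<phi> + (\<Sum>\<chi>\<in>S - S'. N S' (\<phi> \<union> \<chi>))" by (rule N_le_Un[OF finS])
  also have "(\<Sum>\<chi>\<in>S - S'. N S' (\<phi> \<union> \<chi>)) \<le> (\<Sum>\<chi>\<in>S - S'. if \<chi> \<inter> \<phi> \<noteq> {} then 2 * N S' {} * (1 / falling M (card (\<phi> \<union> \<chi>))) else 0)"
  proof (rule sum_mono)
    fix \<chi> assume \<chi>: "\<chi> \<in> S - S'"
    then have F: "\<chi> \<subseteq> A \<times> B" "card \<chi> \<le> 4" using S pattern by auto
    show "N S' (\<phi> \<union> \<chi>) \<le> (if \<chi> \<inter> \<phi> \<noteq> {} then 2 * N S' {} * (1 / falling M (card (\<phi> \<union> \<chi>))) else 0)"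
    proof (cases "\<chi> \<inter> \<phi> = {}")
      case True
      from \<chi> have "touches \<phi> \<chi>" by (auto simp: S'_def)
      then obtain a b a' b' where "(a, b) \<in> \<phi>" "(a', b') \<in> \<chi>" "a = a' \<or> b = b'"
        by (fastforce simp: touches_def)
      then have "N S' (\<phi> \<union> \<chi>) = 0"
        using True F \<phi>' by (intro N_conflict[of _ a b a' b']) auto
      then show ?thesis using True by simp
    next
      case False
      have "card (\<phi> \<union> \<chi>) \<le> 8" using card_Un_le[of \<phi> \<chi>] F \<phi>' by simp
      then show ?thesis using False F \<phi>' S' N_upper2[of S' "\<phi> \<union> \<chi>"] by simp
    qed
  qed
  also have "\<dots> = (\<Sum>\<chi> | \<chi> \<in> S - S' \<and> \<chi> \<inter> \<phi> \<noteq> {}. 2 * N S' {} * (1 / falling M (card (\<phi> \<union> \<chi>))))"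
    using finS by (intro sum.inter_filter[symmetric]) auto
  also have "\<dots> \<le> (\<Sum>\<chi> | \<chi> \<in> F \<and> \<chi> \<noteq> \<phi> \<and> \<chi> \<inter> \<phi> \<noteq> {}. 2 * N S' {} * (1 / falling M (card (\<phi> \<union> \<chi>))))"
  proof (rule sum_mono2)
    fix \<chi> assume "\<chi> \<in> {\<chi> \<in> F. \<chi> \<noteq> \<phi> \<and> \<chi> \<inter> \<phi> \<noteq> {}} - {\<chi> \<in> S - S'. \<chi> \<inter> \<phi> \<noteq> {}}"
    then have "card (\<phi> \<union> \<chi>) \<le> 8" using card_Un_le[of \<phi> \<chi>] \<phi>' pattern[of \<chi>] by simp
    then show "0 \<le> 2 * N S' {} * (1 / falling M (card (\<phi> \<union> \<chi>)))"
      using falling_pos8 by (simp add: less_imp_le)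
  qed (use finite_F S \<phi> in auto)
  also have "\<dots> = 2 * N S' {} * (\<Sum>\<chi> | \<chi> \<in> F \<and> \<chi> \<noteq> \<phi> \<and> \<chi> \<inter> \<phi> \<noteq> {}. 1 / falling M (card (\<phi> \<union> \<chi>)))"
    by (simp add: sum_distrib_left)
  also have "\<dots> \<le> 2 * N S' {} * (\<zeta> / falling M (card \<phi>))"
    by (intro mult_left_mono overlap \<phi>) simp
  finally have "N S' {} * (1 - 64 * \<kappa>) \<le> falling M (card \<phi>) * (N S \<phi> + 2 * N S' {} * (\<zeta> / falling M (card \<phi>)))"
    using fpos by simp
  then have "N S' {} * (1 - 64 * \<kappa> - 2 * \<zeta>) \<le> falling M (card \<phi>) * N S \<phi>"
    using fpos by (simp add: algebra_simps)
  moreover have "N S {} * (1 - 64 * \<kappa> - 2 * \<zeta>) \<le> N S' {} * (1 - 64 * \<kappa> - 2 * \<zeta>)"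
    using N_mono[OF S'(1)] nonneg by (intro mult_right_mono) auto
  ultimately show ?thesis by linarith
qed

text \<open>Since 1 - x <= exp (- x), it is the lower bound on the conditional probabilities that
  bounds the product from above.\<close>

lemma N_avoid_upper:
  assumes nonneg: "64 * \<kappa> + 2 * \<zeta> \<le> 1"
  shows "N F {} \<le> fact M * exp (- (\<Lambda> * (1 - 64 * \<kappa> - 2 * \<zeta>)))"
proof -
  let ?\<eta> = "1 - 64 * \<kappa> - 2 * \<zeta>"
  have "N S {} \<le> fact M * exp (- ((\<Sum>\<chi>\<in>S. 1 / falling M (card \<chi>)) * ?\<eta>))" if "finite S" "S \<subseteq> F" for S
    using that
  proof (induction S rule: finite_induct)
    case empty
    then show ?case by (simp add: N_empty)
  next
    case (insert \<chi> S)
    let ?w = "1 / falling M (card \<chi>)"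
    have fpos: "falling M (card \<chi>) > 0" using falling_pos8 pattern[of \<chi>] insert.prems by simp
    have "N S {} * ?\<eta> \<le> falling M (card \<chi>) * N S \<chi>"
      using insert nonneg by (intro N_lower) auto
    then have "N S {} * ?\<eta> * ?w \<le> N S \<chi>" using fpos by (simp add: field_simps)
    then have "N (insert \<chi> S) {} \<le> N S {} * (1 + (- (?w * ?\<eta>)))"
      unfolding N_insert by (simp add: algebra_simps)
    also have "\<dots> \<le> N S {} * exp (- (?w * ?\<eta>))"
      by (intro mult_left_mono exp_ge_add_one_self) simp
    also have "\<dots> \<le> fact M * exp (- ((\<Sum>\<chi>\<in>S. 1 / falling M (card \<chi>)) * ?\<eta>)) * exp (- (?w * ?\<eta>))"
      using insert by (intro mult_right_mono) auto
    also have "\<dots> = fact M * exp (- ((\<Sum>\<chi>\<in>insert \<chi> S. 1 / falling M (card \<chi>)) * ?\<eta>))"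
      using insert.hyps by (simp add: exp_add[symmetric] algebra_simps)
    finally show ?case .
  qed
  from this[OF finite_F order_refl] show ?thesis unfolding \<Lambda>_def .
qed

text \<open>The reverse of 1 - x <= exp (- x) costs a quadratic term. As the conditional
  probabilities are at most \<open>2 * \<kappa>\<close>, this term is again a relative error of
  order \<open>\<kappa>\<close>.\<close>

lemma N_avoid_lower: "N F {} \<ge> fact M * exp (- (\<Lambda> * (1 + 40 * \<kappa>)))"
proof -
  have "N S {} \<ge> fact M * exp (- ((\<Sum>\<chi>\<in>S. 1 / falling M (card \<chi>)) * (1 + 40 * \<kappa>)))" if "finite S" "S \<subseteq> F" for S
    using that
  proof (induction S rule: finite_induct)
    case empty
    then show ?case by (simp add: N_empty)
  next
    case (insert \<chi> S)
    let ?w = "1 / falling M (card \<chi>)"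
    have \<chi>: "\<chi> \<in> F" "\<chi> \<subseteq> A \<times> B" "card \<chi> \<le> 4" using insert.prems pattern[of \<chi>] by auto
    have fpos: "falling M (card \<chi>) > 0" using falling_pos8 \<chi> by simp
    have w: "0 \<le> ?w" "?w \<le> \<kappa>" using weight_nonneg weight_le_\<kappa> \<chi> by auto
    \<comment> \<open>An upper bound for the conditional probability of \<open>\<chi>\<close>: the
      loss in \<open>N_upper\<close> is at most 1 / (1 - 16 \<open>\<kappa>\<close>) because
      \<open>card \<chi> \<le> 4\<close>, and this is at most 1 + 32
      \<open>\<kappa>\<close>.\<close>
    define z where "z = ?w * (1 + 32 * \<kappa>)"
    have "?w * (1 + 32 * \<kappa>) \<le> \<kappa> * 2" using w \<kappa>_nonneg \<kappa>_le by (intro mult_mono) auto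
    then have z1: "z \<le> 2 * \<kappa>" by (simp only: z_def mult.commute)
    have z0: "0 \<le> z" unfolding z_def using w \<kappa>_nonneg by (intro mult_nonneg_nonneg) auto
    note z = z0 z1
    have z12: "z \<le> 1/2" using z1 \<kappa>_le by linarith
    have "- z - 2 * z\<^sup>2 \<le> ln (1 - z)"
      using z0 z12 by (intro ln_one_minus_pos_lower_bound) auto
    then have "exp (- z - 2 * z\<^sup>2) \<le> exp (ln (1 - z))" by simp
    also have "\<dots> = 1 - z" using z12 by simp
    finally have ez: "exp (- z - 2 * z\<^sup>2) \<le> 1 - z" .
    have zw: "z + 2 * z\<^sup>2 \<le> ?w * (1 + 40 * \<kappa>)"
    proof -
      have "z + 2 * z\<^sup>2 = z * (1 + 2 * z)" by (simp add: power2_eq_square algebra_simps)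
      also have "\<dots> \<le> z * (1 + 4 * \<kappa>)" using z by (intro mult_left_mono) auto
      also have "\<dots> = ?w * ((1 + 32 * \<kappa>) * (1 + 4 * \<kappa>))" by (simp add: z_def)
      \<comment> \<open>The product is 1 + 36 \<open>\<kappa>\<close> + 128
        \<open>\<kappa>\<close>^2, and the last term is at most \<open>\<kappa>\<close>.\<close>
      also have "\<dots> \<le> ?w * (1 + 40 * \<kappa>)"
      proof (rule mult_left_mono)
        have "\<kappa> * \<kappa> \<le> \<kappa> * (1/128)" using \<kappa>_nonneg \<kappa>_le by (intro mult_left_mono) auto
        then show "(1 + 32 * \<kappa>) * (1 + 4 * \<kappa>) \<le> 1 + 40 * \<kappa>" using \<kappa>_nonneg by (simp add: algebra_simps)
      qed (use w in simp)
      finally show ?thesis .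
    qed
    have "exp (- (?w * (1 + 40 * \<kappa>))) \<le> exp (- z - 2 * z\<^sup>2)" using zw by simp
    with ez have e: "exp (- (?w * (1 + 40 * \<kappa>))) \<le> 1 - z" by linarith
    have "N S \<chi> \<le> N S {} * z"
    proof -
      have d: "4 * real (card \<chi>) * \<kappa> \<le> 16 * \<kappa>"
        using \<chi> \<kappa>_nonneg by (intro mult_right_mono) auto
      have "(1 - 16 * \<kappa>) * (falling M (card \<chi>) * N S \<chi>) \<le> (1 - 4 * real (card \<chi>) * \<kappa>) * (falling M (card \<chi>) * N S \<chi>)"
        using d fpos by (intro mult_right_mono) auto
      also have "\<dots> \<le> N S {}" using \<chi> insert.prems by (intro N_upper) auto
      finally have 1: "(1 - 16 * \<kappa>) * (falling M (card \<chi>) * N S \<chi>) \<le> N S {}" .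
      have "\<kappa> * \<kappa> \<le> \<kappa> * (1/128)" using \<kappa>_nonneg \<kappa>_le by (intro mult_left_mono) auto
      then have "1 \<le> (1 + 32 * \<kappa>) * (1 - 16 * \<kappa>)" using \<kappa>_nonneg by (simp add: algebra_simps)
      then have "1 * (falling M (card \<chi>) * N S \<chi>) \<le> (1 + 32 * \<kappa>) * (1 - 16 * \<kappa>) * (falling M (card \<chi>) * N S \<chi>)"
        using fpos by (intro mult_right_mono) auto
      also have "\<dots> = (1 + 32 * \<kappa>) * ((1 - 16 * \<kappa>) * (falling M (card \<chi>) * N S \<chi>))" by simp
      also have "\<dots> \<le> (1 + 32 * \<kappa>) * N S {}" using 1 \<kappa>_nonneg by (intro mult_left_mono) auto
      finally show ?thesis using fpos by (simp add: z_def field_simps)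
    qed
    then have "N S {} * (1 - z) \<le> N (insert \<chi> S) {}"
      unfolding N_insert by (simp add: algebra_simps)
    moreover have "N S {} * exp (- (?w * (1 + 40 * \<kappa>))) \<le> N S {} * (1 - z)"
      using e by (intro mult_left_mono) auto
    moreover have "fact M * exp (- ((\<Sum>\<chi>\<in>S. 1 / falling M (card \<chi>)) * (1 + 40 * \<kappa>))) * exp (- (?w * (1 + 40 * \<kappa>)))
        \<le> N S {} * exp (- (?w * (1 + 40 * \<kappa>)))"
      using insert by (intro mult_right_mono) auto
    moreover have "fact M * exp (- ((\<Sum>\<chi>\<in>S. 1 / falling M (card \<chi>)) * (1 + 40 * \<kappa>))) * exp (- (?w * (1 + 40 * \<kappa>)))
       = fact M * exp (- ((\<Sum>\<chi>\<in>insert \<chi> S. 1 / falling M (card \<chi>)) * (1 + 40 * \<kappa>)))"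
      using insert.hyps by (simp add: exp_add[symmetric] algebra_simps)
    ultimately show ?case by linarith
  qed
  from this[OF finite_F order_refl] show ?thesis unfolding \<Lambda>_def .
qed

end

section \<open>Loops and 4-cycles in the configuration model\<close>

text \<open>\<open>((i, a), (e, b))\<close> says that the \<open>a\<close>-th point of vertex \<open>i\<close> is placed in the \<open>b\<close>-th slot of
  edge \<open>e\<close>.\<close>

type_synonym incidence = "(nat \<times> nat) \<times> (nat \<times> nat)"

definition distinct_pairs :: "nat \<Rightarrow> (nat \<times> nat) set" where
  "distinct_pairs q = {(a, b). a < q \<and> b < q \<and> a \<noteq> b}"

definition loop_pattern :: "nat \<Rightarrow> nat \<Rightarrow> nat \<Rightarrow> nat \<Rightarrow> nat \<Rightarrow> nat \<Rightarrow> incidence set" where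
  "loop_pattern i a a' e b b' = {((i, a), (e, b)), ((i, a'), (e, b'))}"

text \<open>The names follow the closed walk i, e, j, f, i: vertex \<open>i\<close> is left by point
  \<open>a\<close>, edge \<open>e\<close> is entered at \<open>b\<close> and left at
  \<open>b'\<close>, \<open>j\<close> is entered at \<open>d\<close> and left at \<open>d'\<close>,
  \<open>f\<close> is entered at \<open>c\<close> and left at \<open>c'\<close>, and
  \<open>i\<close> is reached again at \<open>a'\<close>.\<close>

definition cycle_pattern :: "nat \<Rightarrow> nat \<Rightarrow> nat \<Rightarrow> nat \<Rightarrow> nat \<Rightarrow> nat \<Rightarrow> nat \<Rightarrow> nat \<Rightarrow> nat \<Rightarrow> nat \<Rightarrow> nat \<Rightarrow> nat \<Rightarrow> incidence set" where
  "cycle_pattern i a a' j d d' e b b' f c c' =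
     {((i, a), (e, b)), ((i, a'), (f, c')), ((j, d), (e, b')), ((j, d'), (f, c))}"

lemma card_distinct_pairs: "card (distinct_pairs q) = q * (q - 1)"
proof -
  have "distinct_pairs q = (SIGMA a:{..<q}. {..<q} - {a})"
    by (auto simp: distinct_pairs_def)
  then show ?thesis by simp
qed

lemma finite_distinct_pairs [simp]: "finite (distinct_pairs q)"
  by (rule finite_subset[of _ "{..<q} \<times> {..<q}"]) (auto simp: distinct_pairs_def)

locale degree_model =
  fixes n r m K :: nat and k :: "nat \<Rightarrow> nat"
  assumes sum_degrees: "(\<Sum>j = 1..n. k j) = m * r" and k_le: "i \<in> {1..n} \<Longrightarrow> k i \<le> K"
begin

definition points :: "(nat \<times> nat) set" where
  "points = (SIGMA i:{1..n}. {..<k i})"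

definition slots :: "(nat \<times> nat) set" where
  "slots = {..<m} \<times> {..<r}"

definition loops :: "incidence set set" where
  "loops = {loop_pattern i a a' e b b' | i a a' e b b'.
     i \<in> {1..n} \<and> (a, a') \<in> distinct_pairs (k i) \<and> e < m \<and> (b, b') \<in> distinct_pairs r}"

definition cycle_tuple :: "nat \<Rightarrow> nat \<Rightarrow> nat \<Rightarrow> nat \<Rightarrow> nat \<Rightarrow> nat \<Rightarrow> nat \<Rightarrow> nat \<Rightarrow> nat \<Rightarrow> nat \<Rightarrow> nat \<Rightarrow> nat \<Rightarrow> bool" where
  "cycle_tuple i a a' j d d' e b b' f c c' \<longleftrightarrow> i \<in> {1..n} \<and> j \<in> {1..n} \<and> i \<noteq> j \<and>
     (a, a') \<in> distinct_pairs (k i) \<and> (d, d') \<in> distinct_pairs (k j) \<and>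
     e < m \<and> f < m \<and> e \<noteq> f \<and> (b, b') \<in> distinct_pairs r \<and> (c, c') \<in> distinct_pairs r"

definition cycles :: "incidence set set" where
  "cycles = {cycle_pattern i a a' j d d' e b b' f c c' | i a a' j d d' e b b' f c c'.
     cycle_tuple i a a' j d d' e b b' f c c'}"

section \<open>Shapes and symmetries of the patterns\<close>

lemma finite_points: "finite points" and finite_slots: "finite slots"
  by (auto simp: points_def slots_def)

lemma card_points: "card points = m * r" and card_slots: "card slots = m * r"
  using sum_degrees by (simp_all add: points_def slots_def)

sublocale matching_space points slots "m * r"
  by unfold_locales (fact finite_points finite_slots card_points card_slots)+

lemma loops_subset: "\<chi> \<in> loops \<Longrightarrow> \<chi> \<subseteq> points \<times> slots"
  by (auto simp: loops_def loop_pattern_def points_def slots_def distinct_pairs_def)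

lemma cycles_subset: "\<chi> \<in> cycles \<Longrightarrow> \<chi> \<subseteq> points \<times> slots"
  unfolding cycles_def cycle_tuple_def cycle_pattern_def points_def slots_def distinct_pairs_def
  by auto

lemma finite_loops_cycles: "finite (loops \<union> cycles)"
proof (rule finite_subset)
  show "loops \<union> cycles \<subseteq> Pow (points \<times> slots)"
    using loops_subset cycles_subset by blast
qed (simp add: finite_points finite_slots)

lemma finite_loops [simp]: "finite loops" and finite_cycles [simp]: "finite cycles"
  using finite_loops_cycles by auto

text \<open>The two incidences of a loop are interchangeable, so any one of them may be put first.
  Counting the loops through a given incidence then means counting the remaining parameters.\<close>

lemma loop_at:
  assumes "\<chi> \<in> loops" "p \<in> \<chi>"
  obtains i a a' e b b' where "\<chi> = loop_pattern i a a' e b b'" "p = ((i, a), (e, b))"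
    "i \<in> {1..n}" "(a, a') \<in> distinct_pairs (k i)" "e < m" "(b, b') \<in> distinct_pairs r"
proof -
  obtain i a a' e b b' where *: "\<chi> = loop_pattern i a a' e b b'"
    "i \<in> {1..n}" "(a, a') \<in> distinct_pairs (k i)" "e < m" "(b, b') \<in> distinct_pairs r"
    using assms(1) unfolding loops_def by blast
  then have "\<chi> = loop_pattern i a' a e b' b" "(a', a) \<in> distinct_pairs (k i)" "(b', b) \<in> distinct_pairs r"
    by (auto simp: loop_pattern_def distinct_pairs_def)
  moreover have "p = ((i, a), (e, b)) \<or> p = ((i, a'), (e, b'))"
    using assms(2) * by (simp add: loop_pattern_def)
  ultimately show thesis using that * by blast
qed

lemma distinct_pairs_sym: "(a, b) \<in> distinct_pairs q \<Longrightarrow> (b, a) \<in> distinct_pairs q"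
  by (simp add: distinct_pairs_def)

text \<open>The symmetries of a 4-cycle allow any of its incidences to be the first one.\<close>

lemma cycle_at:
  assumes "\<chi> \<in> cycles" "p \<in> \<chi>"
  obtains i a a' j d d' e b b' f c c' where "\<chi> = cycle_pattern i a a' j d d' e b b' f c c'"
    "p = ((i, a), (e, b))" "cycle_tuple i a a' j d d' e b b' f c c'"
proof -
  obtain i a a' j d d' e b b' f c c' where \<chi>: "\<chi> = cycle_pattern i a a' j d d' e b b' f c c'"
    and t: "cycle_tuple i a a' j d d' e b b' f c c'"
    using assms(1) unfolding cycles_def by blast
  have 1: "\<chi> = cycle_pattern j d d' i a a' e b' b f c' c"
    unfolding \<chi> cycle_pattern_def by blast
  have 2: "\<chi> = cycle_pattern i a' a j d' d f c' c e b' b"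
    unfolding \<chi> cycle_pattern_def by blast
  have 3: "\<chi> = cycle_pattern j d' d i a' a f c c' e b b'"
    unfolding \<chi> cycle_pattern_def by blast
  have t': "cycle_tuple j d d' i a a' e b' b f c' c" "cycle_tuple i a' a j d' d f c' c e b' b"
    "cycle_tuple j d' d i a' a f c c' e b b'"
    using t distinct_pairs_sym unfolding cycle_tuple_def by blast+
  have "p = ((i, a), (e, b)) \<or> p = ((i, a'), (f, c')) \<or> p = ((j, d), (e, b')) \<or> p = ((j, d'), (f, c))"
    using assms(2) unfolding \<chi> cycle_pattern_def by simp
  then show thesis using that \<chi> t 1 2 3 t' by blast
qed

lemma cycle_tupleD:
  assumes "cycle_tuple i a a' j d d' e b b' f c c'"
  shows "(i, a) \<in> points" "(i, a') \<in> points" "(j, d) \<in> points" "(j, d') \<in> points"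
    "(e, b) \<in> slots" "(e, b') \<in> slots" "(f, c) \<in> slots" "(f, c') \<in> slots"
    "a < K" "a' < K" "d < K" "d' < K" "b < r" "b' < r" "c < r" "c' < r"
  using assms k_le[of i] k_le[of j]
  by (simp_all add: cycle_tuple_def points_def slots_def distinct_pairs_def)

lemma card_loop: "\<chi> \<in> loops \<Longrightarrow> card \<chi> = 2"
  by (auto simp: loops_def loop_pattern_def distinct_pairs_def)

lemma cycle_tuple_distinct:
  assumes "cycle_tuple i a a' j d d' e b b' f c c'"
  shows "i \<noteq> j" "e \<noteq> f" "a \<noteq> a'" "d \<noteq> d'" "b \<noteq> b'" "c \<noteq> c'"
  using assms by (simp_all add: cycle_tuple_def distinct_pairs_def)

lemma card_cycle:
  assumes "\<chi> \<in> cycles" shows "card \<chi> = 4"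
proof -
  obtain i a a' j d d' e b b' f c c' where \<chi>: "\<chi> = cycle_pattern i a a' j d d' e b b' f c c'"
    and t: "cycle_tuple i a a' j d d' e b b' f c c'"
    using assms unfolding cycles_def by blast
  show ?thesis using cycle_tuple_distinct[OF t] by (simp add: \<chi> cycle_pattern_def)
qed

lemma cycle_no_loop:
  assumes "\<chi> \<in> cycles" "((i, a), (e, b)) \<in> \<chi>" "((i, a'), (e, b')) \<in> \<chi>"
  shows "a = a'"
proof -
  obtain i1 a1 a2 j d d' e1 b1 b2 f c c' where \<chi>: "\<chi> = cycle_pattern i1 a1 a2 j d d' e1 b1 b2 f c c'"
    and t: "cycle_tuple i1 a1 a2 j d d' e1 b1 b2 f c c'"
    using assms unfolding cycles_def by blast
  show ?thesis using assms(2,3) cycle_tuple_distinct[OF t] by (auto simp: \<chi> cycle_pattern_def)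
qed

text \<open>By size, a proper inclusion could only put a loop inside a 4-cycle, but a 4-cycle has
  just one incidence for each pair of a vertex and an edge. Consequently two different overlapping
  patterns always have incidences outside each other.\<close>

lemma pattern_antichain:
  assumes "\<chi> \<in> loops \<union> cycles" "\<phi> \<in> loops \<union> cycles" "\<chi> \<subseteq> \<phi>"
  shows "\<chi> = \<phi>"
proof -
  have fin: "finite \<phi>"
    using assms(2) loops_subset cycles_subset finite_subset[of \<phi> "points \<times> slots"] finite_points finite_slots by blast
  have "card \<chi> = card \<phi>"
  proof -
    have "\<not> (\<chi> \<in> loops \<and> \<phi> \<in> cycles)"
    proof
      assume *: "\<chi> \<in> loops \<and> \<phi> \<in> cycles"
      then obtain i a a' e b b' where "\<chi> = loop_pattern i a a' e b b'" "(a, a') \<in> distinct_pairs (k i)"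
        unfolding loops_def by blast
      then show False
        using cycle_no_loop[of \<phi> i a e b a' b'] * assms(3) by (auto simp: loop_pattern_def distinct_pairs_def)
    qed
    then show ?thesis using assms card_mono[OF fin assms(3)] card_loop card_cycle by fastforce
  qed
  then show ?thesis using card_subset_eq[OF fin assms(3)] by simp
qed

lemma inj_on_pattern:
  assumes "\<chi> \<in> loops \<union> cycles"
  shows "inj_on fst \<chi>" "inj_on snd \<chi>"
proof -
  have "inj_on fst \<chi> \<and> inj_on snd \<chi>"
  proof (cases "\<chi> \<in> loops")
    case True
    then show ?thesis by (auto simp: loops_def loop_pattern_def distinct_pairs_def)
  next
    case False
    then obtain i a a' j d d' e b b' f c c' where \<chi>: "\<chi> = cycle_pattern i a a' j d d' e b b' f c c'"
      and t: "cycle_tuple i a a' j d d' e b b' f c c'"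
      using assms unfolding cycles_def by blast
    show ?thesis using cycle_tuple_distinct[OF t] by (simp add: \<chi> cycle_pattern_def)
  qed
  then show "inj_on fst \<chi>" "inj_on snd \<chi>" by auto
qed

section \<open>Patterns through a given point or slot, or overlapping a given pattern\<close>

lemma card_loops_fst: "card {\<chi> \<in> loops. x \<in> fst ` \<chi>} \<le> K * (m * r) * r"
proof -
  \<comment> \<open>The point \<open>x\<close> fixes \<open>i\<close> and \<open>a\<close>. In this
    and the following counts a further point of a vertex already chosen costs \<open>K\<close>, a
    further slot of an edge already chosen costs \<open>r\<close>, and a point of a new vertex or a
    slot of a new edge costs \<open>m * r\<close>.\<close>
  let ?h = "\<lambda>(a', (e, b), b'). loop_pattern (fst x) (snd x) a' e b b'"
  have "{\<chi> \<in> loops. x \<in> fst ` \<chi>} \<subseteq> ?h ` ({..<K} \<times> slots \<times> {..<r})"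
  proof
    fix \<chi> assume "\<chi> \<in> {\<chi> \<in> loops. x \<in> fst ` \<chi>}"
    then obtain p where \<chi>: "\<chi> \<in> loops" and p: "p \<in> \<chi>" "x = fst p" by auto
    then obtain i a a' e b b' where t: "\<chi> = loop_pattern i a a' e b b'" "p = ((i, a), (e, b))"
      "i \<in> {1..n}" "(a, a') \<in> distinct_pairs (k i)" "e < m" "(b, b') \<in> distinct_pairs r"
      using loop_at by metis
    then have "\<chi> = ?h (a', (e, b), b')" using p by simp
    moreover have "(a', (e, b), b') \<in> {..<K} \<times> slots \<times> {..<r}"
      using t k_le[of i] by (simp add: slots_def distinct_pairs_def)
    ultimately show "\<chi> \<in> ?h ` ({..<K} \<times> slots \<times> {..<r})" by (rule image_eqI)
  qed
  then have "card {\<chi> \<in> loops. x \<in> fst ` \<chi>} \<le> card ({..<K} \<times> slots \<times> {..<r})"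
    by (rule surj_card_le[rotated]) (simp add: finite_slots)
  then show ?thesis by (simp add: card_slots card_cartesian_product ac_simps)
qed

lemma card_loops_snd: "card {\<chi> \<in> loops. s \<in> snd ` \<chi>} \<le> K * (m * r) * r"
proof -
  let ?h = "\<lambda>((i, a), a', b'). loop_pattern i a a' (fst s) (snd s) b'"
  have "{\<chi> \<in> loops. s \<in> snd ` \<chi>} \<subseteq> ?h ` (points \<times> {..<K} \<times> {..<r})"
  proof
    fix \<chi> assume "\<chi> \<in> {\<chi> \<in> loops. s \<in> snd ` \<chi>}"
    then obtain p where \<chi>: "\<chi> \<in> loops" and p: "p \<in> \<chi>" "s = snd p" by auto
    then obtain i a a' e b b' where t: "\<chi> = loop_pattern i a a' e b b'" "p = ((i, a), (e, b))"
      "i \<in> {1..n}" "(a, a') \<in> distinct_pairs (k i)" "e < m" "(b, b') \<in> distinct_pairs r"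
      using loop_at by metis
    then have "\<chi> = ?h ((i, a), a', b')" using p by simp
    moreover have "((i, a), a', b') \<in> points \<times> {..<K} \<times> {..<r}"
      using t k_le[of i] by (simp add: points_def distinct_pairs_def)
    ultimately show "\<chi> \<in> ?h ` (points \<times> {..<K} \<times> {..<r})" by (rule image_eqI)
  qed
  then have "card {\<chi> \<in> loops. s \<in> snd ` \<chi>} \<le> card (points \<times> {..<K} \<times> {..<r})"
    by (rule surj_card_le[rotated]) (simp add: finite_points)
  then show ?thesis by (simp add: card_points card_cartesian_product ac_simps)
qed

lemma card_cycles_fst: "card {\<chi> \<in> cycles. x \<in> fst ` \<chi>} \<le> K\<^sup>2 * r\<^sup>2 * (m * r) ^ 3"
proof -
  let ?h = "\<lambda>((e, b), a', b', (j, d), d', (f, c), c'). cycle_pattern (fst x) (snd x) a' j d d' e b b' f c c'"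
  let ?X = "slots \<times> {..<K} \<times> {..<r} \<times> points \<times> {..<K} \<times> slots \<times> {..<r}"
  have "{\<chi> \<in> cycles. x \<in> fst ` \<chi>} \<subseteq> ?h ` ?X"
  proof
    fix \<chi> assume "\<chi> \<in> {\<chi> \<in> cycles. x \<in> fst ` \<chi>}"
    then obtain p where \<chi>: "\<chi> \<in> cycles" and p: "p \<in> \<chi>" "x = fst p" by auto
    then obtain i a a' j d d' e b b' f c c' where t: "\<chi> = cycle_pattern i a a' j d d' e b b' f c c'"
      "p = ((i, a), (e, b))" "cycle_tuple i a a' j d d' e b b' f c c'"
      using cycle_at by metis
    then have "\<chi> = ?h ((e, b), a', b', (j, d), d', (f, c), c')" using p by simp
    moreover have "((e, b), a', b', (j, d), d', (f, c), c') \<in> ?X"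
      using cycle_tupleD[OF t(3)] by simp
    ultimately show "\<chi> \<in> ?h ` ?X" by (rule image_eqI)
  qed
  then have "card {\<chi> \<in> cycles. x \<in> fst ` \<chi>} \<le> card ?X"
    by (rule surj_card_le[rotated]) (simp add: finite_slots finite_points)
  also have "\<dots> = K\<^sup>2 * r\<^sup>2 * (m * r) ^ 3"
    by (simp add: card_slots card_points card_cartesian_product power2_eq_square power3_eq_cube ac_simps)
  finally show ?thesis .
qed

lemma card_cycles_snd: "card {\<chi> \<in> cycles. s \<in> snd ` \<chi>} \<le> K\<^sup>2 * r\<^sup>2 * (m * r) ^ 3"
proof -
  let ?h = "\<lambda>((i, a), a', b', (j, d), d', (f, c), c'). cycle_pattern i a a' j d d' (fst s) (snd s) b' f c c'"
  let ?X = "points \<times> {..<K} \<times> {..<r} \<times> points \<times> {..<K} \<times> slots \<times> {..<r}"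
  have "{\<chi> \<in> cycles. s \<in> snd ` \<chi>} \<subseteq> ?h ` ?X"
  proof
    fix \<chi> assume "\<chi> \<in> {\<chi> \<in> cycles. s \<in> snd ` \<chi>}"
    then obtain p where \<chi>: "\<chi> \<in> cycles" and p: "p \<in> \<chi>" "s = snd p" by auto
    then obtain i a a' j d d' e b b' f c c' where t: "\<chi> = cycle_pattern i a a' j d d' e b b' f c c'"
      "p = ((i, a), (e, b))" "cycle_tuple i a a' j d d' e b b' f c c'"
      using cycle_at by metis
    then have "\<chi> = ?h ((i, a), a', b', (j, d), d', (f, c), c')" using p by simp
    moreover have "((i, a), a', b', (j, d), d', (f, c), c') \<in> ?X"
      using cycle_tupleD[OF t(3)] by simp
    ultimately show "\<chi> \<in> ?h ` ?X" by (rule image_eqI)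
  qed
  then have "card {\<chi> \<in> cycles. s \<in> snd ` \<chi>} \<le> card ?X"
    by (rule surj_card_le[rotated]) (simp add: finite_slots finite_points)
  also have "\<dots> = K\<^sup>2 * r\<^sup>2 * (m * r) ^ 3"
    by (simp add: card_slots card_points card_cartesian_product power2_eq_square power3_eq_cube ac_simps)
  finally show ?thesis .
qed

text \<open>The factor 4 selects the shared incidence within \<open>\<phi>\<close>; it fixes the
  vertex and the edge of the loop.\<close>

lemma card_loops_overlap:
  assumes "finite \<phi>" "card \<phi> \<le> 4"
  shows "card {\<chi> \<in> loops. \<chi> \<inter> \<phi> \<noteq> {}} \<le> 4 * (K * r)"
proof -
  let ?h = "\<lambda>(((i, a), (e, b)), a', b'). loop_pattern i a a' e b b'"
  let ?X = "\<phi> \<times> {..<K} \<times> {..<r}"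
  have "{\<chi> \<in> loops. \<chi> \<inter> \<phi> \<noteq> {}} \<subseteq> ?h ` ?X"
  proof
    fix \<chi> assume "\<chi> \<in> {\<chi> \<in> loops. \<chi> \<inter> \<phi> \<noteq> {}}"
    then have \<chi>: "\<chi> \<in> loops" "\<chi> \<inter> \<phi> \<noteq> {}" by auto
    from \<chi>(2) obtain p where p: "p \<in> \<chi>" "p \<in> \<phi>" by blast
    with \<chi> obtain i a a' e b b' where t: "\<chi> = loop_pattern i a a' e b b'" "p = ((i, a), (e, b))"
      "i \<in> {1..n}" "(a, a') \<in> distinct_pairs (k i)" "e < m" "(b, b') \<in> distinct_pairs r"
      using loop_at by metis
    then have "\<chi> = ?h (p, a', b')" by simp
    moreover have "(p, a', b') \<in> ?X"
      using t p k_le[of i] by (simp add: distinct_pairs_def)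
    ultimately show "\<chi> \<in> ?h ` ?X" by (rule image_eqI)
  qed
  then have "card {\<chi> \<in> loops. \<chi> \<inter> \<phi> \<noteq> {}} \<le> card ?X"
    by (rule surj_card_le[rotated]) (simp add: assms)
  also have "\<dots> = card \<phi> * (K * r)" by (simp add: card_cartesian_product)
  also have "\<dots> \<le> 4 * (K * r)" using assms by (intro mult_right_mono) auto
  finally show ?thesis .
qed

lemma cycle_overlap:
  assumes "\<chi> \<in> cycles" "\<chi> \<inter> \<phi> \<noteq> {}"
  obtains i a a' j d d' e b b' f c c' where "\<chi> = cycle_pattern i a a' j d d' e b b' f c c'"
    "((i, a), (e, b)) \<in> \<phi>" "cycle_tuple i a a' j d d' e b b' f c c'"
proof -
  obtain p where p: "p \<in> \<chi>" "p \<in> \<phi>" using assms by blast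
  show thesis using cycle_at[OF assms(1) p(1)] p(2) that by metis
qed

lemma card_cycles_overlap3:
  assumes "finite \<phi>" "card \<phi> \<le> 4"
  shows "card {\<chi> \<in> cycles. \<chi> \<inter> \<phi> \<noteq> {}} \<le> 4 * (K\<^sup>2 * r\<^sup>2 * (m * r) ^ 2)"
proof -
  let ?h = "\<lambda>(((i, a), (e, b)), a', b', (j, d), d', (f, c), c'). cycle_pattern i a a' j d d' e b b' f c c'"
  let ?X = "\<phi> \<times> {..<K} \<times> {..<r} \<times> points \<times> {..<K} \<times> slots \<times> {..<r}"
  have "{\<chi> \<in> cycles. \<chi> \<inter> \<phi> \<noteq> {}} \<subseteq> ?h ` ?X"
  proof
    fix \<chi> assume "\<chi> \<in> {\<chi> \<in> cycles. \<chi> \<inter> \<phi> \<noteq> {}}"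
    then have \<chi>: "\<chi> \<in> cycles" "\<chi> \<inter> \<phi> \<noteq> {}" by auto
    then obtain i a a' j d d' e b b' f c c' where t: "\<chi> = cycle_pattern i a a' j d d' e b b' f c c'"
      "((i, a), (e, b)) \<in> \<phi>" "cycle_tuple i a a' j d d' e b b' f c c'"
      by (rule cycle_overlap)
    have "\<chi> = ?h (((i, a), (e, b)), a', b', (j, d), d', (f, c), c')" using t by simp
    moreover have "(((i, a), (e, b)), a', b', (j, d), d', (f, c), c') \<in> ?X"
      using t(2) cycle_tupleD[OF t(3)] by simp
    ultimately show "\<chi> \<in> ?h ` ?X" by (rule image_eqI)
  qed
  then have "card {\<chi> \<in> cycles. \<chi> \<inter> \<phi> \<noteq> {}} \<le> card ?X"
    by (rule surj_card_le[rotated]) (simp add: assms finite_points finite_slots)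
  also have "\<dots> = card \<phi> * (K\<^sup>2 * r\<^sup>2 * (m * r) ^ 2)"
    by (simp add: card_cartesian_product card_points card_slots power2_eq_square ac_simps)
  also have "\<dots> \<le> 4 * (K\<^sup>2 * r\<^sup>2 * (m * r) ^ 2)" using assms by (intro mult_right_mono) auto
  finally show ?thesis .
qed

lemma card_image_three_le:
  assumes "finite X" "finite Y" "finite Z" "S \<subseteq> f ` X \<union> g ` Y \<union> h ` Z"
  shows "card S \<le> card X + card Y + card Z"
proof -
  have "card S \<le> card (f ` X \<union> g ` Y \<union> h ` Z)"
    using assms by (intro card_mono) auto
  also have "\<dots> \<le> card (f ` X \<union> g ` Y) + card (h ` Z)" by (rule card_Un_le)
  also have "\<dots> \<le> card (f ` X) + card (g ` Y) + card (h ` Z)" by (simp add: card_Un_le)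
  also have "\<dots> \<le> card X + card Y + card Z"
    using assms by (intro add_mono card_image_le)
  finally show ?thesis .
qed

text \<open>A second shared incidence lies at the same vertex as the first, in the same edge, or
  opposite to it. This leaves one edge and one vertex less to choose in the last case than with one
  shared incidence, and one of the two less in the others. Each case is at most
  \<open>K\<^sup>2 * r\<^sup>2 * (m * r)\<close> for each of the 16 ordered pairs from
  \<open>\<phi>\<close>, hence 48.\<close>

lemma card_cycles_overlap2:
  assumes \<phi>: "finite \<phi>" "card \<phi> \<le> 4" and pos: "K > 0" "r > 0" "m > 0"
  shows "card {\<chi> \<in> cycles. \<chi> \<inter> \<phi> \<noteq> {} \<and> card (\<chi> - \<phi>) = 2} \<le> 48 * (K\<^sup>2 * r\<^sup>2 * (m * r))"
proof -
  let ?h1 = "\<lambda>((((i, a), (e, b)), ((i', a'), (f, c'))), b', (j, d), d', c). cycle_pattern i a a' j d d' e b b' f c c'"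
  let ?h2 = "\<lambda>((((i, a), (e, b)), ((j, d), (e', b'))), a', (f, c'), d', c). cycle_pattern i a a' j d d' e b b' f c c'"
  let ?h3 = "\<lambda>((((i, a), (e, b)), ((j, d'), (f, c))), a', c', d, b'). cycle_pattern i a a' j d d' e b b' f c c'"
  let ?X1 = "(\<phi> \<times> \<phi>) \<times> {..<r} \<times> points \<times> {..<K} \<times> {..<r}"
  let ?X2 = "(\<phi> \<times> \<phi>) \<times> {..<K} \<times> slots \<times> {..<K} \<times> {..<r}"
  let ?X3 = "(\<phi> \<times> \<phi>) \<times> {..<K} \<times> {..<r} \<times> {..<K} \<times> {..<r}"
  let ?S = "{\<chi> \<in> cycles. \<chi> \<inter> \<phi> \<noteq> {} \<and> card (\<chi> - \<phi>) = 2}"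
  have "?S \<subseteq> ?h1 ` ?X1 \<union> ?h2 ` ?X2 \<union> ?h3 ` ?X3"
  proof
    fix \<chi> assume "\<chi> \<in> ?S"
    then have \<chi>: "\<chi> \<in> cycles" "\<chi> \<inter> \<phi> \<noteq> {}" "card (\<chi> - \<phi>) = 2" by auto
    obtain i a a' j d d' e b b' f c c' where t: "\<chi> = cycle_pattern i a a' j d d' e b b' f c c'"
      "((i, a), (e, b)) \<in> \<phi>" "cycle_tuple i a a' j d d' e b b' f c c'"
      by (rule cycle_overlap[OF \<chi>(1,2)])
    note D = cycle_tupleD[OF t(3)] and N = cycle_tuple_distinct[OF t(3)]
    consider "((i, a'), (f, c')) \<in> \<phi>" | "((j, d), (e, b')) \<in> \<phi>" | "((j, d'), (f, c)) \<in> \<phi>"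
    proof (rule ccontr)
      assume "\<not> thesis"
      with that have "((i, a'), (f, c')) \<notin> \<phi>" "((j, d), (e, b')) \<notin> \<phi>" "((j, d'), (f, c)) \<notin> \<phi>" by blast+
      then have "card (\<chi> - \<phi>) = 3" using t(2) N by (simp add: t(1) cycle_pattern_def insert_Diff_if)
      then show False using \<chi>(3) by simp
    qed
    then show "\<chi> \<in> ?h1 ` ?X1 \<union> ?h2 ` ?X2 \<union> ?h3 ` ?X3"
    proof cases
      case 1
      have "\<chi> = ?h1 ((((i, a), (e, b)), ((i, a'), (f, c'))), b', (j, d), d', c)" using t by simp
      moreover have "((((i, a), (e, b)), ((i, a'), (f, c'))), b', (j, d), d', c) \<in> ?X1"
        using t(2) 1 D by simp
      ultimately have "\<chi> \<in> ?h1 ` ?X1" by (rule image_eqI)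
      then show ?thesis by blast
    next
      case 2
      have "\<chi> = ?h2 ((((i, a), (e, b)), ((j, d), (e, b'))), a', (f, c'), d', c)" using t by simp
      moreover have "((((i, a), (e, b)), ((j, d), (e, b'))), a', (f, c'), d', c) \<in> ?X2"
        using t(2) 2 D by simp
      ultimately have "\<chi> \<in> ?h2 ` ?X2" by (rule image_eqI)
      then show ?thesis by blast
    next
      case 3
      have "\<chi> = ?h3 ((((i, a), (e, b)), ((j, d'), (f, c))), a', c', d, b')" using t by simp
      moreover have "((((i, a), (e, b)), ((j, d'), (f, c))), a', c', d, b') \<in> ?X3"
        using t(2) 3 D by simp
      ultimately have "\<chi> \<in> ?h3 ` ?X3" by (rule image_eqI)
      then show ?thesis by blast
    qed
  qed
  then have "card ?S \<le> card ?X1 + card ?X2 + card ?X3"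
    by (rule card_image_three_le[rotated 3]) (simp_all add: \<phi> finite_points finite_slots)
  also have "\<dots> = card \<phi> * card \<phi> * (r * (m * r) * K * r + K * (m * r) * K * r + K * r * K * r)"
    by (simp add: card_cartesian_product card_points card_slots algebra_simps)
  also have "\<dots> \<le> 4 * 4 * (K\<^sup>2 * r\<^sup>2 * (m * r) + K\<^sup>2 * r\<^sup>2 * (m * r) + K\<^sup>2 * r\<^sup>2 * (m * r))"
  proof -
    have "K \<le> K\<^sup>2" "r \<le> r\<^sup>2" "1 \<le> m * r" using pos by (auto simp: power2_eq_square)
    then have "r\<^sup>2 * (m * r) * K \<le> r\<^sup>2 * (m * r) * K\<^sup>2" "K\<^sup>2 * (m * r) * r \<le> K\<^sup>2 * (m * r) * r\<^sup>2" "K\<^sup>2 * r\<^sup>2 * 1 \<le> K\<^sup>2 * r\<^sup>2 * (m * r)"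
      by (intro mult_left_mono; simp)+
    then have "r * (m * r) * K * r \<le> K\<^sup>2 * r\<^sup>2 * (m * r)" "K * (m * r) * K * r \<le> K\<^sup>2 * r\<^sup>2 * (m * r)" "K * r * K * r \<le> K\<^sup>2 * r\<^sup>2 * (m * r)"
      by (simp_all add: power2_eq_square ac_simps)
    then have "r * (m * r) * K * r + K * (m * r) * K * r + K * r * K * r \<le> K\<^sup>2 * r\<^sup>2 * (m * r) + K\<^sup>2 * r\<^sup>2 * (m * r) + K\<^sup>2 * r\<^sup>2 * (m * r)"
      by linarith
    moreover have "card \<phi> * card \<phi> \<le> 4 * 4" by (intro mult_mono \<phi>) auto
    ultimately show ?thesis by (rule mult_le_mono[rotated])
  qed
  finally show ?thesis by (simp add: ac_simps)
qed

text \<open>Three shared incidences determine both vertices and both edges, so that only the point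
  and the slot of the fourth are free, at cost \<open>K * r\<close>. The fourth has 3 possible
  positions, and there are at most 64 ordered triples from \<open>\<phi>\<close>, hence 192.\<close>

lemma card_cycles_overlap1:
  assumes \<phi>: "finite \<phi>" "card \<phi> \<le> 4"
  shows "card {\<chi> \<in> cycles. \<chi> \<inter> \<phi> \<noteq> {} \<and> card (\<chi> - \<phi>) = 1} \<le> 192 * (K * r)"
proof -
  let ?h1 = "\<lambda>((((i, a), (e, b)), ((i', a'), (f, c')), ((j, d), (e', b'))), d', c). cycle_pattern i a a' j d d' e b b' f c c'"
  let ?h2 = "\<lambda>((((i, a), (e, b)), ((i', a'), (f, c')), ((j, d'), (f', c))), d, b'). cycle_pattern i a a' j d d' e b b' f c c'"
  let ?h3 = "\<lambda>((((i, a), (e, b)), ((j, d), (e', b')), ((j', d'), (f, c))), a', c'). cycle_pattern i a a' j d d' e b b' f c c'"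
  let ?X = "(\<phi> \<times> \<phi> \<times> \<phi>) \<times> {..<K} \<times> {..<r}"
  let ?S = "{\<chi> \<in> cycles. \<chi> \<inter> \<phi> \<noteq> {} \<and> card (\<chi> - \<phi>) = 1}"
  have "?S \<subseteq> ?h1 ` ?X \<union> ?h2 ` ?X \<union> ?h3 ` ?X"
  proof
    fix \<chi> assume "\<chi> \<in> ?S"
    then have \<chi>: "\<chi> \<in> cycles" "\<chi> \<inter> \<phi> \<noteq> {}" "card (\<chi> - \<phi>) = 1" by auto
    obtain i a a' j d d' e b b' f c c' where t: "\<chi> = cycle_pattern i a a' j d d' e b b' f c c'"
      "((i, a), (e, b)) \<in> \<phi>" "cycle_tuple i a a' j d d' e b b' f c c'"
      by (rule cycle_overlap[OF \<chi>(1,2)])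
    note D = cycle_tupleD[OF t(3)] and N = cycle_tuple_distinct[OF t(3)]
    consider "((i, a'), (f, c')) \<in> \<phi>" "((j, d), (e, b')) \<in> \<phi>" | "((i, a'), (f, c')) \<in> \<phi>" "((j, d'), (f, c)) \<in> \<phi>"
      | "((j, d), (e, b')) \<in> \<phi>" "((j, d'), (f, c)) \<in> \<phi>"
    proof (rule ccontr)
      assume "\<not> thesis"
      with that have "((i, a'), (f, c')) \<notin> \<phi> \<and> ((j, d), (e, b')) \<notin> \<phi> \<or> ((i, a'), (f, c')) \<notin> \<phi> \<and> ((j, d'), (f, c)) \<notin> \<phi>
        \<or> ((j, d), (e, b')) \<notin> \<phi> \<and> ((j, d'), (f, c)) \<notin> \<phi>" by blast
      then have "card (\<chi> - \<phi>) \<noteq> 1"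
        using t(2) N by (elim disjE) (auto simp: t(1) cycle_pattern_def insert_Diff_if)
      then show False using \<chi>(3) by simp
    qed
    then show "\<chi> \<in> ?h1 ` ?X \<union> ?h2 ` ?X \<union> ?h3 ` ?X"
    proof cases
      case 1
      have "\<chi> = ?h1 ((((i, a), (e, b)), ((i, a'), (f, c')), ((j, d), (e, b'))), d', c)" using t by simp
      moreover have "((((i, a), (e, b)), ((i, a'), (f, c')), ((j, d), (e, b'))), d', c) \<in> ?X"
        using t(2) 1 D by simp
      ultimately have "\<chi> \<in> ?h1 ` ?X" by (rule image_eqI)
      then show ?thesis by blast
    next
      case 2
      have "\<chi> = ?h2 ((((i, a), (e, b)), ((i, a'), (f, c')), ((j, d'), (f, c))), d, b')" using t by simp
      moreover have "((((i, a), (e, b)), ((i, a'), (f, c')), ((j, d'), (f, c))), d, b') \<in> ?X"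
        using t(2) 2 D by simp
      ultimately have "\<chi> \<in> ?h2 ` ?X" by (rule image_eqI)
      then show ?thesis by blast
    next
      case 3
      have "\<chi> = ?h3 ((((i, a), (e, b)), ((j, d), (e, b')), ((j, d'), (f, c))), a', c')" using t by simp
      moreover have "((((i, a), (e, b)), ((j, d), (e, b')), ((j, d'), (f, c))), a', c') \<in> ?X"
        using t(2) 3 D by simp
      ultimately have "\<chi> \<in> ?h3 ` ?X" by (rule image_eqI)
      then show ?thesis by blast
    qed
  qed
  then have "card ?S \<le> card ?X + card ?X + card ?X"
    by (rule card_image_three_le[rotated 3]) (simp_all add: \<phi>)
  also have "\<dots> = 3 * (card \<phi> * card \<phi> * card \<phi> * (K * r))"
    by (simp add: card_cartesian_product)
  also have "\<dots> \<le> 3 * (4 * 4 * 4 * (K * r))"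
    by (intro mult_mono \<phi>) auto
  finally show ?thesis by simp
qed

end

lemma sum_Un_le:
  fixes f :: "'a \<Rightarrow> real"
  assumes "finite A" "finite B" "\<And>x. x \<in> A \<union> B \<Longrightarrow> f x \<ge> 0"
  shows "sum f (A \<union> B) \<le> sum f A + sum f B"
proof -
  have "0 \<le> sum f (A \<inter> B)" using assms(3) by (intro sum_nonneg) auto
  then show ?thesis using sum.union_inter[OF assms(1,2), of f] by linarith
qed

context degree_model
begin

lemma loops_cycles_disjoint: "loops \<inter> cycles = {}"
  using card_loop card_cycle by fastforce

lemma sum_patterns:
  fixes g :: "nat \<Rightarrow> real"
  shows "(\<Sum>\<chi> | \<chi> \<in> loops \<union> cycles \<and> P \<chi>. g (card \<chi>)) =
    real (card {\<chi> \<in> loops. P \<chi>}) * g 2 + real (card {\<chi> \<in> cycles. P \<chi>}) * g 4"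
proof -
  have "{\<chi>. \<chi> \<in> loops \<union> cycles \<and> P \<chi>} = {\<chi> \<in> loops. P \<chi>} \<union> {\<chi> \<in> cycles. P \<chi>}" by auto
  then have "(\<Sum>\<chi> | \<chi> \<in> loops \<union> cycles \<and> P \<chi>. g (card \<chi>)) =
      (\<Sum>\<chi> | \<chi> \<in> loops \<and> P \<chi>. g (card \<chi>)) + (\<Sum>\<chi> | \<chi> \<in> cycles \<and> P \<chi>. g (card \<chi>))"
    using loops_cycles_disjoint by (simp only:, intro sum.union_disjoint) auto
  also have "(\<Sum>\<chi> | \<chi> \<in> loops \<and> P \<chi>. g (card \<chi>)) = (\<Sum>\<chi> | \<chi> \<in> loops \<and> P \<chi>. g 2)"
    by (intro sum.cong) (auto simp: card_loop)
  also have "(\<Sum>\<chi> | \<chi> \<in> cycles \<and> P \<chi>. g (card \<chi>)) = (\<Sum>\<chi> | \<chi> \<in> cycles \<and> P \<chi>. g 4)"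
    by (intro sum.cong) (auto simp: card_cycle)
  finally show ?thesis by simp
qed

section \<open>Loops and 4-cycles form a pattern family\<close>

abbreviation \<delta> :: real where
  "\<delta> \<equiv> real K ^ 2 * real r ^ 2 / real (m * r)"

lemma M_pos: "m * r \<ge> 128 \<Longrightarrow> real (m * r) > 0"
  unfolding of_nat_0_less_iff by linarith

lemma inverse_falling_le:
  assumes "d \<le> 8" "m * r \<ge> 128"
  shows "1 / falling (m * r) d \<le> 2 / real (m * r) ^ d"
proof -
  have "real (m * r) ^ d / 2 \<le> falling (m * r) d" using falling_lower assms by blast
  moreover have "real (m * r) ^ d > 0" using M_pos assms by (intro zero_less_power) auto
  ultimately have "1 / falling (m * r) d \<le> 1 / (real (m * r) ^ d / 2)"
    using assms by (intro divide_left_mono mult_pos_pos falling_pos) auto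
  then show ?thesis by simp
qed

text \<open>Loops contribute at most 2 K r / M and 4-cycles at most 2 K^2 r^2 / M, where the 2 comes
  from replacing falling factorials by powers. This is the origin of
  \<open>\<kappa> = 4 * \<delta>\<close>.\<close>

lemma touch_bound:
  assumes M: "m * r \<ge> 128" and K: "K \<ge> 1" and c2: "c2 \<le> K * (m * r) * r" and c4: "c4 \<le> K\<^sup>2 * r\<^sup>2 * (m * r) ^ 3"
  shows "real c2 * (1 / falling (m * r) 2) + real c4 * (1 / falling (m * r) 4) \<le> 4 * \<delta>"
proof -
  let ?M = "real (m * r)"
  have Mpos: "?M > 0" using M by (rule M_pos)
  have r: "r \<ge> 1" using M by (cases r) auto
  have "real c2 \<le> real (K * (m * r) * r)" using c2 by (simp only: of_nat_le_iff)
  also have "\<dots> = real K * ?M * real r" by simp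
  finally have c2': "real c2 \<le> real K * ?M * real r" .
  have "real c4 \<le> real (K\<^sup>2 * r\<^sup>2 * (m * r) ^ 3)" using c4 by (simp only: of_nat_le_iff)
  also have "\<dots> = real K ^ 2 * real r ^ 2 * ?M ^ 3" by (simp only: of_nat_mult of_nat_power)
  finally have c4': "real c4 \<le> real K ^ 2 * real r ^ 2 * ?M ^ 3" .
  have "real c2 * (1 / falling (m * r) 2) \<le> (real K * ?M * real r) * (2 / ?M ^ 2)"
    using c2' inverse_falling_le[of 2] M falling_pos[of 2 "m * r"] by (intro mult_mono) auto
  also have "\<dots> = 2 * (real K * real r) / ?M" using Mpos by (simp add: power2_eq_square del: of_nat_mult)
  also have "\<dots> \<le> 2 * (real K ^ 2 * real r ^ 2) / ?M"
    using Mpos K r by (intro divide_right_mono mult_left_mono mult_mono self_le_power) auto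
  finally have 1: "real c2 * (1 / falling (m * r) 2) \<le> 2 * \<delta>" by simp
  have "real c4 * (1 / falling (m * r) 4) \<le> (real K ^ 2 * real r ^ 2 * ?M ^ 3) * (2 / ?M ^ 4)"
    using c4' inverse_falling_le[of 4] M falling_pos[of 4 "m * r"] by (intro mult_mono) auto
  also have "\<dots> = 2 * \<delta>" using Mpos by (simp add: power_numeral_reduce del: of_nat_mult)
  finally show ?thesis using 1 by linarith
qed

text \<open>Once \<open>\<phi>\<close> is present, every incidence of \<open>\<chi>\<close> outside
  \<open>\<phi>\<close> costs a factor of about 1 / M; the total inaccuracy is at most 2.\<close>

lemma falling_overlap:
  assumes M: "m * r \<ge> 128" and \<phi>: "finite \<phi>" "card \<phi> \<le> 4" and \<chi>: "finite \<chi>" "card \<chi> \<le> 4"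
  shows "1 / falling (m * r) (card (\<phi> \<union> \<chi>)) \<le> (2 / real (m * r) ^ card (\<chi> - \<phi>)) / falling (m * r) (card \<phi>)"
proof -
  let ?j = "card (\<chi> - \<phi>)" and ?M = "real (m * r)"
  have j: "?j \<le> 4" using card_mono[of \<chi> "\<chi> - \<phi>"] \<chi> by auto
  have c: "card (\<phi> \<union> \<chi>) = card \<phi> + ?j"
    using card_Un_disjoint[of \<phi> "\<chi> - \<phi>"] \<phi> \<chi> by auto
  have f: "falling (m * r) (card \<phi>) > 0" using M \<phi> by (intro falling_pos) simp
  have p: "?M ^ ?j > 0" using M_pos[OF M] by (rule zero_less_power)
  have fu: "falling (m * r) (card (\<phi> \<union> \<chi>)) > 0" using M \<phi> j by (intro falling_pos) (simp add: c)
  have "?M ^ ?j / 2 \<le> (\<Prod>i<?j. real (m * r) - real (card \<phi>) - real i)"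
    using j \<phi> M by (intro falling_shift_lower) auto
  then have "falling (m * r) (card \<phi>) * (?M ^ ?j / 2) \<le> falling (m * r) (card (\<phi> \<union> \<chi>))"
    unfolding c falling_add using f by (intro mult_left_mono) auto
  then have "1 / falling (m * r) (card (\<phi> \<union> \<chi>)) \<le> 1 / (falling (m * r) (card \<phi>) * (?M ^ ?j / 2))"
    using f p fu by (intro divide_left_mono mult_pos_pos) auto
  also have "\<dots> = (2 / ?M ^ ?j) / falling (m * r) (card \<phi>)" by simp
  finally show ?thesis .
qed

text \<open>For each number j of incidences outside \<open>\<phi>\<close>, the number of overlapping
  patterns times M^(-j) is a constant times \<open>\<delta>\<close>. The constants are 4 for loops
  and 192, 48 and 4 for 4-cycles with j = 1, 2, 3. Their sum 248 is doubled by
  \<open>falling_overlap\<close>, and 496 is rounded up to 500.\<close>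

lemma overlap_bound:
  assumes M: "m * r \<ge> 128" and K: "K \<ge> 1" and \<phi>: "\<phi> \<in> loops \<union> cycles"
  shows "(\<Sum>\<chi> | \<chi> \<in> loops \<union> cycles \<and> \<chi> \<noteq> \<phi> \<and> \<chi> \<inter> \<phi> \<noteq> {}. 1 / falling (m * r) (card (\<phi> \<union> \<chi>)))
    \<le> (500 * \<delta>) / falling (m * r) (card \<phi>)"
proof -
  let ?M = "real (m * r)" and ?G = "{\<chi>. \<chi> \<in> loops \<union> cycles \<and> \<chi> \<noteq> \<phi> \<and> \<chi> \<inter> \<phi> \<noteq> {}}"
  have Mpos: "?M > 0" using M by (rule M_pos)
  have pos: "K > 0" "r > 0" "m > 0" using M K by (auto intro: Suc_leI gr0I)
  have KK: "real K \<le> real K ^ 2" "real r \<le> real r ^ 2" using pos by (auto intro: self_le_power)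
  have fin: "finite \<chi>" if "\<chi> \<in> loops \<union> cycles" for \<chi>
    using that loops_subset cycles_subset finite_subset[of \<chi> "points \<times> slots"] finite_points finite_slots by blast
  have c4: "card \<chi> \<le> 4" if "\<chi> \<in> loops \<union> cycles" for \<chi>
    using that card_loop card_cycle by fastforce
  note \<phi>' = fin[OF \<phi>] c4[OF \<phi>]
  have f: "falling (m * r) (card \<phi>) > 0" using M \<phi>' by (intro falling_pos) simp
  define L where "L = {\<chi> \<in> loops. \<chi> \<inter> \<phi> \<noteq> {}} \<inter> ?G"
  define C1 where "C1 = {\<chi> \<in> cycles. \<chi> \<inter> \<phi> \<noteq> {} \<and> card (\<chi> - \<phi>) = 1}"
  define C2 where "C2 = {\<chi> \<in> cycles. \<chi> \<inter> \<phi> \<noteq> {} \<and> card (\<chi> - \<phi>) = 2}"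
  define C3 where "C3 = {\<chi> \<in> cycles. \<chi> \<inter> \<phi> \<noteq> {} \<and> card (\<chi> - \<phi>) = 3}"
  have finC: "finite L" "finite C1" "finite C2" "finite C3"
    by (auto simp: L_def C1_def C2_def C3_def)
  let ?u = "\<lambda>\<chi>. 2 / ?M ^ card (\<chi> - \<phi>)"
  have u0: "?u \<chi> \<ge> 0" for \<chi> by simp
  \<comment> \<open>\<open>pattern_antichain\<close> yields an incidence outside
    \<open>\<phi>\<close>, and the overlap yields one inside.\<close>
  have less: "0 < card (\<chi> - \<phi>) \<and> card (\<chi> - \<phi>) < card \<chi>" if "\<chi> \<in> ?G" for \<chi>
  proof -
    have "\<not> \<chi> \<subseteq> \<phi>" using pattern_antichain[of \<chi> \<phi>] that \<phi> by auto
    moreover have "\<chi> - \<phi> \<subset> \<chi>" using that by auto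
    ultimately show ?thesis using fin[of \<chi>] that by (auto intro: psubset_card_mono simp: card_gt_0_iff)
  qed
  have sub: "?G \<subseteq> L \<union> C1 \<union> C2 \<union> C3"
  proof
    fix \<chi> assume G: "\<chi> \<in> ?G"
    show "\<chi> \<in> L \<union> C1 \<union> C2 \<union> C3"
    proof (cases "\<chi> \<in> loops")
      case True
      then show ?thesis using G by (simp add: L_def)
    next
      case False
      then have "\<chi> \<in> cycles" using G by auto
      moreover from this have "card (\<chi> - \<phi>) = 1 \<or> card (\<chi> - \<phi>) = 2 \<or> card (\<chi> - \<phi>) = 3"
        using less[OF G] card_cycle by fastforce
      ultimately show ?thesis using G by (auto simp: C1_def C2_def C3_def)
    qed
  qed
  have "(\<Sum>\<chi>\<in>?G. ?u \<chi>) \<le> (\<Sum>\<chi>\<in>L \<union> C1 \<union> C2 \<union> C3. ?u \<chi>)"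
    using finC sub u0 by (intro sum_mono2) auto
  also have "\<dots> \<le> sum ?u (L \<union> C1 \<union> C2) + sum ?u C3" using finC u0 by (intro sum_Un_le) auto
  also have "sum ?u (L \<union> C1 \<union> C2) \<le> sum ?u (L \<union> C1) + sum ?u C2" using finC u0 by (intro sum_Un_le) auto
  also have "sum ?u (L \<union> C1) \<le> sum ?u L + sum ?u C1" using finC u0 by (intro sum_Un_le) auto
  also have "sum ?u L = (\<Sum>\<chi>\<in>L. 2 / ?M)"
  proof (intro sum.cong refl)
    fix \<chi> assume "\<chi> \<in> L"
    then have "card (\<chi> - \<phi>) = 1" using less[of \<chi>] card_loop[of \<chi>] by (auto simp: L_def)
    then show "?u \<chi> = 2 / ?M" by simp
  qed
  also have "sum ?u C1 = (\<Sum>\<chi>\<in>C1. 2 / ?M)" by (intro sum.cong) (auto simp: C1_def)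
  also have "sum ?u C2 = (\<Sum>\<chi>\<in>C2. 2 / ?M ^ 2)" by (intro sum.cong) (auto simp: C2_def)
  also have "sum ?u C3 = (\<Sum>\<chi>\<in>C3. 2 / ?M ^ 3)" by (intro sum.cong) (auto simp: C3_def)
  finally have 1: "(\<Sum>\<chi>\<in>?G. ?u \<chi>) \<le>
    real (card L) * (2 / ?M) + real (card C1) * (2 / ?M) + real (card C2) * (2 / ?M ^ 2) + real (card C3) * (2 / ?M ^ 3)"
    by (simp only: sum_constant)
  have "card L \<le> 4 * (K * r)"
    using card_loops_overlap[OF \<phi>'] card_mono[of "{\<chi> \<in> loops. \<chi> \<inter> \<phi> \<noteq> {}}" L] by (auto simp: L_def)
  then have "real (card L) \<le> real (4 * (K * r))" by (simp only: of_nat_le_iff)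
  also have "\<dots> = 4 * (real K * real r)" by simp
  also have "\<dots> \<le> 4 * (real K ^ 2 * real r ^ 2)" using KK by (intro mult_left_mono mult_mono) auto
  finally have L: "real (card L) * (2 / ?M) \<le> 4 * (real K ^ 2 * real r ^ 2) * (2 / ?M)"
    by (rule mult_right_mono) simp
  have "card C1 \<le> 192 * (K * r)" using card_cycles_overlap1[OF \<phi>'] by (simp only: C1_def)
  then have "real (card C1) \<le> real (192 * (K * r))" by (simp only: of_nat_le_iff)
  also have "\<dots> = 192 * (real K * real r)" by simp
  also have "\<dots> \<le> 192 * (real K ^ 2 * real r ^ 2)" using KK by (intro mult_left_mono mult_mono) auto
  finally have C1: "real (card C1) * (2 / ?M) \<le> 192 * (real K ^ 2 * real r ^ 2) * (2 / ?M)"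
    by (rule mult_right_mono) simp
  have "card C2 \<le> 48 * (K\<^sup>2 * r\<^sup>2 * (m * r))"
    using card_cycles_overlap2[OF \<phi>' pos] by (simp only: C2_def)
  then have "real (card C2) \<le> real (48 * (K\<^sup>2 * r\<^sup>2 * (m * r)))" by (simp only: of_nat_le_iff)
  also have "\<dots> = 48 * (real K ^ 2 * real r ^ 2 * ?M)" by (simp only: of_nat_mult of_nat_power of_nat_numeral)
  finally have "real (card C2) * (2 / ?M ^ 2) \<le> 48 * (real K ^ 2 * real r ^ 2 * ?M) * (2 / ?M ^ 2)"
    by (rule mult_right_mono) simp
  also have "\<dots> = 48 * (real K ^ 2 * real r ^ 2) * (2 / ?M)" using Mpos by (simp add: power2_eq_square del: of_nat_mult)
  finally have C2: "real (card C2) * (2 / ?M ^ 2) \<le> 48 * (real K ^ 2 * real r ^ 2) * (2 / ?M)" .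
  have "card C3 \<le> card {\<chi> \<in> cycles. \<chi> \<inter> \<phi> \<noteq> {}}" by (intro card_mono) (auto simp: C3_def)
  also have "\<dots> \<le> 4 * (K\<^sup>2 * r\<^sup>2 * (m * r) ^ 2)" by (rule card_cycles_overlap3[OF \<phi>'])
  finally have "real (card C3) \<le> real (4 * (K\<^sup>2 * r\<^sup>2 * (m * r) ^ 2))" by (simp only: of_nat_le_iff)
  also have "\<dots> = 4 * (real K ^ 2 * real r ^ 2 * ?M ^ 2)" by (simp only: of_nat_mult of_nat_power of_nat_numeral)
  finally have "real (card C3) * (2 / ?M ^ 3) \<le> 4 * (real K ^ 2 * real r ^ 2 * ?M ^ 2) * (2 / ?M ^ 3)"
    by (rule mult_right_mono) simp
  also have "\<dots> = 4 * (real K ^ 2 * real r ^ 2) * (2 / ?M)"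
    using Mpos by (simp add: power2_eq_square power3_eq_cube del: of_nat_mult)
  finally have C3: "real (card C3) * (2 / ?M ^ 3) \<le> 4 * (real K ^ 2 * real r ^ 2) * (2 / ?M)" .
  have "(\<Sum>\<chi>\<in>?G. ?u \<chi>) \<le> 248 * (real K ^ 2 * real r ^ 2) * (2 / ?M)"
    using 1 L C1 C2 C3 by (simp only: distrib_right)
  also have "\<dots> \<le> 500 * \<delta>" using Mpos by (simp add: divide_right_mono del: of_nat_mult)
  finally have 2: "(\<Sum>\<chi>\<in>?G. ?u \<chi>) \<le> 500 * \<delta>" .
  have "(\<Sum>\<chi>\<in>?G. 1 / falling (m * r) (card (\<phi> \<union> \<chi>))) \<le> (\<Sum>\<chi>\<in>?G. ?u \<chi> / falling (m * r) (card \<phi>))"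
    using fin c4 \<phi>' M by (intro sum_mono falling_overlap) auto
  also have "\<dots> = (\<Sum>\<chi>\<in>?G. ?u \<chi>) / falling (m * r) (card \<phi>)" by (simp only: sum_divide_distrib)
  also have "\<dots> \<le> (500 * \<delta>) / falling (m * r) (card \<phi>)" using 2 f by (intro divide_right_mono) auto
  finally show ?thesis .
qed

lemma pattern_family:
  assumes M: "m * r \<ge> 128" and K: "K \<ge> 1" and \<delta>: "\<delta> \<le> 1 / 512"
  shows "pattern_family points slots (m * r) (loops \<union> cycles) (4 * \<delta>) (500 * \<delta>)"
proof unfold_locales
  show "finite (loops \<union> cycles)" by (rule finite_loops_cycles)
  fix \<chi> assume \<chi>: "\<chi> \<in> loops \<union> cycles"
  have "card \<chi> = 2 \<or> card \<chi> = 4" using \<chi> card_loop card_cycle by blast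
  then have "\<chi> \<noteq> {}" "card \<chi> \<le> 4" by auto
  then show "\<chi> \<subseteq> points \<times> slots \<and> \<chi> \<noteq> {} \<and> card \<chi> \<le> 4 \<and> inj_on fst \<chi> \<and> inj_on snd \<chi>"
    using \<chi> loops_subset cycles_subset inj_on_pattern by blast
next
  fix x assume "x \<in> points"
  show "(\<Sum>\<chi> | \<chi> \<in> loops \<union> cycles \<and> x \<in> fst ` \<chi>. 1 / falling (m * r) (card \<chi>)) \<le> 4 * \<delta>"
    unfolding sum_patterns[where g = "\<lambda>d. 1 / falling (m * r) d"] by (intro touch_bound M K card_loops_fst card_cycles_fst)
next
  fix x assume "x \<in> slots"
  show "(\<Sum>\<chi> | \<chi> \<in> loops \<union> cycles \<and> x \<in> snd ` \<chi>. 1 / falling (m * r) (card \<chi>)) \<le> 4 * \<delta>"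
    unfolding sum_patterns[where g = "\<lambda>d. 1 / falling (m * r) d"] by (intro touch_bound M K card_loops_snd card_cycles_snd)
next
  fix \<phi> assume "\<phi> \<in> loops \<union> cycles"
  then show "(\<Sum>\<chi> | \<chi> \<in> loops \<union> cycles \<and> \<chi> \<noteq> \<phi> \<and> \<chi> \<inter> \<phi> \<noteq> {}. 1 / falling (m * r) (card (\<phi> \<union> \<chi>)))
      \<le> (500 * \<delta>) / falling (m * r) (card \<phi>)"
    by (rule overlap_bound[OF M K])
next
  show "4 * \<delta> \<le> 1 / 128" using \<delta> by linarith
qed (use M in auto)

section \<open>Exact numbers of loops and 4-cycles\<close>

lemma card_loops: "2 * card loops = (\<Sum>i = 1..n. k i * (k i - 1)) * (m * (r * (r - 1)))"
proof -
  \<comment> \<open>Exchanging its incidences gives a loop two descriptions. Ordering the points,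
    with the slots left unordered, selects one of them.\<close>
  let ?T = "(SIGMA i:{1..n}. SIGMA a:{..<k i}. {..<a}) \<times> {..<m} \<times> distinct_pairs r"
  let ?h = "\<lambda>((i, a, a'), e, b, b'). loop_pattern i a a' e b b'"
  have tri: "2 * (\<Sum>a<q. a) = q * (q - 1)" for q :: nat
    by (induction q) (auto simp: algebra_simps)
  have "loops = ?h ` ?T"
  proof (intro equalityI subsetI)
    fix \<chi> assume "\<chi> \<in> loops"
    then obtain i a a' e b b' where \<chi>: "\<chi> = loop_pattern i a a' e b b'" and t:
      "i \<in> {1..n}" "(a, a') \<in> distinct_pairs (k i)" "e < m" "(b, b') \<in> distinct_pairs r"
      unfolding loops_def by blast
    have "\<chi> = ?h ((i, a, a'), e, b, b')" using \<chi> by simp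
    moreover have "\<chi> = ?h ((i, a', a), e, b', b)" using \<chi> by (auto simp: loop_pattern_def)
    moreover have "((i, a, a'), e, b, b') \<in> ?T \<or> ((i, a', a), e, b', b) \<in> ?T"
      using t by (auto simp: distinct_pairs_def)
    ultimately show "\<chi> \<in> ?h ` ?T" by (elim disjE) (rule image_eqI, assumption, assumption)+
  next
    fix \<chi> assume "\<chi> \<in> ?h ` ?T"
    then obtain i a a' e b b' where "\<chi> = loop_pattern i a a' e b b'" "i \<in> {1..n}" "a < k i" "a' < a" "e < m" "(b, b') \<in> distinct_pairs r"
      by auto
    then show "\<chi> \<in> loops" unfolding loops_def distinct_pairs_def by fastforce
  qed
  moreover have "inj_on ?h ?T"
    by (rule inj_onI) (auto simp: loop_pattern_def doubleton_eq_iff)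
  ultimately have "card loops = card ?T" by (simp add: card_image)
  also have "\<dots> = (\<Sum>i = 1..n. \<Sum>a<k i. a) * (m * (r * (r - 1)))"
    by (simp add: card_cartesian_product card_distinct_pairs)
  finally have "2 * card loops = (\<Sum>i = 1..n. 2 * (\<Sum>a<k i. a)) * (m * (r * (r - 1)))"
    by (simp add: sum_distrib_left mult.assoc)
  then show ?thesis by (simp add: tri)
qed

text \<open>A device for reading off the parameters: a 4-cycle has exactly one incidence at each
  pair of one of its vertices and one of its edges.\<close>

definition incidences_at :: "nat \<Rightarrow> nat \<Rightarrow> incidence set \<Rightarrow> incidence set" where
  "incidences_at i e \<chi> = {p \<in> \<chi>. fst (fst p) = i \<and> fst (snd p) = e}"

lemma incidences_at_cycle:
  assumes "i \<noteq> j" "e \<noteq> f"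
  shows "incidences_at i e (cycle_pattern i a a' j d d' e b b' f c c') = {((i, a), (e, b))}"
    "incidences_at i f (cycle_pattern i a a' j d d' e b b' f c c') = {((i, a'), (f, c'))}"
    "incidences_at j e (cycle_pattern i a a' j d d' e b b' f c c') = {((j, d), (e, b'))}"
    "incidences_at j f (cycle_pattern i a a' j d d' e b b' f c c') = {((j, d'), (f, c))}"
  using assms by (auto simp: incidences_at_def cycle_pattern_def)

text \<open>Exchanging the two vertices or the two edges gives each 4-cycle four descriptions, of
  which i < j and e < f select one. One factor 2 stays in the sum over vertices, to fit
  \<open>sum_ordered_pairs\<close>; the other turns the number of pairs of edges into
  \<open>m * (m - 1)\<close>.\<close>

lemma card_cycles: "4 * card cycles =
  (\<Sum>j = 1..n. \<Sum>i \<in> {1..<j}. 2 * (k i * (k i - 1)) * (k j * (k j - 1))) * (m * (m - 1) * (r * (r - 1))\<^sup>2)"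
proof -
  let ?U = "SIGMA j:{1..n}. SIGMA i:{1..<j}. distinct_pairs (k i) \<times> distinct_pairs (k j)"
  let ?V = "(SIGMA f:{..<m}. {..<f}) \<times> distinct_pairs r \<times> distinct_pairs r"
  let ?h = "\<lambda>((j, i, (a, a'), (d, d')), (f, e), (b, b'), (c, c')). cycle_pattern i a a' j d d' e b b' f c c'"
  have tri: "2 * (\<Sum>a<q. a) = q * (q - 1)" for q :: nat
    by (induction q) (auto simp: algebra_simps)
  have "cycles = ?h ` (?U \<times> ?V)"
  proof (intro equalityI subsetI)
    fix \<chi> assume "\<chi> \<in> cycles"
    then obtain i a a' j d d' e b b' f c c' where \<chi>: "\<chi> = cycle_pattern i a a' j d d' e b b' f c c'"
      and t: "cycle_tuple i a a' j d d' e b b' f c c'"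
      unfolding cycles_def by blast
    have mem: "x \<in> ?h ` (?U \<times> ?V)" if "x = cycle_pattern i a a' j d d' e b b' f c c'"
      "cycle_tuple i a a' j d d' e b b' f c c'" "i < j" "e < f" for x i a a' j d d' e b b' f c c'
    proof (rule image_eqI)
      show "x = ?h ((j, i, (a, a'), (d, d')), (f, e), (b, b'), (c, c'))" using that by simp
      show "((j, i, (a, a'), (d, d')), (f, e), (b, b'), (c, c')) \<in> ?U \<times> ?V"
        using that by (simp add: cycle_tuple_def)
    qed
    have s: "\<chi> = cycle_pattern j d d' i a a' e b' b f c' c" "\<chi> = cycle_pattern i a' a j d' d f c' c e b' b"
      "\<chi> = cycle_pattern j d' d i a' a f c c' e b b'"
      unfolding \<chi> cycle_pattern_def by blast+
    have t': "cycle_tuple j d d' i a a' e b' b f c' c" "cycle_tuple i a' a j d' d f c' c e b' b"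
      "cycle_tuple j d' d i a' a f c c' e b b'"
      using t distinct_pairs_sym unfolding cycle_tuple_def by blast+
    have "(i < j \<or> j < i) \<and> (e < f \<or> f < e)" using cycle_tuple_distinct[OF t] by auto
    then show "\<chi> \<in> ?h ` (?U \<times> ?V)"
      using mem[OF \<chi> t] mem[OF s(1) t'(1)] mem[OF s(2) t'(2)] mem[OF s(3) t'(3)] by blast
  next
    fix \<chi> assume "\<chi> \<in> ?h ` (?U \<times> ?V)"
    then obtain i a a' j d d' e b b' f c c' where \<chi>: "\<chi> = cycle_pattern i a a' j d d' e b b' f c c'"
      and t: "j \<in> {1..n}" "i \<in> {1..<j}" "(a, a') \<in> distinct_pairs (k i)" "(d, d') \<in> distinct_pairs (k j)"
        "f < m" "e < f" "(b, b') \<in> distinct_pairs r" "(c, c') \<in> distinct_pairs r"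
      by auto
    have "cycle_tuple i a a' j d d' e b b' f c c'" using t by (simp add: cycle_tuple_def)
    then show "\<chi> \<in> cycles" using \<chi> unfolding cycles_def by blast
  qed
  moreover have "inj_on ?h (?U \<times> ?V)"
  proof (rule inj_onI)
    fix x y assume x: "x \<in> ?U \<times> ?V" and y: "y \<in> ?U \<times> ?V" and xy: "?h x = ?h y"
    obtain i a a' j d d' e b b' f c c' where x': "x = ((j, i, (a, a'), (d, d')), (f, e), (b, b'), (c, c'))"
      by (metis prod.exhaust)
    obtain i1 a1 a1' j1 d1 d1' e1 b1 b1' f1 c1 c1' where y': "y = ((j1, i1, (a1, a1'), (d1, d1')), (f1, e1), (b1, b1'), (c1, c1'))"
      by (metis prod.exhaust)
    have ord: "i < j" "i1 < j1" "e < f" "e1 < f1" using x y by (simp_all add: x' y')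
    have eq: "cycle_pattern i a a' j d d' e b b' f c c' = cycle_pattern i1 a1 a1' j1 d1 d1' e1 b1 b1' f1 c1 c1'"
      using xy by (simp add: x' y')
    from arg_cong[OF eq, of "\<lambda>\<chi>. fst ` fst ` \<chi>"] have "{i, j} = {i1, j1}" by (auto simp: cycle_pattern_def)
    then have ij: "i1 = i" "j1 = j" using ord by (auto simp: doubleton_eq_iff)
    from arg_cong[OF eq, of "\<lambda>\<chi>. fst ` snd ` \<chi>"] have "{e, f} = {e1, f1}" by (auto simp: cycle_pattern_def)
    then have ef: "e1 = e" "f1 = f" using ord by (auto simp: doubleton_eq_iff)
    have ne: "i \<noteq> j" "e \<noteq> f" using ord by auto
    note at = incidences_at_cycle[OF ne]
    from arg_cong[OF eq, of "incidences_at i e"] arg_cong[OF eq, of "incidences_at i f"]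
      arg_cong[OF eq, of "incidences_at j e"] arg_cong[OF eq, of "incidences_at j f"]
    show "x = y"
      unfolding x' y' ij ef at by simp
  qed
  ultimately have "card cycles = card (?U \<times> ?V)" by (simp add: card_image)
  also have "\<dots> = (\<Sum>j = 1..n. \<Sum>i \<in> {1..<j}. (k i * (k i - 1)) * (k j * (k j - 1))) * ((\<Sum>f<m. f) * (r * (r - 1))\<^sup>2)"
    by (simp add: card_cartesian_product card_distinct_pairs power2_eq_square)
  finally have "4 * card cycles = 2 * (\<Sum>j = 1..n. \<Sum>i \<in> {1..<j}. (k i * (k i - 1)) * (k j * (k j - 1))) * (2 * (\<Sum>f<m. f) * (r * (r - 1))\<^sup>2)"
    by simp
  then show ?thesis unfolding tri by (simp add: sum_distrib_left mult.assoc)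
qed

end

section \<open>The expected number of loops and 4-cycles\<close>

text \<open>The expansion of a square. It expresses the sum over pairs of distinct vertices by the
  square of M_2 minus a diagonal sum, which will be an error term.\<close>

lemma sum_ordered_pairs:
  fixes q :: "nat \<Rightarrow> nat"
  shows "(\<Sum>j = 1..n. \<Sum>i \<in> {1..<j}. 2 * q i * q j) + (\<Sum>j = 1..n. (q j)\<^sup>2) = (\<Sum>j = 1..n. q j)\<^sup>2"
proof (induction n)
  case (Suc n)
  have "(\<Sum>i \<in> {1..<Suc n}. 2 * q i * q (Suc n)) = 2 * (\<Sum>j = 1..n. q j) * q (Suc n)"
    by (simp add: sum_distrib_left sum_distrib_right atLeastLessThanSuc_atLeastAtMost)
  then show ?case using Suc by (simp add: power2_eq_square algebra_simps)
qed simp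

text \<open>\<open>R\<close> is M (M - r) / \<open>falling M 4\<close>. The numerator comes from the
  ordered pairs of distinct edges, as \<open>m * (m - 1)\<close> times r^2 is M (M - r); the
  denominator comes from the weight of a 4-cycle.\<close>

lemma ratio_estimate:
  fixes M r :: real
  assumes M: "M \<ge> 128" and r: "1 \<le> r" "r \<le> M"
  defines "R \<equiv> (M - r) / ((M - 1) * (M - 2) * (M - 3))"
  shows "0 \<le> R" "R \<le> 2 / M\<^sup>2" "\<bar>R - 1 / M\<^sup>2\<bar> \<le> 16 * r / M ^ 3"
proof -
  let ?D = "(M - 1) * (M - 2) * (M - 3)"
  have Mp: "M > 0" using M by simp
  have "M * M * M = M ^ 3" by (simp add: power3_eq_cube)
  have MM: "M * 128 \<le> M * M" using M by (intro mult_left_mono) auto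
  have MMM: "M * M * 128 \<le> M * M * M" using M by (intro mult_left_mono) auto
  have D: "?D = M * M * M - 6 * (M * M) + 11 * M - 6" by (simp add: algebra_simps)
  have D2: "M ^ 3 / 2 \<le> ?D" unfolding D using M MM MMM \<open>M * M * M = M ^ 3\<close> by linarith
  have Dp: "?D > 0" using M by simp
  show "0 \<le> R" unfolding R_def using r Dp by (intro divide_nonneg_pos) auto
  have "R \<le> M / (M ^ 3 / 2)" unfolding R_def
    using r D2 Mp by (intro frac_le) auto
  also have "\<dots> = 2 / M\<^sup>2" using Mp by (simp add: power2_eq_square power3_eq_cube)
  finally show "R \<le> 2 / M\<^sup>2" .
  have frac: "x / y - 1 / z = (z * x - y) / (z * y)" if "y > 0" "z > 0" for x y z :: real
    using that by (simp add: field_simps)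
  have "R - 1 / M\<^sup>2 = (M\<^sup>2 * (M - r) - ?D) / (M\<^sup>2 * ?D)"
    unfolding R_def using Mp Dp by (intro frac) auto
  also have "M\<^sup>2 * (M - r) - ?D = 6 * (M * M) - r * (M * M) - 11 * M + 6"
    unfolding D by (simp add: power2_eq_square algebra_simps)
  finally have e: "\<bar>R - 1 / M\<^sup>2\<bar> = \<bar>6 * (M * M) - r * (M * M) - 11 * M + 6\<bar> / (M\<^sup>2 * ?D)"
    using Dp Mp by (simp only: abs_divide abs_of_pos[of "M\<^sup>2 * ?D"] mult_pos_pos zero_less_power)
  have rM: "M * M \<le> r * (M * M)" using r mult_right_mono[of 1 r "M * M"] by simp
  have "\<bar>6 * (M * M) - r * (M * M) - 11 * M + 6\<bar> \<le> 8 * (r * (M * M))"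
    using rM MM M by (intro abs_leI) linarith+
  then have "\<bar>R - 1 / M\<^sup>2\<bar> \<le> 8 * (r * (M * M)) / (M\<^sup>2 * (M ^ 3 / 2))"
    unfolding e using D2 Mp r by (intro frac_le mult_left_mono) auto
  also have "\<dots> = 16 * r / M ^ 3" using Mp by (simp add: power2_eq_square)
  finally show "\<bar>R - 1 / M\<^sup>2\<bar> \<le> 16 * r / M ^ 3" .
qed

text \<open>Three changes lead to the main term, each measured by K^4 r^4 / M: replacing M - 1 by M
  costs 1, dropping the diagonal sum \<open>Q\<close> costs 1, and replacing the ratio of
  \<open>ratio_estimate\<close> by 1 / M^2 costs 4.\<close>

lemma expectation_estimate:
  fixes M r K X Q :: real
  assumes M: "M \<ge> 128" and r: "1 \<le> r" "r \<le> M" and K: "K \<ge> 1"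
    and X: "0 \<le> X" "X \<le> K * M" and Q: "0 \<le> Q" "Q \<le> K ^ 3 * M"
  shows "\<bar>(X * (r - 1) / (2 * (M - 1)) + (X\<^sup>2 - Q) * (r - 1)\<^sup>2 / 4 * ((M - r) / ((M - 1) * (M - 2) * (M - 3))))
      - ((r - 1) * X / (2 * M) + (r - 1)\<^sup>2 * X\<^sup>2 / (4 * M\<^sup>2))\<bar> \<le> 6 * (K ^ 4 * r ^ 4 / M)"
proof -
  let ?R = "(M - r) / ((M - 1) * (M - 2) * (M - 3))"
  note R = ratio_estimate[OF M r]
  have Mp: "M > 0" "M - 1 > 0" using M by simp_all
  have r1: "0 \<le> r - 1" "r - 1 \<le> r" "(r - 1)\<^sup>2 \<le> r\<^sup>2" using r by (auto intro: power_mono)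
  have le: "K ^ a * r ^ b / M \<le> K ^ 4 * r ^ 4 / M" if "a \<le> 4" "b \<le> 4" for a b :: nat
    using that K r Mp by (intro divide_right_mono mult_mono power_increasing) auto
  have "X * (r - 1) / (2 * (M - 1)) - (r - 1) * X / (2 * M) = X * (r - 1) / (2 * M * (M - 1))"
    using Mp by (simp add: field_simps)
  moreover have "X * (r - 1) / (2 * M * (M - 1)) \<le> (K * M) * r / (2 * M * (M / 2))"
    using X r1 Mp M K r by (intro frac_le mult_mono mult_left_mono mult_pos_pos mult_nonneg_nonneg) auto
  moreover have "(K * M) * r / (2 * M * (M / 2)) = K ^ 1 * r ^ 1 / M" using Mp by simp
  moreover have "0 \<le> X * (r - 1) / (2 * M * (M - 1))" using X r1 Mp by simp
  ultimately have 1: "\<bar>X * (r - 1) / (2 * (M - 1)) - (r - 1) * X / (2 * M)\<bar> \<le> K ^ 4 * r ^ 4 / M"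
    using le[of 1 1] by linarith
  have "Q * (r - 1)\<^sup>2 / 4 * ?R \<le> (K ^ 3 * M) * r\<^sup>2 / 4 * (2 / M\<^sup>2)"
    using Q r1 R K r Mp by (intro mult_mono divide_right_mono) auto
  also have "\<dots> = (K ^ 3 * r ^ 2 / M) / 2" using Mp by (simp add: power2_eq_square ac_simps)
  also have "(K ^ 3 * r ^ 2 / M) / 2 \<le> K ^ 3 * r ^ 2 / M"
  proof -
    have half: "t / 2 \<le> t" if "0 \<le> t" for t :: real using that by simp
    show ?thesis by (rule half) (use Mp K in simp)
  qed
  finally have 2: "Q * (r - 1)\<^sup>2 / 4 * ?R \<le> K ^ 4 * r ^ 4 / M" using le[of 3 2] by simp
  have 20: "0 \<le> Q * (r - 1)\<^sup>2 / 4 * ?R" using Q R by (intro mult_nonneg_nonneg) auto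
  have "\<bar>X\<^sup>2 * (r - 1)\<^sup>2 / 4 * (?R - 1 / M\<^sup>2)\<bar> = X\<^sup>2 * (r - 1)\<^sup>2 / 4 * \<bar>?R - 1 / M\<^sup>2\<bar>"
    by (simp only: abs_mult) simp
  also have "\<dots> \<le> (K * M)\<^sup>2 * r\<^sup>2 / 4 * (16 * r / M ^ 3)"
    using X r1 R(3) K Mp by (intro mult_mono divide_right_mono power_mono) auto
  also have "\<dots> = 4 * (K ^ 2 * r ^ 3 / M)" using Mp by (simp add: power2_eq_square power3_eq_cube)
  finally have 3: "\<bar>X\<^sup>2 * (r - 1)\<^sup>2 / 4 * (?R - 1 / M\<^sup>2)\<bar> \<le> 4 * (K ^ 4 * r ^ 4 / M)"
    using le[of 2 3] by simp
  have "(X * (r - 1) / (2 * (M - 1)) + (X\<^sup>2 - Q) * (r - 1)\<^sup>2 / 4 * ?R) - ((r - 1) * X / (2 * M) + (r - 1)\<^sup>2 * X\<^sup>2 / (4 * M\<^sup>2))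
     = (X * (r - 1) / (2 * (M - 1)) - (r - 1) * X / (2 * M)) + X\<^sup>2 * (r - 1)\<^sup>2 / 4 * (?R - 1 / M\<^sup>2) - Q * (r - 1)\<^sup>2 / 4 * ?R"
    by (simp add: algebra_simps diff_divide_distrib)
  then show ?thesis using 1 2 20 3 by linarith
qed

context degree_model
begin

text \<open>The negative of the main exponent of the theorem; it differs from the exact expectation
  \<open>\<Lambda>\<close> by a small error.\<close>

definition expected :: real where
  "expected = (real r - 1) * real (\<Sum>i = 1..n. k i * (k i - 1)) / (2 * real (m * r)) +
     (real r - 1)\<^sup>2 * (real (\<Sum>i = 1..n. k i * (k i - 1)))\<^sup>2 / (4 * (real (m * r))\<^sup>2)"

lemma falling2_le: "i \<in> {1..n} \<Longrightarrow> k i * (k i - 1) \<le> K * k i"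
  using k_le[of i] by (simp add: mult.commute mult_le_mono2 le_diff_conv)

lemma deg_sum2_le: "(\<Sum>i = 1..n. k i * (k i - 1)) \<le> K * (m * r)"
  unfolding sum_degrees[symmetric] sum_distrib_left by (intro sum_mono falling2_le)

lemma pattern_weight_estimate:
  assumes M: "m * r \<ge> 128" and K: "K \<ge> 1"
  shows "\<bar>(\<Sum>\<chi>\<in>loops \<union> cycles. 1 / falling (m * r) (card \<chi>)) - expected\<bar> \<le> 6 * (\<delta> * (real K ^ 2 * real r ^ 2))"
proof -
  define X where "X = real (\<Sum>i = 1..n. k i * (k i - 1))"
  define Q where "Q = real (\<Sum>i = 1..n. (k i * (k i - 1))\<^sup>2)"
  let ?M = "real (m * r)" and ?r = "real r" and ?K = "real K"
  have M': "?M \<ge> 128" using M by (metis of_nat_le_iff of_nat_numeral)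
  have "r \<noteq> 0" "m \<noteq> 0" using M by (metis mult_0_right mult_0 not_numeral_le_zero)+
  then have r: "r \<ge> 1" "m \<ge> 1" by simp_all
  then have r': "1 \<le> ?r" "?r \<le> ?M" by auto
  have "X \<le> real (K * (m * r))" unfolding X_def of_nat_le_iff by (rule deg_sum2_le)
  then have X: "0 \<le> X" "X \<le> ?K * ?M" unfolding of_nat_mult[of K] by (simp_all only: X_def of_nat_0_le_iff)
  have kq: "(k i * (k i - 1))\<^sup>2 \<le> K ^ 3 * k i" if "i \<in> {1..n}" for i
  proof -
    have "(k i * (k i - 1))\<^sup>2 \<le> (K * k i)\<^sup>2" using falling2_le[OF that] by (intro power_mono) auto
    also have "\<dots> = K\<^sup>2 * k i * k i" by (simp add: power2_eq_square)
    also have "\<dots> \<le> K\<^sup>2 * k i * K" using k_le[OF that] by (intro mult_left_mono) auto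
    finally show ?thesis by (simp add: power2_eq_square power3_eq_cube mult.commute mult.left_commute)
  qed
  have "(\<Sum>i = 1..n. (k i * (k i - 1))\<^sup>2) \<le> (\<Sum>i = 1..n. K ^ 3 * k i)" by (intro sum_mono kq)
  then have "(\<Sum>i = 1..n. (k i * (k i - 1))\<^sup>2) \<le> K ^ 3 * (m * r)"
    unfolding sum_degrees[symmetric] sum_distrib_left .
  then have "Q \<le> real (K ^ 3 * (m * r))" unfolding Q_def by (simp only: of_nat_le_iff)
  then have Q: "0 \<le> Q" "Q \<le> ?K ^ 3 * ?M"
    unfolding of_nat_mult[of "K ^ 3"] of_nat_power by (simp_all only: Q_def of_nat_0_le_iff)
  have "2 * real (card loops) = real (2 * card loops)" by simp
  also have "\<dots> = X * (real m * (?r * (?r - 1)))"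
    unfolding card_loops X_def using r by (simp only: of_nat_mult of_nat_diff of_nat_1)
  finally have "real (card loops) = X * ?M * (?r - 1) / 2" by simp
  moreover have "falling (m * r) 2 = ?M * (?M - 1)"
    by (simp add: falling_def numeral_2_eq_2 lessThan_Suc)
  moreover have "(x * y * z / 2) * (1 / (y * (y - 1))) = x * z / (2 * (y - 1))" if "y \<ge> 128" for x y z :: real
    using that by (simp add: field_simps)
  ultimately have L: "real (card loops) * (1 / falling (m * r) 2) = X * (?r - 1) / (2 * (?M - 1))"
    using M' by (simp only:)
  have "real (\<Sum>j = 1..n. \<Sum>i \<in> {1..<j}. 2 * (k i * (k i - 1)) * (k j * (k j - 1))) + Q = X\<^sup>2"
    unfolding Q_def X_def using arg_cong[OF sum_ordered_pairs[of "\<lambda>i. k i * (k i - 1)" n], of real]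
    by (simp only: of_nat_add of_nat_power)
  then have S: "real (\<Sum>j = 1..n. \<Sum>i \<in> {1..<j}. 2 * (k i * (k i - 1)) * (k j * (k j - 1))) = X\<^sup>2 - Q" by linarith
  have "4 * real (card cycles) = real (4 * card cycles)" by simp
  also have "\<dots> = (X\<^sup>2 - Q) * (real m * (real m - 1) * (?r * (?r - 1))\<^sup>2)"
    unfolding card_cycles S[symmetric] using r by (simp only: of_nat_mult of_nat_diff of_nat_1 of_nat_power)
  also have "real m * (real m - 1) * (?r * (?r - 1))\<^sup>2 = ?M * (?M - ?r) * (?r - 1)\<^sup>2"
    by (simp add: power2_eq_square algebra_simps)
  finally have "real (card cycles) = ?M * ((X\<^sup>2 - Q) * (?r - 1)\<^sup>2 / 4 * (?M - ?r))" by (simp add: ac_simps)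
  moreover have "falling (m * r) 4 = ?M * ((?M - 1) * (?M - 2) * (?M - 3))"
    by (simp add: falling_def eval_nat_numeral lessThan_Suc)
  moreover have "(y * (p * q)) * (1 / (y * d)) = p * (q / d)" if "y \<ge> 128" for y p q d :: real
    using that by simp
  ultimately have C: "real (card cycles) * (1 / falling (m * r) 4) =
      (X\<^sup>2 - Q) * (?r - 1)\<^sup>2 / 4 * ((?M - ?r) / ((?M - 1) * (?M - 2) * (?M - 3)))"
    using M' by (simp only:)
  have "(\<Sum>\<chi>\<in>loops \<union> cycles. 1 / falling (m * r) (card \<chi>)) = real (card loops) * (1 / falling (m * r) 2) + real (card cycles) * (1 / falling (m * r) 4)"
    using sum_patterns[where g = "\<lambda>d. 1 / falling (m * r) d" and P = "\<lambda>_. True"] by (simp only: simp_thms Collect_mem_eq)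
  then have "(\<Sum>\<chi>\<in>loops \<union> cycles. 1 / falling (m * r) (card \<chi>)) - expected =
     (X * (?r - 1) / (2 * (?M - 1)) + (X\<^sup>2 - Q) * (?r - 1)\<^sup>2 / 4 * ((?M - ?r) / ((?M - 1) * (?M - 2) * (?M - 3))))
      - ((?r - 1) * X / (2 * ?M) + (?r - 1)\<^sup>2 * X\<^sup>2 / (4 * ?M\<^sup>2))"
    unfolding L C expected_def X_def by simp
  also have "\<bar>\<dots>\<bar> \<le> 6 * (?K ^ 4 * ?r ^ 4 / ?M)"
    using K by (intro expectation_estimate M' r' X Q) auto
  finally have "\<bar>(\<Sum>\<chi>\<in>loops \<union> cycles. 1 / falling (m * r) (card \<chi>)) - expected\<bar> \<le> 6 * (?K ^ 4 * ?r ^ 4 / ?M)" .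
  moreover have "x ^ 4 * y ^ 4 / z = x ^ 2 * y ^ 2 / z * (x ^ 2 * y ^ 2)" for x y z :: real
    by (simp add: power2_eq_square power4_eq_xxxx ac_simps)
  ultimately show ?thesis by (simp only:)
qed

text \<open>With t = (r - 1) M_2 / M the quantity is t / 2 + t^2 / 4, and t <= r K because M_2 <= K
  M. The upper bound will control \<open>\<Lambda>\<close>, by which all relative errors are
  multiplied.\<close>

lemma expected_bounds:
  assumes M: "m * r \<ge> 128" and K: "K \<ge> 1"
  shows "0 \<le> expected" "expected \<le> real K ^ 2 * real r ^ 2"
proof -
  define X where "X = real (\<Sum>i = 1..n. k i * (k i - 1))"
  let ?M = "real (m * r)" and ?r = "real r" and ?K = "real K"
  have Mp: "?M > 0" using M by (rule M_pos)
  have r: "1 \<le> ?r" using M by (cases r) auto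
  have "X \<le> real (K * (m * r))" unfolding X_def of_nat_le_iff by (rule deg_sum2_le)
  then have X: "0 \<le> X" "X \<le> ?K * ?M" unfolding of_nat_mult[of K] by (simp_all only: X_def of_nat_0_le_iff)
  then have XM: "0 \<le> X / ?M" "X / ?M \<le> ?K" using Mp by (auto simp: field_simps)
  have e: "expected = (?r - 1) * (X / ?M) / 2 + ((?r - 1) * (X / ?M))\<^sup>2 / 4"
    unfolding expected_def X_def[symmetric] by (simp add: power_mult_distrib power_divide)
  have "0 \<le> (?r - 1) * (X / ?M)" by (rule mult_nonneg_nonneg[OF _ XM(1)]) (use r in simp)
  then show "0 \<le> expected"
    unfolding e by (intro add_nonneg_nonneg divide_nonneg_nonneg zero_le_power2) auto
  have "(?r - 1) * (X / ?M) \<le> ?r * ?K" using r XM by (intro mult_mono) auto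
  moreover have "0 \<le> (?r - 1) * (X / ?M)" by (rule mult_nonneg_nonneg[OF _ XM(1)]) (use r in simp)
  ultimately have "expected \<le> (?r * ?K) / 2 + (?r * ?K)\<^sup>2 / 4"
    unfolding e by (intro add_mono divide_right_mono power_mono) auto
  also have "1 * 1 \<le> ?r * ?K" using r K by (intro mult_mono) auto
  then have rK: "?r * ?K \<le> (?r * ?K)\<^sup>2" by (simp add: self_le_power)
  have "t / 2 + s / 4 \<le> s" if "t \<le> s" "0 \<le> s" for t s :: real
    using that by linarith
  from this[OF rK] have "(?r * ?K) / 2 + (?r * ?K)\<^sup>2 / 4 \<le> (?r * ?K)\<^sup>2" by simp
  also have "(?r * ?K)\<^sup>2 = ?K ^ 2 * ?r ^ 2" by (simp only: power_mult_distrib mult.commute)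
  finally show "expected \<le> ?K ^ 2 * ?r ^ 2" .
qed

text \<open>With \<open>\<kappa> = 4 * \<delta>\<close> and \<open>\<zeta> = 500 * \<delta>\<close>
  the relative errors of the exponent become 160 \<open>\<delta>\<close> = 40 * 4
  \<open>\<delta>\<close> and 1256 \<open>\<delta>\<close> = (64 * 4 + 2 * 500)
  \<open>\<delta>\<close>. Since \<open>\<Lambda>\<close> is at most 2 K^2 r^2, the total error is
  at most (2 * 1256 + 6) \<open>\<delta>\<close> K^2 r^2, and 2518 is rounded up to 3000.\<close>

lemma avoiding_count:
  assumes M: "m * r \<ge> 128" and K: "K \<ge> 1" and \<delta>: "1256 * \<delta> \<le> 1"
  obtains \<epsilon> where "N (loops \<union> cycles) {} = fact (m * r) * exp (- expected + \<epsilon>)"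
    "\<bar>\<epsilon>\<bar> \<le> 3000 * (\<delta> * (real K ^ 2 * real r ^ 2))"
proof -
  interpret pattern_family points slots "m * r" "loops \<union> cycles" "4 * \<delta>" "500 * \<delta>"
    using \<delta> by (intro pattern_family M K) linarith
  let ?N = "N (loops \<union> cycles) {}" and ?T = "real K ^ 2 * real r ^ 2"
  have \<delta>0: "\<delta> \<ge> 0" by simp
  have upper: "?N \<le> fact (m * r) * exp (- (\<Lambda> * (1 - 64 * (4 * \<delta>) - 2 * (500 * \<delta>))))"
    by (rule N_avoid_upper) (use \<delta> in linarith)
  have lower: "fact (m * r) * exp (- (\<Lambda> * (1 + 40 * (4 * \<delta>)))) \<le> ?N" by (rule N_avoid_lower)
  define \<epsilon> where "\<epsilon> = ln (?N / fact (m * r)) + expected"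
  \<comment> \<open>The lower bound shows that avoiding bijections exist, so that the logarithm
    defining \<open>\<epsilon>\<close> is meaningful.\<close>
  have pos: "?N / fact (m * r) > 0"
    using lower by (intro divide_pos_pos less_le_trans[OF _ lower] mult_pos_pos) auto
  have "exp (- expected + \<epsilon>) = ?N / fact (m * r)" using pos by (simp add: \<epsilon>_def)
  then have eq: "?N = fact (m * r) * exp (- expected + \<epsilon>)" by simp
  have "?N / fact (m * r) \<le> exp (- (\<Lambda> * (1 - 64 * (4 * \<delta>) - 2 * (500 * \<delta>))))"
    using upper by (simp add: pos_divide_le_eq mult.commute)
  then have "ln (?N / fact (m * r)) \<le> - (\<Lambda> * (1 - 64 * (4 * \<delta>) - 2 * (500 * \<delta>)))"
    using pos by (metis exp_gt_zero ln_exp ln_le_cancel_iff)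
  then have u: "ln (?N / fact (m * r)) + \<Lambda> \<le> 1256 * (\<Lambda> * \<delta>)" by (simp add: algebra_simps)
  have "exp (- (\<Lambda> * (1 + 40 * (4 * \<delta>)))) \<le> ?N / fact (m * r)"
    using lower by (simp add: pos_le_divide_eq mult.commute)
  then have "- (\<Lambda> * (1 + 40 * (4 * \<delta>))) \<le> ln (?N / fact (m * r))"
    using pos by (metis exp_gt_zero ln_exp ln_le_cancel_iff)
  then have l: "- (160 * (\<Lambda> * \<delta>)) \<le> ln (?N / fact (m * r)) + \<Lambda>" by (simp add: algebra_simps)
  have est: "\<bar>\<Lambda> - expected\<bar> \<le> 6 * (\<delta> * ?T)"
    unfolding \<Lambda>_def by (rule pattern_weight_estimate[OF M K])
  have T0: "?T \<ge> 0" by simp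
  have "\<delta> * ?T \<le> (1/1256) * ?T" using \<delta> T0 by (intro mult_right_mono) linarith+
  then have "\<Lambda> \<le> 2 * ?T" using est expected_bounds[OF M K] by linarith
  then have "\<Lambda> * \<delta> \<le> 2 * ?T * \<delta>" using \<delta>0 by (intro mult_right_mono)
  then have L: "\<Lambda> * \<delta> \<le> 2 * (\<delta> * ?T)" by (simp only: mult.assoc mult.commute mult.left_commute)
  have L0: "0 \<le> \<Lambda> * \<delta>" using \<Lambda>_nonneg \<delta>0 by (rule mult_nonneg_nonneg)
  have D0: "0 \<le> \<delta> * ?T" using \<delta>0 T0 by (rule mult_nonneg_nonneg)
  have "\<bar>\<epsilon>\<bar> \<le> 3000 * (\<delta> * ?T)"
    unfolding \<epsilon>_def using u l est L L0 D0 by linarith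
  with eq show thesis by (rule that)
qed

end

section \<open>Linear hypergraphs as avoiding bijections\<close>

lemma bijectionsD:
  assumes "f \<in> bijections A B"
  shows "inj_on f A" "f ` A = B" "f \<in> extensional A" "x \<in> A \<Longrightarrow> f x \<in> B"
  using assms by (auto simp: bijections_def bij_betw_def)

lemma restrict_bijections: "bij_betw f A B \<Longrightarrow> restrict f A \<in> bijections A B"
  unfolding bijections_def by (auto intro: bij_betw_cong[THEN iffD1, rotated])

context degree_model
begin

definition loop_free :: "(nat \<times> nat \<Rightarrow> nat \<times> nat) \<Rightarrow> bool" where
  "loop_free f \<longleftrightarrow>
     (\<forall>i a a'. (i, a) \<in> points \<longrightarrow> (i, a') \<in> points \<longrightarrow> fst (f (i, a)) = fst (f (i, a')) \<longrightarrow> a = a')"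

text \<open>Slots do not appear: a bijection assigns distinct slots to distinct points, and points
  in distinct edges are distinct. So the edges of the points already decide whether a 4-cycle is
  present.\<close>

definition cycle_free :: "(nat \<times> nat \<Rightarrow> nat \<times> nat) \<Rightarrow> bool" where
  "cycle_free f \<longleftrightarrow>
     (\<forall>i j a a' d d'. (i, a) \<in> points \<longrightarrow> (i, a') \<in> points \<longrightarrow> (j, d) \<in> points \<longrightarrow> (j, d') \<in> points \<longrightarrow>
        fst (f (i, a)) = fst (f (j, d)) \<longrightarrow> fst (f (i, a')) = fst (f (j, d')) \<longrightarrow>
        fst (f (i, a)) \<noteq> fst (f (i, a')) \<longrightarrow> i = j)"

lemmas loop_freeI = loop_free_def[THEN iffD2, rule_format]
  and loop_freeD = loop_free_def[THEN iffD1, rule_format]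
  and cycle_freeI = cycle_free_def[THEN iffD2, rule_format]
  and cycle_freeD = cycle_free_def[THEN iffD1, rule_format]

definition good :: "(nat \<times> nat \<Rightarrow> nat \<times> nat) set" where
  "good = {f \<in> bijections points slots. loop_free f \<and> cycle_free f}"

lemma points_iff: "(i, a) \<in> points \<longleftrightarrow> i \<in> {1..n} \<and> a < k i"
  by (auto simp: points_def)

lemma slots_iff: "(e, b) \<in> slots \<longleftrightarrow> e < m \<and> b < r"
  by (auto simp: slots_def)

lemma avoiding_eq_good: "avoiding (loops \<union> cycles) {} = good"
proof (intro equalityI subsetI)
  fix f assume f: "f \<in> avoiding (loops \<union> cycles) {}"
  then have fb: "f \<in> bijections points slots" and av: "\<And>\<chi>. \<chi> \<in> loops \<union> cycles \<Longrightarrow> \<not> agrees f \<chi>"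
    by (auto simp: avoiding_def)
  note F = bijectionsD[OF fb]
  have inj: "p = q" if "f p = f q" "p \<in> points" "q \<in> points" for p q
    using F(1) that by (rule inj_onD)
  have slot: "fst (f p) < m" "snd (f p) < r" if "p \<in> points" for p
    using F(4)[OF that] slots_iff[of "fst (f p)" "snd (f p)"] by auto
  have dp: "(snd (f p), snd (f q)) \<in> distinct_pairs r" if "p \<in> points" "q \<in> points" "fst (f p) = fst (f q)" "p \<noteq> q" for p q
    using slot[OF that(1)] slot[OF that(2)] inj[OF _ that(1,2)] that(3,4) by (auto simp: distinct_pairs_def prod_eq_iff)
  have loop: "loop_free f"
  proof (rule loop_freeI, rule ccontr)
    fix i a a' assume p: "(i, a) \<in> points" "(i, a') \<in> points" and e: "fst (f (i, a)) = fst (f (i, a'))"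
    assume "a \<noteq> a'"
    let ?\<chi> = "loop_pattern i a a' (fst (f (i, a))) (snd (f (i, a))) (snd (f (i, a')))"
    have "?\<chi> \<in> loops"
      unfolding loops_def using p slot[OF p(1)] dp[OF p e] \<open>a \<noteq> a'\<close>
      by (intro CollectI exI conjI) (auto simp: points_iff distinct_pairs_def)
    moreover have "agrees f ?\<chi>"
      using e by (simp add: loop_pattern_def prod_eq_iff)
    ultimately show False using av by blast
  qed
  have cycle: "cycle_free f"
  proof (rule cycle_freeI, rule ccontr)
    fix i j a a' d d' assume p: "(i, a) \<in> points" "(i, a') \<in> points" "(j, d) \<in> points" "(j, d') \<in> points"
      and e: "fst (f (i, a)) = fst (f (j, d))" "fst (f (i, a')) = fst (f (j, d'))" "fst (f (i, a)) \<noteq> fst (f (i, a'))"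
    assume ij: "i \<noteq> j"
    have ne: "a \<noteq> a'" "d \<noteq> d'" using e by auto
    let ?\<chi> = "cycle_pattern i a a' j d d' (fst (f (i, a))) (snd (f (i, a))) (snd (f (j, d))) (fst (f (i, a'))) (snd (f (j, d'))) (snd (f (i, a')))"
    have "cycle_tuple i a a' j d d' (fst (f (i, a))) (snd (f (i, a))) (snd (f (j, d))) (fst (f (i, a'))) (snd (f (j, d'))) (snd (f (i, a')))"
      using p slot[OF p(1)] slot[OF p(2)] dp[OF p(1) p(3)] dp[OF p(4) p(2)] ij ne e
      by (simp add: cycle_tuple_def points_iff distinct_pairs_def)
    then have "?\<chi> \<in> cycles" unfolding cycles_def by blast
    moreover have "agrees f ?\<chi>"
      using e by (simp add: cycle_pattern_def prod_eq_iff)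
    ultimately show False using av by blast
  qed
  show "f \<in> good" using fb loop cycle by (simp add: good_def)
next
  fix f assume f: "f \<in> good"
  then have fb: "f \<in> bijections points slots" "loop_free f" "cycle_free f" by (simp_all add: good_def)
  have "\<not> agrees f \<chi>" if "\<chi> \<in> loops \<union> cycles" for \<chi>
  proof
    assume ag: "agrees f \<chi>"
    from that show False
    proof
      assume "\<chi> \<in> loops"
      then obtain i a a' e b b' where \<chi>: "\<chi> = loop_pattern i a a' e b b'"
        "i \<in> {1..n}" "(a, a') \<in> distinct_pairs (k i)"
        unfolding loops_def by blast
      then have "f (i, a) = (e, b)" "f (i, a') = (e, b')" "a \<noteq> a'" "(i, a) \<in> points" "(i, a') \<in> points"
        using ag by (auto simp: loop_pattern_def distinct_pairs_def points_iff)
      then show False using loop_freeD[OF fb(2), of i a a'] by simp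
    next
      assume "\<chi> \<in> cycles"
      then obtain i a a' j d d' e b b' g c c' where \<chi>: "\<chi> = cycle_pattern i a a' j d d' e b b' g c c'"
        and t: "cycle_tuple i a a' j d d' e b b' g c c'"
        unfolding cycles_def by blast
      have v: "f (i, a) = (e, b)" "f (i, a') = (g, c')" "f (j, d) = (e, b')" "f (j, d') = (g, c)"
        using ag by (simp_all add: \<chi> cycle_pattern_def)
      from cycle_freeD[OF fb(3) cycle_tupleD(1,2,3,4)[OF t]] show False
        using v cycle_tuple_distinct[OF t] by simp
    qed
  qed
  then show "f \<in> avoiding (loops \<union> cycles) {}" using fb by (simp add: avoiding_def)
qed

text \<open>Linear hypergraphs have neither loops nor repeated edges, so sets can replace the
  multisets; \<open>card_linear_hypergraphs\<close> translates back.\<close>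

definition linear_edge_sets :: "nat set set set" where
  "linear_edge_sets = {E. (\<forall>e\<in>E. e \<subseteq> {1..n} \<and> card e = r) \<and>
     (\<forall>e\<in>E. \<forall>e'\<in>E. e \<noteq> e' \<longrightarrow> card (e \<inter> e') \<le> 1) \<and> (\<forall>i\<in>{1..n}. card {e \<in> E. i \<in> e} = k i)}"

lemma linear_edge_setsD:
  assumes "E \<in> linear_edge_sets"
  shows "finite E" "e \<in> E \<Longrightarrow> finite e" "e \<in> E \<Longrightarrow> e \<subseteq> {1..n}" "e \<in> E \<Longrightarrow> card e = r"
    "e \<in> E \<Longrightarrow> e' \<in> E \<Longrightarrow> i \<in> e \<Longrightarrow> j \<in> e \<Longrightarrow> i \<in> e' \<Longrightarrow> j \<in> e' \<Longrightarrow> i \<noteq> j \<Longrightarrow> e = e'"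
    "i \<in> {1..n} \<Longrightarrow> card {e \<in> E. i \<in> e} = k i"
proof -
  show *: "e \<subseteq> {1..n}" if "e \<in> E" for e using assms that by (auto simp: linear_edge_sets_def)
  then show fe: "finite e" if "e \<in> E" for e using that finite_subset by blast
  have "E \<subseteq> Pow {1..n}" using * by blast
  then show "finite E" by (rule finite_subset) simp
  show "card e = r" if "e \<in> E" for e using assms that by (auto simp: linear_edge_sets_def)
  show "card {e \<in> E. i \<in> e} = k i" if "i \<in> {1..n}" for i using assms that by (simp add: linear_edge_sets_def)
  show "e = e'" if "e \<in> E" "e' \<in> E" "i \<in> e" "j \<in> e" "i \<in> e'" "j \<in> e'" "i \<noteq> j" for e e' i j
  proof (rule ccontr)
    assume "e \<noteq> e'"
    then have "card (e \<inter> e') \<le> Suc 0" using assms that by (simp add: linear_edge_sets_def)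
    then show False using that fe[OF that(1)] by (subst (asm) card_le_Suc0_iff_eq) auto
  qed
qed

text \<open>Double counting of incident pairs of a vertex and an edge.\<close>

lemma card_linear_edge_set:
  assumes "E \<in> linear_edge_sets" "r > 0"
  shows "card E = m"
proof -
  note E = linear_edge_setsD[OF assms(1)]
  have "card E * r = (\<Sum>e\<in>E. card e)" using E(4) by simp
  also have "\<dots> = (\<Sum>e\<in>E. \<Sum>i = 1..n. if i \<in> e then 1 else 0)"
  proof (rule sum.cong)
    fix e assume "e \<in> E"
    then have "{1..n} \<inter> e = e" using E(3) by blast
    then show "card e = (\<Sum>i = 1..n. if i \<in> e then 1 else 0)" by (simp add: sum.If_cases)
  qed simp
  also have "\<dots> = (\<Sum>i = 1..n. \<Sum>e\<in>E. if i \<in> e then 1 else 0)" by (rule sum.swap)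
  also have "\<dots> = (\<Sum>i = 1..n. k i)"
  proof (rule sum.cong)
    fix i assume "i \<in> {1..n}"
    then show "(\<Sum>e\<in>E. if i \<in> e then 1 else 0) = k i"
      using E(1,6) by (simp add: sum.If_cases Collect_conj_eq Int_commute)
  qed simp
  finally show ?thesis using sum_degrees assms(2) by simp
qed

section \<open>The edge set of a good bijection\<close>

definition edge_of :: "((nat \<times> nat) \<Rightarrow> nat \<times> nat) \<Rightarrow> nat \<Rightarrow> nat set" where
  "edge_of f t = {i. \<exists>a. (i, a) \<in> points \<and> fst (f (i, a)) = t}"

lemma goodD:
  assumes "f \<in> good"
  shows "f \<in> bijections points slots"
    "(i, a) \<in> points \<Longrightarrow> (i, a') \<in> points \<Longrightarrow> fst (f (i, a)) = fst (f (i, a')) \<Longrightarrow> a = a'"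
    "i \<in> edge_of f t \<Longrightarrow> j \<in> edge_of f t \<Longrightarrow> i \<in> edge_of f u \<Longrightarrow> j \<in> edge_of f u \<Longrightarrow> t \<noteq> u \<Longrightarrow> i = j"
    "p \<in> points \<Longrightarrow> fst (f p) < m" "p \<in> points \<Longrightarrow> snd (f p) < r"
    "p \<in> points \<Longrightarrow> q \<in> points \<Longrightarrow> f p = f q \<Longrightarrow> p = q"
    "t < m \<Longrightarrow> b < r \<Longrightarrow> \<exists>i a. (i, a) \<in> points \<and> f (i, a) = (t, b)"
proof -
  show fb: "f \<in> bijections points slots" using assms by (simp add: good_def)
  show "a = a'" if "(i, a) \<in> points" "(i, a') \<in> points" "fst (f (i, a)) = fst (f (i, a'))" for i a a'
    using assms that loop_freeD by (auto simp: good_def)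
  show "i = j" if "i \<in> edge_of f t" "j \<in> edge_of f t" "i \<in> edge_of f u" "j \<in> edge_of f u" "t \<noteq> u" for i j t u
  proof -
    from that obtain a d a' d' where *: "(i, a) \<in> points" "(j, d) \<in> points" "(i, a') \<in> points" "(j, d') \<in> points"
      "fst (f (i, a)) = t" "fst (f (j, d)) = t" "fst (f (i, a')) = u" "fst (f (j, d')) = u"
      unfolding edge_of_def by blast
    show ?thesis using assms *(5-8) that(5) cycle_freeD[of f, OF _ *(1,3,2,4)] by (simp add: good_def)
  qed
  show "fst (f p) < m" "snd (f p) < r" if "p \<in> points" for p
    using bijectionsD(4)[OF fb that] slots_iff[of "fst (f p)" "snd (f p)"] by auto
  show "p = q" if "p \<in> points" "q \<in> points" "f p = f q" for p q
    using bijectionsD(1)[OF fb] that by (simp add: inj_on_def)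
  show "\<exists>i a. (i, a) \<in> points \<and> f (i, a) = (t, b)" if "t < m" "b < r"
  proof -
    have "(t, b) \<in> f ` points" using bijectionsD(2)[OF fb] that by (simp add: slots_iff)
    then show ?thesis by (metis imageE prod.exhaust)
  qed
qed

lemma edge_of_subset: "edge_of f t \<subseteq> {1..n}"
  by (auto simp: edge_of_def points_iff)

lemma edge_of_fst: "(i, a) \<in> points \<Longrightarrow> i \<in> edge_of f (fst (f (i, a)))"
  by (auto simp: edge_of_def)

text \<open>The slot of vertex \<open>i\<close> in edge \<open>t\<close>. For a good
  \<open>f\<close> and a vertex of that edge the chosen point is unique, by loop-freeness.\<close>

definition position :: "((nat \<times> nat) \<Rightarrow> nat \<times> nat) \<Rightarrow> nat \<Rightarrow> nat \<Rightarrow> nat" where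
  "position f t i = snd (f (i, SOME a. (i, a) \<in> points \<and> fst (f (i, a)) = t))"

lemma position_eq:
  assumes "f \<in> good" "(i, a) \<in> points"
  shows "position f (fst (f (i, a))) i = snd (f (i, a))"
proof -
  have "(SOME a'. (i, a') \<in> points \<and> fst (f (i, a')) = fst (f (i, a))) = a"
    using goodD(2)[OF assms(1)] assms(2) by (intro some_equality) auto
  then show ?thesis by (simp add: position_def)
qed

lemma position_bij:
  assumes f: "f \<in> good" and t: "t < m"
  shows "bij_betw (position f t) (edge_of f t) {..<r}"
  unfolding bij_betw_def
proof
  have pos: "\<exists>a. (i, a) \<in> points \<and> f (i, a) = (t, position f t i)" if "i \<in> edge_of f t" for i
    using that position_eq[OF f] by (auto simp: edge_of_def prod_eq_iff)
  show "inj_on (position f t) (edge_of f t)"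
  proof (rule inj_onI)
    fix i j assume "i \<in> edge_of f t" "j \<in> edge_of f t" and eq: "position f t i = position f t j"
    then obtain a d where "(i, a) \<in> points" "(j, d) \<in> points" "f (i, a) = f (j, d)"
      using pos by metis
    then show "i = j" using goodD(6)[OF f] by blast
  qed
  show "position f t ` edge_of f t = {..<r}"
  proof (intro equalityI subsetI)
    fix b assume "b \<in> position f t ` edge_of f t"
    then show "b \<in> {..<r}" using pos goodD(5)[OF f] by fastforce
  next
    fix b assume "b \<in> {..<r}"
    then obtain i a where p: "(i, a) \<in> points" "f (i, a) = (t, b)" using goodD(7)[OF f t, of b] by auto
    then have "position f t i = b" "i \<in> edge_of f t"
      using position_eq[OF f p(1)] edge_of_fst[OF p(1), of f] by auto
    then show "b \<in> position f t ` edge_of f t" by blast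
  qed
qed

text \<open>Two equal edges would have r >= 2 common vertices, which \<open>cycle_free\<close>
  forbids. This is how repeated edges are excluded.\<close>

lemma inj_edge_of:
  assumes f: "f \<in> good" and r: "r \<ge> 2"
  shows "inj_on (edge_of f) {..<m}"
proof (rule inj_onI, rule ccontr)
  fix t u assume tu: "t \<in> {..<m}" "u \<in> {..<m}" "edge_of f t = edge_of f u" "t \<noteq> u"
  have "card (edge_of f t) = r" using bij_betw_same_card[OF position_bij[OF f, of t]] tu by simp
  moreover have "finite (edge_of f t)" using edge_of_subset finite_subset by blast
  moreover have "card (edge_of f t) \<le> Suc 0"
    using calculation(2) goodD(3)[OF f, of _ t _ u] tu by (subst card_le_Suc0_iff_eq) auto
  ultimately show False using r by simp
qed

lemma incident_edges_bij:
  assumes f: "f \<in> good" and r: "r \<ge> 2" and i: "i \<in> {1..n}"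
  shows "bij_betw (\<lambda>a. edge_of f (fst (f (i, a)))) {..<k i} {e \<in> edge_of f ` {..<m}. i \<in> e}"
  unfolding bij_betw_def
proof
  have p: "(i, a) \<in> points" if "a < k i" for a using that i by (simp add: points_iff)
  show "inj_on (\<lambda>a. edge_of f (fst (f (i, a)))) {..<k i}"
  proof (rule inj_onI)
    fix a a' assume a: "a \<in> {..<k i}" "a' \<in> {..<k i}" "edge_of f (fst (f (i, a))) = edge_of f (fst (f (i, a')))"
    then have "fst (f (i, a)) = fst (f (i, a'))"
      using inj_onD[OF inj_edge_of[OF f r] a(3)] goodD(4)[OF f] p by simp
    then show "a = a'" using goodD(2)[OF f] p a by blast
  qed
  show "(\<lambda>a. edge_of f (fst (f (i, a)))) ` {..<k i} = {e \<in> edge_of f ` {..<m}. i \<in> e}"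
  proof (intro equalityI subsetI)
    fix e assume "e \<in> (\<lambda>a. edge_of f (fst (f (i, a)))) ` {..<k i}"
    then show "e \<in> {e \<in> edge_of f ` {..<m}. i \<in> e}"
      using p goodD(4)[OF f] edge_of_fst by auto
  next
    fix e assume "e \<in> {e \<in> edge_of f ` {..<m}. i \<in> e}"
    then obtain t where t: "e = edge_of f t" "i \<in> edge_of f t" by blast
    then obtain a where "(i, a) \<in> points" "fst (f (i, a)) = t" by (auto simp: edge_of_def)
    then show "e \<in> (\<lambda>a. edge_of f (fst (f (i, a)))) ` {..<k i}" using t by (auto simp: points_iff)
  qed
qed

lemma edge_set_linear:
  assumes f: "f \<in> good" and r: "r \<ge> 2"
  shows "edge_of f ` {..<m} \<in> linear_edge_sets"
proof -
  have fin: "finite (edge_of f t)" for t using edge_of_subset finite_subset by blast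
  have 1: "card (edge_of f t) = r" if "t < m" for t
    using bij_betw_same_card[OF position_bij[OF f that]] by simp
  have 2: "card (edge_of f t \<inter> edge_of f u) \<le> Suc 0" if "edge_of f t \<noteq> edge_of f u" for t u
    using fin that goodD(3)[OF f, of _ t _ u] by (subst card_le_Suc0_iff_eq) auto
  have 3: "card {e \<in> edge_of f ` {..<m}. i \<in> e} = k i" if "i \<in> {1..n}" for i
    using bij_betw_same_card[OF incident_edges_bij[OF f r that]] by simp
  show ?thesis unfolding linear_edge_sets_def
    using 1 2 3 edge_of_subset by auto
qed

text \<open>A bijection with edge set \<open>E\<close> amounts to a numbering of the edges, an order of the vertices of each
  edge, and an order of the edges at each vertex.\<close>

definition labellings where
  "labellings E = bijections E {..<m} \<times> (\<Pi>\<^sub>E e\<in>E. bijections e {..<r}) \<times>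
     (\<Pi>\<^sub>E i\<in>{1..n}. bijections {..<k i} {e \<in> E. i \<in> e})"

text \<open>The edge of point \<open>a\<close> of vertex \<open>i\<close> is \<open>h i a\<close>;
  it receives the number given by \<open>g\<close>, and \<open>i\<close> receives a slot in it from
  the order \<open>\<beta>\<close>.\<close>

definition assignment where
  "assignment = (\<lambda>(g, \<beta>, h). restrict (\<lambda>(i, a). (g (h i a), \<beta> (h i a) i)) points)"

lemma card_labellings:
  assumes E: "E \<in> linear_edge_sets" and r: "r > 0"
  shows "card (labellings E) = fact m * (fact r ^ m * (\<Prod>i = 1..n. fact (k i)))"
proof -
  note D = linear_edge_setsD[OF E]
  note c = card_linear_edge_set[OF E r]
  have "card (bijections E {..<m}) = fact m" using D(1) c card_bijections[of E "{..<m}"] by simp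
  moreover have "card (\<Pi>\<^sub>E e\<in>E. bijections e {..<r}) = fact r ^ m"
    using D c by (simp add: card_PiE card_bijections)
  moreover have "card (\<Pi>\<^sub>E i\<in>{1..n}. bijections {..<k i} {e \<in> E. i \<in> e}) = (\<Prod>i = 1..n. fact (k i))"
    using D(1,6) by (simp add: card_PiE card_bijections)
  ultimately show ?thesis by (simp only: labellings_def card_cartesian_product)
qed

lemma labellingD:
  assumes "(g, \<beta>, h) \<in> labellings E"
  shows "g \<in> bijections E {..<m}" "e \<in> E \<Longrightarrow> \<beta> e \<in> bijections e {..<r}"
    "i \<in> {1..n} \<Longrightarrow> h i \<in> bijections {..<k i} {e \<in> E. i \<in> e}"
    "\<beta> \<in> extensional E" "h \<in> extensional {1..n}"
    "(i, a) \<in> points \<Longrightarrow> h i a \<in> E" "(i, a) \<in> points \<Longrightarrow> i \<in> h i a"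
    "(i, a) \<in> points \<Longrightarrow> (i, a') \<in> points \<Longrightarrow> h i a = h i a' \<Longrightarrow> a = a'"
    "e \<in> E \<Longrightarrow> i \<in> e \<Longrightarrow> i \<in> {1..n} \<Longrightarrow> \<exists>a. (i, a) \<in> points \<and> h i a = e"
    "e \<in> E \<Longrightarrow> g e < m" "e \<in> E \<Longrightarrow> e' \<in> E \<Longrightarrow> g e = g e' \<Longrightarrow> e = e'"
    "(i, a) \<in> points \<Longrightarrow> assignment (g, \<beta>, h) (i, a) = (g (h i a), \<beta> (h i a) i)"
proof -
  show g: "g \<in> bijections E {..<m}" and "\<beta> \<in> extensional E" and "h \<in> extensional {1..n}"
    using assms by (auto simp: labellings_def PiE_def)
  show "\<beta> e \<in> bijections e {..<r}" if "e \<in> E" for e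
    using assms that by (auto simp: labellings_def)
  show h: "h i \<in> bijections {..<k i} {e \<in> E. i \<in> e}" if "i \<in> {1..n}" for i
    using assms that by (auto simp: labellings_def)
  have "h i a \<in> {e \<in> E. i \<in> e}" if "(i, a) \<in> points" for i a
    using bijectionsD(4)[OF h, of i a] that by (simp add: points_iff)
  then show "(i, a) \<in> points \<Longrightarrow> h i a \<in> E" "(i, a) \<in> points \<Longrightarrow> i \<in> h i a" by auto
  show "(i, a) \<in> points \<Longrightarrow> (i, a') \<in> points \<Longrightarrow> h i a = h i a' \<Longrightarrow> a = a'"
    using bijectionsD(1)[OF h, of i] by (simp add: points_iff inj_on_def)
  show "\<exists>a. (i, a) \<in> points \<and> h i a = e" if "e \<in> E" "i \<in> e" "i \<in> {1..n}"
  proof -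
    have "e \<in> h i ` {..<k i}" using bijectionsD(2)[OF h[OF that(3)]] that by simp
    then show ?thesis using that(3) by (auto simp: points_iff)
  qed
  show "e \<in> E \<Longrightarrow> g e < m" using bijectionsD(4)[OF g, of e] by simp
  show "e \<in> E \<Longrightarrow> e' \<in> E \<Longrightarrow> g e = g e' \<Longrightarrow> e = e'" using bijectionsD(1)[OF g] by (simp add: inj_on_def)
  show "(i, a) \<in> points \<Longrightarrow> assignment (g, \<beta>, h) (i, a) = (g (h i a), \<beta> (h i a) i)"
    by (simp add: assignment_def)
qed

text \<open>The bijection retains its edges: this makes the images of different edge sets disjoint
  and lets the numbering \<open>g\<close> be recovered.\<close>

lemma edge_of_assignment:
  assumes E: "E \<in> linear_edge_sets" and x: "(g, \<beta>, h) \<in> labellings E" and e: "e \<in> E"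
  shows "edge_of (assignment (g, \<beta>, h)) (g e) = e"
proof (intro equalityI subsetI)
  note X = labellingD[OF x]
  fix i assume "i \<in> edge_of (assignment (g, \<beta>, h)) (g e)"
  then obtain a where a: "(i, a) \<in> points" "g (h i a) = g e" using X(12) by (auto simp: edge_of_def)
  then have "h i a = e" using X(6,11) e by blast
  then show "i \<in> e" using X(7)[OF a(1)] by simp
next
  note X = labellingD[OF x]
  fix i assume i: "i \<in> e"
  then have "i \<in> {1..n}" using linear_edge_setsD(3)[OF E e] by blast
  then obtain a where "(i, a) \<in> points" "h i a = e" using X(9)[OF e i] by blast
  then show "i \<in> edge_of (assignment (g, \<beta>, h)) (g e)" using X(12) by (auto simp: edge_of_def)
qed

lemma assignment_good:
  assumes E: "E \<in> linear_edge_sets" and x: "(g, \<beta>, h) \<in> labellings E"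
  shows "assignment (g, \<beta>, h) \<in> good" "edge_of (assignment (g, \<beta>, h)) ` {..<m} = E"
proof -
  note X = labellingD[OF x]
  let ?f = "assignment (g, \<beta>, h)"
  have inj: "inj_on ?f points"
  proof (rule inj_onI, clarify)
    fix i a j d assume p: "(i, a) \<in> points" "(j, d) \<in> points" and eq: "?f (i, a) = ?f (j, d)"
    then have e: "h i a = h j d" using X(12)[OF p(1)] X(12)[OF p(2)] X(6,11) by simp
    then have "\<beta> (h i a) i = \<beta> (h i a) j" using eq X(12)[OF p(1)] X(12)[OF p(2)] by simp
    moreover have "j \<in> h i a" "i \<in> h i a" using X(7)[OF p(1)] X(7)[OF p(2)] e by simp_all
    ultimately have "i = j" using bijectionsD(1)[OF X(2)[OF X(6)[OF p(1)]]] by (simp add: inj_on_def)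
    then show "i = j \<and> a = d" using X(8) p e by blast
  qed
  have sub: "?f ` points \<subseteq> slots"
  proof (rule image_subsetI)
    fix q assume "q \<in> points"
    moreover obtain i a where q: "q = (i, a)" by (cases q)
    ultimately have p: "(i, a) \<in> points" by simp
    have "\<beta> (h i a) i \<in> {..<r}" using bijectionsD(4)[OF X(2)[OF X(6)[OF p]] X(7)[OF p]] .
    then show "?f q \<in> slots" unfolding q using X(12)[OF p] X(10)[OF X(6)[OF p]] by (simp add: slots_iff)
  qed
  \<comment> \<open>An injection between sets of the same size is onto.\<close>
  have "?f ` points = slots"
    using sub card_image[OF inj] card_points card_slots finite_slots by (intro card_subset_eq) auto
  then have fb: "?f \<in> bijections points slots"
    using inj by (simp add: bijections_def bij_betw_def assignment_def)
  have loop: "loop_free ?f"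
  proof (rule loop_freeI)
    fix i a a' assume p: "(i, a) \<in> points" "(i, a') \<in> points" and e: "fst (?f (i, a)) = fst (?f (i, a'))"
    show "a = a'"
      using e X(12)[OF p(1)] X(12)[OF p(2)] X(11) X(6)[OF p(1)] X(6)[OF p(2)] X(8)[OF p] by simp
  qed
  have cyc: "cycle_free ?f"
  proof (rule cycle_freeI, rule ccontr)
    fix i j a a' d d' assume p: "(i, a) \<in> points" "(i, a') \<in> points" "(j, d) \<in> points" "(j, d') \<in> points"
      and e: "fst (?f (i, a)) = fst (?f (j, d))" "fst (?f (i, a')) = fst (?f (j, d'))" "fst (?f (i, a)) \<noteq> fst (?f (i, a'))"
      and ij: "i \<noteq> j"
    \<comment> \<open>The two different edges \<open>h i a\<close> and \<open>h i a'\<close> both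
      contain \<open>i\<close> and \<open>j\<close>, against linearity.\<close>
    have "h i a = h j d" "h i a' = h j d'" "h i a \<noteq> h i a'"
      using e X(12) X(11) X(6) p by auto
    then show False
      using linear_edge_setsD(5)[OF E X(6)[OF p(1)] X(6)[OF p(2)], of i j] X(7) p ij by metis
  qed
  show "?f \<in> good" using fb loop cyc by (simp add: good_def)
  have "g ` E = {..<m}" using bijectionsD(2)[OF X(1)] .
  then have "edge_of ?f ` {..<m} = (\<lambda>e. edge_of ?f (g e)) ` E" by (metis image_image)
  also have "\<dots> = E" using edge_of_assignment[OF E x] by simp
  finally show "edge_of ?f ` {..<m} = E" .
qed

text \<open>The components are recovered in turn: \<open>g\<close> from the vertex sets of the
  numbered edges, then \<open>h\<close> from the edge numbers because \<open>g\<close> is injective,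
  and finally \<open>\<beta>\<close> from the slots.\<close>

lemma inj_assignment:
  assumes E: "E \<in> linear_edge_sets"
  shows "inj_on assignment (labellings E)"
proof (rule inj_onI)
  fix x y assume x: "x \<in> labellings E" and y: "y \<in> labellings E" and eq: "assignment x = assignment y"
  obtain g \<beta> h g' \<beta>' h' where xy: "x = (g, \<beta>, h)" "y = (g', \<beta>', h')" by (metis prod.exhaust)
  note x = x[unfolded xy] and y = y[unfolded xy] and eq = eq[unfolded xy]
  note X = labellingD[OF x] and Y = labellingD[OF y]
  have gg: "g e = g' e" if e: "e \<in> E" for e
  proof -
    have "g e \<in> g' ` E" using bijectionsD(2)[OF Y(1)] X(10)[OF e] by simp
    then obtain e' where e': "e' \<in> E" "g e = g' e'" by blast
    have "e = e'" using edge_of_assignment[OF E x e] edge_of_assignment[OF E y e'(1)] e'(2) eq by simp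
    then show ?thesis using e' by simp
  qed
  then have "g = g'" using bijectionsD(3)[OF X(1)] bijectionsD(3)[OF Y(1)] by (intro extensionalityI)
  have hh: "h i a = h' i a" if p: "(i, a) \<in> points" for i a
    using eq X(12)[OF p] Y(12)[OF p] \<open>g = g'\<close> X(11) X(6)[OF p] Y(6)[OF p] by simp
  have "h = h'"
  proof (rule extensionalityI[OF X(5) Y(5)])
    fix i assume i: "i \<in> {1..n}"
    show "h i = h' i"
      using bijectionsD(3)[OF X(3)[OF i]] bijectionsD(3)[OF Y(3)[OF i]] hh i
      by (intro extensionalityI) (auto simp: points_iff)
  qed
  have "\<beta> = \<beta>'"
  proof (rule extensionalityI[OF X(4) Y(4)])
    fix e assume e: "e \<in> E"
    show "\<beta> e = \<beta>' e"
    proof (rule extensionalityI[OF bijectionsD(3)[OF X(2)[OF e]] bijectionsD(3)[OF Y(2)[OF e]]])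
      fix i assume i: "i \<in> e"
      then have "i \<in> {1..n}" using linear_edge_setsD(3)[OF E e] by blast
      then obtain a where a: "(i, a) \<in> points" "h i a = e" using X(9)[OF e i] by blast
      then show "\<beta> e i = \<beta>' e i" using eq X(12)[OF a(1)] Y(12)[OF a(1)] \<open>h = h'\<close> by simp
    qed
  qed
  then show "x = y" using xy \<open>g = g'\<close> \<open>h = h'\<close> by simp
qed

lemma assignment_surj:
  assumes f: "f \<in> good" and r: "r \<ge> 2"
  shows "f \<in> assignment ` labellings (edge_of f ` {..<m})"
proof -
  let ?E = "edge_of f ` {..<m}"
  define g where "g = restrict (inv_into {..<m} (edge_of f)) ?E"
  define \<beta> where "\<beta> = restrict (\<lambda>e. restrict (position f (g e)) e) ?E"
  define h where "h = restrict (\<lambda>i. restrict (\<lambda>a. edge_of f (fst (f (i, a)))) {..<k i}) {1..n}"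
  note inj = inj_edge_of[OF f r]
  have g: "g (edge_of f t) = t" if "t < m" for t
    using that inj by (simp add: g_def inv_into_f_f)
  have "bij_betw (inv_into {..<m} (edge_of f)) ?E {..<m}"
    using inj by (intro bij_betw_inv_into) (simp add: bij_betw_def)
  then have "g \<in> bijections ?E {..<m}"
    unfolding g_def by (rule restrict_bijections)
  moreover have "\<beta> \<in> (\<Pi>\<^sub>E e\<in>?E. bijections e {..<r})"
  proof (rule PiE_I)
    fix e assume "e \<in> ?E"
    then obtain t where t: "e = edge_of f t" "t < m" by blast
    then have "\<beta> e = restrict (position f t) (edge_of f t)" by (simp add: \<beta>_def g)
    then show "\<beta> e \<in> bijections e {..<r}"
      using restrict_bijections[OF position_bij[OF f t(2)]] t by simp
  qed (simp add: \<beta>_def)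
  moreover have "h \<in> (\<Pi>\<^sub>E i\<in>{1..n}. bijections {..<k i} {e \<in> ?E. i \<in> e})"
  proof (rule PiE_I)
    fix i assume i: "i \<in> {1..n}"
    then have "h i = restrict (\<lambda>a. edge_of f (fst (f (i, a)))) {..<k i}" by (simp add: h_def)
    then show "h i \<in> bijections {..<k i} {e \<in> ?E. i \<in> e}"
      using restrict_bijections[OF incident_edges_bij[OF f r i]] by simp
  qed (auto simp: h_def)
  ultimately have x: "(g, \<beta>, h) \<in> labellings ?E" by (simp add: labellings_def)
  have "f = assignment (g, \<beta>, h)"
  proof (rule extensionalityI[of _ points])
    show "f \<in> extensional points" using bijectionsD(3)[OF goodD(1)[OF f]] .
    show "assignment (g, \<beta>, h) \<in> extensional points" by (simp add: assignment_def)
    fix p assume "p \<in> points"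
    then obtain i a where p: "p = (i, a)" "(i, a) \<in> points" by (cases p) auto
    then have i: "i \<in> {1..n}" "a < k i" by (simp_all add: points_iff)
    let ?t = "fst (f (i, a))"
    have t: "?t < m" by (rule goodD(4)[OF f p(2)])
    have h: "h i a = edge_of f ?t" using i by (simp add: h_def)
    have "\<beta> (h i a) i = position f ?t i"
      using t edge_of_fst[OF p(2), of f] by (simp add: \<beta>_def h g)
    also have "\<dots> = snd (f (i, a))" by (rule position_eq[OF f p(2)])
    finally have "assignment (g, \<beta>, h) p = (?t, snd (f (i, a)))"
      using p t by (simp add: assignment_def h g)
    then show "f p = assignment (g, \<beta>, h) p" using p by simp
  qed
  then show ?thesis using x by (rule image_eqI)
qed

text \<open>Good bijections are partitioned by their edge sets, and all classes have the same size,
  that of \<open>labellings\<close>.\<close>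

lemma card_good:
  assumes r: "r \<ge> 2"
  shows "card good = card linear_edge_sets * (fact m * (fact r ^ m * (\<Prod>i = 1..n. fact (k i))))"
proof -
  have finL: "finite linear_edge_sets"
  proof (rule finite_subset)
    show "linear_edge_sets \<subseteq> Pow (Pow {1..n})" using linear_edge_setsD(3) by blast
  qed simp
  have fing: "finite good"
    by (rule finite_subset[OF _ finite_bijections[OF finite_points finite_slots]]) (auto simp: good_def)
  have "good = (\<Union>E\<in>linear_edge_sets. assignment ` labellings E)"
  proof (intro equalityI subsetI)
    fix f assume "f \<in> good"
    then show "f \<in> (\<Union>E\<in>linear_edge_sets. assignment ` labellings E)"
      using assignment_surj edge_set_linear r by blast
  next
    fix f assume "f \<in> (\<Union>E\<in>linear_edge_sets. assignment ` labellings E)"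
    then show "f \<in> good" using assignment_good(1) by auto
  qed
  moreover have "card (\<Union>E\<in>linear_edge_sets. assignment ` labellings E) = (\<Sum>E\<in>linear_edge_sets. card (assignment ` labellings E))"
  proof (rule card_UN_disjoint[OF finL])
    show "\<forall>E\<in>linear_edge_sets. finite (assignment ` labellings E)"
      using fing assignment_good(1) by (auto intro!: finite_subset[OF _ fing])
    show "\<forall>E\<in>linear_edge_sets. \<forall>E'\<in>linear_edge_sets. E \<noteq> E' \<longrightarrow> assignment ` labellings E \<inter> assignment ` labellings E' = {}"
    proof (intro ballI impI, rule ccontr)
      fix E E' assume E: "E \<in> linear_edge_sets" "E' \<in> linear_edge_sets" "E \<noteq> E'"
        "assignment ` labellings E \<inter> assignment ` labellings E' \<noteq> {}"
      then obtain x y where "x \<in> labellings E" "y \<in> labellings E'" "assignment x = assignment y" by auto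
      then show False using assignment_good(2)[OF E(1)] assignment_good(2)[OF E(2)] E(3)
        by (metis prod.exhaust)
    qed
  qed
  moreover have "card (assignment ` labellings E) = fact m * (fact r ^ m * (\<Prod>i = 1..n. fact (k i)))"
    if "E \<in> linear_edge_sets" for E
    using card_image[OF inj_assignment[OF that]] card_labellings[OF that] r by simp
  ultimately show ?thesis by simp
qed

section \<open>The asymptotic formula\<close>

lemma linear_hypergraphs_of_edge_set:
  assumes E: "E \<in> linear_edge_sets"
  shows "({1..n}, mset_set (mset_set ` E)) \<in> linear_hypergraphs n r k"
proof -
  note D = linear_edge_setsD[OF E]
  have inj: "inj_on mset_set E"
    using D(2) by (auto intro!: inj_onI dest: arg_cong[of _ _ set_mset])
  have fin: "finite (mset_set ` E)" using D(1) by simp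
  have card_int: "card (e \<inter> e') \<le> 1" if "e \<in> E" "e' \<in> E" "e \<noteq> e'" for e e'
    using E that by (simp add: linear_edge_sets_def)
  have "hypergraph_degree ({1..n}, mset_set (mset_set ` E)) j = k j" if j: "j \<in> {1..n}" for j
  proof -
    have "hypergraph_degree ({1..n}, mset_set (mset_set ` E)) j = card {x \<in> mset_set ` E. j \<in># x}"
      using fin by (simp add: hypergraph_degree_def)
    also have "{x \<in> mset_set ` E. j \<in># x} = mset_set ` {e \<in> E. j \<in> e}" using D(2) by auto
    also have "card \<dots> = card {e \<in> E. j \<in> e}" by (rule card_image) (rule inj_on_subset[OF inj], auto)
    finally show ?thesis using D(6)[OF j] by simp
  qed
  moreover have "hypergraph ({1..n}, mset_set (mset_set ` E))"
    using D(2,3) fin by (auto simp: hypergraph_def)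
  moreover have "uniform_hypergraph r ({1..n}, mset_set (mset_set ` E))"
    using D(4) fin by (auto simp: uniform_hypergraph_def)
  moreover have "linear_hypergraph ({1..n}, mset_set (mset_set ` E))"
    using fin D(2) card_int
    by (auto simp: linear_hypergraph_def simple_hypergraph_def loop_in_def count_mset_set')
  ultimately show ?thesis by (simp add: linear_hypergraphs_def)
qed

lemma edge_set_of_linear_hypergraphs:
  assumes H: "H \<in> linear_hypergraphs n r k"
  shows "set_mset ` set_mset (snd H) \<in> linear_edge_sets"
    "H = ({1..n}, mset_set (mset_set ` set_mset ` set_mset (snd H)))"
proof -
  let ?S = "set_mset (snd H)"
  have H': "fst H = {1..n}" "\<And>e. e \<in> ?S \<Longrightarrow> set_mset e \<subseteq> {1..n}" "\<And>e v. e \<in> ?S \<Longrightarrow> count e v < 2"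
    "\<And>e. e \<in> ?S \<Longrightarrow> count (snd H) e = 1" "\<And>e. e \<in> ?S \<Longrightarrow> size e = r"
    "\<And>e f. e \<in> ?S \<Longrightarrow> f \<in> ?S \<Longrightarrow> e \<noteq> f \<Longrightarrow> card (set_mset e \<inter> set_mset f) \<le> 1"
    "\<And>j. j \<in> {1..n} \<Longrightarrow> hypergraph_degree H j = k j"
    using H by (auto simp: linear_hypergraphs_def hypergraph_def linear_hypergraph_def simple_hypergraph_def
        uniform_hypergraph_def loop_in_def not_le)
  have e: "mset_set (set_mset e) = e" if "e \<in> ?S" for e
  proof (rule multiset_eqI)
    fix v show "count (mset_set (set_mset e)) v = count e v"
    proof (cases "v \<in># e")
      case True
      then have "count e v > 0" by simp
      with H'(3)[OF that, of v] have "count e v = 1" by linarith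
      then show ?thesis using True by simp
    qed (simp add: not_in_iff)
  qed
  have "mset_set ?S = snd H"
  proof (rule multiset_eqI)
    fix x show "count (mset_set ?S) x = count (snd H) x"
      using H'(4)[of x] by (cases "x \<in># snd H") (auto simp: not_in_iff)
  qed
  moreover have "mset_set ` set_mset ` ?S = ?S" using e by (auto simp: image_image)
  ultimately show "H = ({1..n}, mset_set (mset_set ` set_mset ` ?S))" using H'(1) by (metis prod.collapse)
  have inj: "inj_on set_mset ?S" using e by (metis inj_onI)
  have "card (set_mset e) = r" if "e \<in> ?S" for e
    using arg_cong[OF e[OF that], of size] H'(5)[OF that] by simp
  moreover have "card {e \<in> set_mset ` ?S. i \<in> e} = k i" if i: "i \<in> {1..n}" for i
  proof -
    have "{e \<in> set_mset ` ?S. i \<in> e} = set_mset ` {e \<in> ?S. i \<in># e}" by auto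
    then have "card {e \<in> set_mset ` ?S. i \<in> e} = card {e \<in> ?S. i \<in># e}"
      using card_image[OF inj_on_subset[OF inj], of "{e \<in> ?S. i \<in># e}"] by auto
    also have "\<dots> = size (filter_mset (\<lambda>e. i \<in># e) (mset_set ?S))" by simp
    also have "\<dots> = hypergraph_degree H i" by (simp only: \<open>mset_set ?S = snd H\<close> hypergraph_degree_def)
    finally show ?thesis using H'(7)[OF i] by simp
  qed
  moreover have "card (e \<inter> f) \<le> 1" if "e \<in> set_mset ` ?S" "f \<in> set_mset ` ?S" "e \<noteq> f" for e f
    using that H'(6) by auto
  ultimately show "set_mset ` ?S \<in> linear_edge_sets"
    using H'(2) by (auto simp: linear_edge_sets_def)
qed

lemma card_linear_hypergraphs: "card (linear_hypergraphs n r k) = card linear_edge_sets"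
proof -
  have "bij_betw (\<lambda>E. ({1..n}, mset_set (mset_set ` E))) linear_edge_sets (linear_hypergraphs n r k)"
    unfolding bij_betw_def
  proof
    show "inj_on (\<lambda>E. ({1..n}, mset_set (mset_set ` E))) linear_edge_sets"
    proof (rule inj_onI)
      have 1: "set_mset ` set_mset (mset_set (mset_set ` E)) = E" if "E \<in> linear_edge_sets" for E
        using linear_edge_setsD(1,2)[OF that] by (simp add: image_image)
      fix E E' assume "E \<in> linear_edge_sets" "E' \<in> linear_edge_sets"
        "({1..n}, mset_set (mset_set ` E)) = ({1..n}, mset_set (mset_set ` E'))"
      then show "E = E'" using 1 by (metis prod.inject)
    qed
    show "(\<lambda>E. ({1..n}, mset_set (mset_set ` E))) ` linear_edge_sets = linear_hypergraphs n r k"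
      using linear_hypergraphs_of_edge_set edge_set_of_linear_hypergraphs by blast
  qed
  then show ?thesis using bij_betw_same_card by fastforce
qed

end

text \<open>The formula for a single n with explicit constants, so that only the choice of large n
  remains for the theorem. The assumption \<open>small\<close> is the condition 1256
  \<open>\<delta>\<close> <= 1 of \<open>avoiding_count\<close>.\<close>

lemma linear_hypergraphs_count:
  fixes n r :: nat and k :: "nat \<Rightarrow> nat"
  defines "M \<equiv> deg_sum n k" and "M2 \<equiv> deg_sum2 n k" and "K \<equiv> deg_max n k"
  assumes r: "r \<ge> 3" "r dvd M" and M: "M \<ge> 128" and small: "1256 * (real K ^ 2 * real r ^ 2 / real M) \<le> 1"
  shows "\<exists>\<epsilon>. \<bar>\<epsilon>\<bar> \<le> 3000 * (real K ^ 4 * real r ^ 4 / real M) \<and>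
    real (card (linear_hypergraphs n r k)) =
      fact M / (fact (M div r) * fact r ^ (M div r) * (\<Prod>i = 1..n. fact (k i))) *
      exp (- ((real r - 1) * real M2 / (2 * real M)) - (real r - 1)\<^sup>2 * (real M2)\<^sup>2 / (4 * (real M)\<^sup>2) + \<epsilon>)"
proof -
  define m where "m = M div r"
  have mr: "m * r = M" using r by (simp add: m_def)
  have k_le: "k i \<le> K" if "i \<in> {1..n}" for i
    unfolding K_def deg_max_def using that by (intro Max_ge) auto
  interpret degree_model n r m K k
    by unfold_locales (use k_le mr in \<open>simp_all add: M_def deg_sum_def\<close>)
  have K: "K \<ge> 1"
  proof (rule ccontr)
    assume "\<not> K \<ge> 1"
    then have "k j = 0" if "j \<in> {1..n}" for j using k_le[OF that] by simp
    then have "(\<Sum>j = 1..n. k j) = 0" by (intro sum.neutral) blast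
    then show False using M by (simp add: M_def deg_sum_def)
  qed
  have M': "m * r \<ge> 128" using M mr by simp
  have small': "1256 * (real K ^ 2 * real r ^ 2 / real (m * r)) \<le> 1" using small by (simp only: mr)
  obtain \<epsilon> where \<epsilon>: "N (loops \<union> cycles) {} = fact (m * r) * exp (- expected + \<epsilon>)"
    "\<bar>\<epsilon>\<bar> \<le> 3000 * (real K ^ 2 * real r ^ 2 / real (m * r) * (real K ^ 2 * real r ^ 2))"
    using avoiding_count[OF M' K small'] by blast
  have "real K ^ 2 * real r ^ 2 / real (m * r) * (real K ^ 2 * real r ^ 2) = real K ^ 4 * real r ^ 4 / real M"
    unfolding mr by (simp add: power2_eq_square power4_eq_xxxx ac_simps)
  then have "\<bar>\<epsilon>\<bar> \<le> 3000 * (real K ^ 4 * real r ^ 4 / real M)" using \<epsilon>(2) by (simp only:)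
  moreover have "real (card (linear_hypergraphs n r k)) =
      fact M / (fact m * fact r ^ m * (\<Prod>i = 1..n. fact (k i))) * exp (- expected + \<epsilon>)"
  proof -
    let ?c = "fact m * fact r ^ m * (\<Prod>i = 1..n. fact (k i)) :: real"
    have c: "?c > 0" by (intro mult_pos_pos prod_pos) auto
    have "N (loops \<union> cycles) {} = real (card (linear_hypergraphs n r k)) * ?c"
      using r by (simp add: avoiding_eq_good card_good card_linear_hypergraphs mult.assoc)
    then have "real (card (linear_hypergraphs n r k)) * ?c = fact M * exp (- expected + \<epsilon>)"
      unfolding \<epsilon>(1) mr by (rule sym)
    then show ?thesis using c by (simp add: nonzero_eq_divide_eq)
  qed
  moreover have "expected = (real r - 1) * real M2 / (2 * real M) + (real r - 1)\<^sup>2 * (real M2)\<^sup>2 / (4 * (real M)\<^sup>2)"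
    by (simp only: expected_def mr M2_def deg_sum2_def)
  ultimately show ?thesis unfolding m_def by (intro exI[of _ \<epsilon>]) simp
qed

theorem theorem1p1:
  fixes r :: "nat \<Rightarrow> nat" and k :: "nat \<Rightarrow> nat \<Rightarrow> nat" and I :: "nat set"
  assumes "\<And>n. n \<ge> 3 \<Longrightarrow> r n \<ge> 3"
    and "I = {n. n \<ge> 3 \<and> r n dvd deg_sum n (k n)}"
    and "infinite I"
    and "filterlim (\<lambda>n. deg_sum n (k n)) at_top (along I)"
    and "(\<lambda>n. real (r n) ^ 4 * real (deg_max n (k n)) ^ 4 * (real (deg_max n (k n)) + real (r n)))
           \<in> o[along I](\<lambda>n. real (deg_sum n (k n)))"
  shows "\<exists>\<epsilon> :: nat \<Rightarrow> real.
    \<epsilon> \<in> O[along I](\<lambda>n. real (r n) ^ 4 * real (deg_max n (k n)) ^ 4 *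
                          (real (deg_max n (k n)) + real (r n)) / real (deg_sum n (k n))) \<and>
    (\<forall>\<^sub>F n in along I.
       real (card (linear_hypergraphs n (r n) (k n))) =
         fact (deg_sum n (k n)) /
           (fact (deg_sum n (k n) div r n) * fact (r n) ^ (deg_sum n (k n) div r n) * (\<Prod>i = 1..n. fact (k n i))) *
         exp (- ((real (r n) - 1) * real (deg_sum2 n (k n)) / (2 * real (deg_sum n (k n))))
              - (real (r n) - 1)\<^sup>2 * (real (deg_sum2 n (k n)))\<^sup>2 / (4 * (real (deg_sum n (k n)))\<^sup>2)
              + \<epsilon> n))"
proof -
  define M where "M n = deg_sum n (k n)" for n
  define K where "K n = deg_max n (k n)" for n
  define T where "T n = real (r n) ^ 4 * real (K n) ^ 4 * (real (K n) + real (r n))" for n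
  define P where "P n \<epsilon> \<longleftrightarrow> \<bar>\<epsilon>\<bar> \<le> 3000 * (T n / real (M n)) \<and>
     real (card (linear_hypergraphs n (r n) (k n))) =
         fact (M n) / (fact (M n div r n) * fact (r n) ^ (M n div r n) * (\<Prod>i = 1..n. fact (k n i))) *
         exp (- ((real (r n) - 1) * real (deg_sum2 n (k n)) / (2 * real (M n)))
              - (real (r n) - 1)\<^sup>2 * (real (deg_sum2 n (k n)))\<^sup>2 / (4 * (real (M n))\<^sup>2) + \<epsilon>)" for n \<epsilon>
  \<comment> \<open>Where no suitable value exists the choice is arbitrary; this is harmless, since
    both claims about \<open>\<epsilon>\<close> concern only n that are eventually reached along
    \<open>I\<close>.\<close>
  define \<epsilon> where "\<epsilon> n = (SOME \<epsilon>. P n \<epsilon>)" for n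
  have "\<forall>\<^sub>F n in along I. n \<in> I" by (simp add: along_def eventually_inf_principal)
  moreover have "\<forall>\<^sub>F n in along I. M n \<ge> 128"
    using assms(4) by (simp add: filterlim_at_top M_def)
  \<comment> \<open>The constant in the little-o condition is chosen to give the assumption
    \<open>small\<close> of \<open>linear_hypergraphs_count\<close>.\<close>
  moreover have "\<forall>\<^sub>F n in along I. norm (T n) \<le> (1 / 1256) * norm (real (M n))"
    using assms(5) unfolding T_def K_def M_def by (rule landau_o.smallD) simp
  ultimately have "\<forall>\<^sub>F n in along I. P n (\<epsilon> n)"
  proof eventually_elim
    case (elim n)
    then have n: "n \<ge> 3" "r n dvd M n" and r: "r n \<ge> 3"
      using assms(1,2) by (auto simp: M_def)
    have Mp: "real (M n) > 0" using elim by simp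
    have T0: "T n \<ge> 0" by (simp add: T_def)
    have r1: "real (r n) \<ge> 1" using r by simp
    \<comment> \<open>The factor K + r is at least 1, so the error obtained, of order K^4 r^4 / M,
      lies within the claimed one.\<close>
    have T4: "real (K n) ^ 4 * real (r n) ^ 4 \<le> T n"
    proof -
      have "real (r n) ^ 4 * real (K n) ^ 4 * 1 \<le> T n"
        unfolding T_def using r1 by (intro mult_left_mono) auto
      then show ?thesis by (simp add: mult.commute)
    qed
    \<comment> \<open>Raising the exponents requires K >= 1; for K = 0 both sides vanish.\<close>
    have "real (K n) ^ 2 * real (r n) ^ 2 \<le> real (K n) ^ 4 * real (r n) ^ 4"
    proof (cases "K n = 0")
      case False
      then show ?thesis using r1 by (intro mult_mono power_increasing) auto
    qed simp
    then have "real (K n) ^ 2 * real (r n) ^ 2 \<le> (1 / 1256) * real (M n)" using T4 elim(3) T0 Mp by simp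
    then have "1256 * (real (K n) ^ 2 * real (r n) ^ 2 / real (M n)) \<le> 1"
      using Mp by (simp add: field_simps)
    then have "\<exists>\<epsilon>. \<bar>\<epsilon>\<bar> \<le> 3000 * (real (K n) ^ 4 * real (r n) ^ 4 / real (M n)) \<and>
      real (card (linear_hypergraphs n (r n) (k n))) =
         fact (M n) / (fact (M n div r n) * fact (r n) ^ (M n div r n) * (\<Prod>i = 1..n. fact (k n i))) *
         exp (- ((real (r n) - 1) * real (deg_sum2 n (k n)) / (2 * real (M n)))
              - (real (r n) - 1)\<^sup>2 * (real (deg_sum2 n (k n)))\<^sup>2 / (4 * (real (M n))\<^sup>2) + \<epsilon>)"
      using r n elim(2) unfolding M_def K_def by (intro linear_hypergraphs_count) auto
    moreover have "3000 * (real (K n) ^ 4 * real (r n) ^ 4 / real (M n)) \<le> 3000 * (T n / real (M n))"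
      using T4 Mp by (intro mult_left_mono divide_right_mono) auto
    ultimately have "\<exists>\<epsilon>. P n \<epsilon>" unfolding P_def by (meson order_trans)
    then show ?case unfolding \<epsilon>_def by (rule someI_ex)
  qed
  then have "\<forall>\<^sub>F n in along I. norm (\<epsilon> n) \<le> 3000 * norm (T n / real (M n))"
    by eventually_elim (simp add: P_def T_def)
  then have "\<epsilon> \<in> O[along I](\<lambda>n. T n / real (M n))" by (rule bigoI)
  moreover note \<open>\<forall>\<^sub>F n in along I. P n (\<epsilon> n)\<close>
  ultimately show ?thesis
    unfolding T_def K_def M_def P_def by (intro exI[of _ \<epsilon>] conjI) (auto elim: eventually_mono)
qed

end
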